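(* Let $n\ge2$, $\mathbf t=(t_0,u_0,t,t_n,u_n)$ with $a,b,c,d,t>0$, where $(a,b,c,d)=(t_n+u_n,\,t_n-u_n,\,t_0+u_0+\tfrac12,\,t_0-u_0+\tfrac12)$, and let $\mathbf t^\sigma=(u_n,u_0,t,t_n,t_0)$. Write $\gamma_\lambda=\gamma_\lambda(\mathbf t)$ and $x_\mu=\gamma_\mu(\mathbf t^\sigma)$. Assume the parameters are generic in the sense that $\gamma_\lambda\ne\gamma_\mu$ and $x_\lambda\ne x_\mu$ for $\lambda\ne\mu$ in $\Lambda=\mathbb Z^n$, and that the symmetric multivariable Wilson polynomials $E^+(\cdot,\gamma_\lambda)$ for $\mathbf t$ (normalized to be $1$ at $x_0$) and $E^+_\sigma(\cdot,x_\mu)$ for $\mathbf t^\sigma$ (normalized to be $1$ at $\gamma_0$) are well defined for all $\lambda,\mu\in\Lambda^+$. Then for all $\lambda,\mu\in\Lambda^+$ $$E^+(x_\mu,\gamma_\lambda)=E^+_\sigma(\gamma_\lambda,x_\mu).$$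
   Context: Notation: $[m,n]=\{m,m+1,\dots,n\}$, $\mathcal P=\mathbb C[x_1,\dots,x_n]$, $\Lambda=\mathbb Z^n$, $\Lambda^+=\{\lambda\in\Lambda\mid\lambda_1\ge\dots\ge\lambda_n\ge0\}$. $W$ is the affine Weyl group of type $\widetilde C_n$, the Coxeter group with generators $s_0,\dots,s_n$, realized faithfully on $\mathbb C^n$ by $s_0x=(1-x_1,x_2,\dots,x_n)$, $s_i$ interchanging $x_i$ and $x_{i+1}$ ($i\in[1,n-1]$), $s_nx=(x_1,\dots,x_{n-1},-x_n)$; it acts on functions by $(wp)(x)=p(w^{-1}x)$. $W_0=\langle s_1,\dots,s_n\rangle$ and $\mathcal P^{W_0}$ is the algebra of $W_0$-invariant polynomials. Put $a_0(x)=1-2x_1$, $a_i(x)=x_i-x_{i+1}$ ($i\in[1,n-1]$), $a_n(x)=2x_n$. Operators on $\mathcal P$, for parameters $\mathbf t=(t_0,u_0,t,t_n,u_n)$: $X_i$ is multiplication by $x_i$, and $T_ip=\chi_i\,s_ip+d_i\,(s_ip-p)$ ($i\in[0,n]$), where $\chi_0=t_0$, $\chi_n=t_n$, $\chi_i=1$ for $i\in[1,n-1]$, $d_0(x)=\frac{t_0^2-u_0^2+(\frac12-x_1)^2}{1-2x_1}$, $d_i(x)=\frac{t}{x_i-x_{i+1}}$ ($i\in[1,n-1]$), $d_n(x)=\frac{t_n^2-u_n^2+x_n^2}{2x_n}$. For $1\le i<j\le n$ put $T_{i,j}=T_iT_{i+1}\cdots T_{j-2}T_{j-1}T_{j-2}\cdots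 T_{i+1}T_i$. The operators $$Y_i=T_i\cdots T_{n-1}T_nT_{n-1}\cdots T_i+T_{i-1}\cdots T_1T_0T_1\cdots T_{i-1}+t\sum_{j=i+1}^nT_{i,j}\qquad(i\in[1,n])$$ commute pairwise, and $f(Y)$ denotes $f$ evaluated at $(Y_1,\dots,Y_n)$. Put $U_n=T_1\cdots T_{n-1}(-X_n-T_n)T_{n-1}\cdots T_1$. Intertwiners: $S_0=[U_n,a_0(Y)]$, $S_i=[T_i,a_i(Y)]$ ($i\in[1,n]$). They satisfy the braid relations of $W$, so $S_w=S_{i_1}\cdots S_{i_r}$ for a reduced expression $w=s_{i_1}\cdots s_{i_r}$ is well defined ($S_1=1$). The dot action of $W$ on $\mathbb C^n$ is $s_i\cdot x=s_ix$ for $i\in[1,n]$ and $s_0\cdot x=(-x_1-1,x_2,\dots,x_n)$; it preserves $\Lambda$. For $\lambda\in\Lambda$, $u_\lambda$ is the unique shortest element of $W$ (length with respect to $s_0,\dots,s_n$) with $u_\lambda\cdot0=\lambda$. The nonsymmetric multivariable Wilson polynomial is $p_\lambda=p_\lambda(\cdot;\mathbf t)=S_{u_\lambda}1\in\mathcal P$. $\gamma_0(\mathbf t)=(\gamma_{0,1},\dots,\gamma_{0,n})$ with $\gamma_{0,i}=t_0+t_n+(n-i)t$ and $\gamma_\lambda(\mathbf t)=u_\lambda\cdot\gamma_0(\mathbf t)$; in particular $x_0=\gamma_0(\mathbf t^\sigma)$ has components $x_{0,i}=t_n+u_n+(n-i)t$. For $\lambda\in\Lambda^+$ put $\mathcal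 P(\lambda)=\mathrm{span}\{p_\mu\mid\mu\in W_0\lambda\}$ and $\mathcal P(\lambda)^{W_0}=\mathcal P(\lambda)\cap\mathcal P^{W_0}$. The symmetric multivariable Wilson polynomial $E^+(\cdot,\gamma_\lambda)$ is the unique element of $\mathcal P(\lambda)^{W_0}$ with value $1$ at $x_0$; it is well defined if $\mathcal P(\lambda)^{W_0}$ is one-dimensional and its nonzero elements do not vanish at $x_0$. Objects for $\mathbf t^\sigma$ (subscript $\sigma$) are obtained by replacing $(t_0,u_0,t,t_n,u_n)$ by $(u_n,u_0,t,t_n,t_0)$ everywhere; this interchanges the roles of $\gamma_0$ and $x_0$. *)

theory Defs
  imports Complex_Main "HOL-Library.Function_Algebras"
begin

text \<open>
  A point of \<open>\<complex>\<^sup>n\<close> is a function \<open>nat \<Rightarrow> complex\<close> of which only the coordinates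
  \<open>1, \<dots>, n\<close> matter: everything below leaves the remaining coordinates alone, and the points that
  are compared with each other are zero there.  Since \<open>\<complex>\<close> is infinite, a polynomial in
  \<open>x\<^sub>1, \<dots>, x\<^sub>n\<close> is identified with its polynomial function.
\<close>

type_synonym point = "nat \<Rightarrow> complex"
type_synonym cfun = "point \<Rightarrow> complex"

inductive_set polys :: "nat \<Rightarrow> cfun set" for n :: nat where
  const: "(\<lambda>x. c) \<in> polys n"
| var: "i \<in> {1..n} \<Longrightarrow> (\<lambda>x. x i) \<in> polys n"
| add: "p \<in> polys n \<Longrightarrow> q \<in> polys n \<Longrightarrow> (\<lambda>x. p x + q x) \<in> polys n"
| mult: "p \<in> polys n \<Longrightarrow> q \<in> polys n \<Longrightarrow> (\<lambda>x. p x * q x) \<in> polys n"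

definition cscale :: "complex \<Rightarrow> cfun \<Rightarrow> cfun" where
  "cscale c f = (\<lambda>x. c * f x)"

global_interpretation cfun: vector_space cscale
  by unfold_locales (auto simp: cscale_def fun_eq_iff algebra_simps)


section \<open>The affine Weyl group of type \<open>C\<^sub>n\<close>\<close>

definition gen :: "nat \<Rightarrow> nat \<Rightarrow> point \<Rightarrow> point" where
  "gen n i x =
     (if i = 0 then x(1 := 1 - x 1)
      else if i = n then x(n := - x n)
      else x(i := x (i + 1), i + 1 := x i))"

definition generated :: "nat \<Rightarrow> nat set \<Rightarrow> (point \<Rightarrow> point) set" where
  "generated n J = {foldr (gen n) ws | ws. set ws \<subseteq> J}"

abbreviation affW :: "nat \<Rightarrow> (point \<Rightarrow> point) set" where
  "affW n \<equiv> generated n {0..n}"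

abbreviation finW :: "nat \<Rightarrow> (point \<Rightarrow> point) set" where
  "finW n \<equiv> generated n {1..n}"

definition word_of :: "nat \<Rightarrow> (point \<Rightarrow> point) \<Rightarrow> nat list \<Rightarrow> bool" where
  "word_of n w ws \<longleftrightarrow> set ws \<subseteq> {0..n} \<and> foldr (gen n) ws = w"

definition cox_length :: "nat \<Rightarrow> (point \<Rightarrow> point) \<Rightarrow> nat" where
  "cox_length n w = (LEAST k. \<exists>ws. word_of n w ws \<and> length ws = k)"

definition reduced_word :: "nat \<Rightarrow> (point \<Rightarrow> point) \<Rightarrow> nat list" where
  "reduced_word n w = (SOME ws. word_of n w ws \<and> length ws = cox_length n w)"

definition act :: "(point \<Rightarrow> point) \<Rightarrow> cfun \<Rightarrow> cfun" where
  "act w p = (\<lambda>x. p (inv w x))"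

definition invariants :: "nat \<Rightarrow> cfun set" where
  "invariants n = {p \<in> polys n. \<forall>w \<in> finW n. act w p = p}"

definition dot_gen :: "nat \<Rightarrow> nat \<Rightarrow> point \<Rightarrow> point" where
  "dot_gen n i x = (if i = 0 then x(1 := - x 1 - 1) else gen n i x)"

text \<open>The choice of the word is immaterial, see \<open>dot_word_of\<close> below.\<close>

definition dot :: "nat \<Rightarrow> (point \<Rightarrow> point) \<Rightarrow> point \<Rightarrow> point" where
  "dot n w x = foldr (dot_gen n) (reduced_word n w) x"

lemma dot_gen_conv_gen: "dot_gen n i x = - gen n i (- x)"
  by (auto simp: dot_gen_def gen_def fun_eq_iff)

lemma foldr_dot_gen: "foldr (dot_gen n) ws x = - foldr (gen n) ws (- x)"
proof (induction ws)
  case Nil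
  show ?case by (simp add: fun_eq_iff)
next
  case (Cons i ws)
  have "- (- foldr (gen n) ws (- x)) = foldr (gen n) ws (- x)"
    by (rule minus_minus)
  with Cons show ?case
    by (simp only: foldr.simps o_apply dot_gen_conv_gen)
qed

lemma word_of_reduced_word:
  assumes "w \<in> affW n"
  shows "word_of n w (reduced_word n w)" "length (reduced_word n w) = cox_length n w"
proof -
  from assms obtain ws where "word_of n w ws"
    by (auto simp: generated_def word_of_def)
  then have "\<exists>k. \<exists>ws. word_of n w ws \<and> length ws = k"
    by blast
  from LeastI_ex[OF this] have "\<exists>ws. word_of n w ws \<and> length ws = cox_length n w"
    unfolding cox_length_def .
  from someI_ex[OF this]
  show "word_of n w (reduced_word n w)" "length (reduced_word n w) = cox_length n w"
    by (auto simp: reduced_word_def)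
qed

lemma dot_word_of:
  assumes "word_of n w ws"
  shows "dot n w = foldr (dot_gen n) ws"
proof
  fix x
  from assms have "w \<in> affW n"
    by (auto simp: generated_def word_of_def)
  then have "foldr (gen n) (reduced_word n w) = foldr (gen n) ws"
    using word_of_reduced_word(1) assms by (auto simp: word_of_def)
  then show "dot n w x = foldr (dot_gen n) ws x"
    by (simp add: dot_def foldr_dot_gen)
qed


section \<open>Weights\<close>

definition Lam :: "nat \<Rightarrow> (nat \<Rightarrow> int) set" where
  "Lam n = {l. \<forall>i. i \<notin> {1..n} \<longrightarrow> l i = 0}"

definition Lam_plus :: "nat \<Rightarrow> (nat \<Rightarrow> int) set" where
  "Lam_plus n = {l \<in> Lam n. (\<forall>i \<in> {1..<n}. l i \<ge> l (i + 1)) \<and> l n \<ge> 0}"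

definition pt :: "(nat \<Rightarrow> int) \<Rightarrow> point" where
  "pt l = (\<lambda>i. of_int (l i))"

text \<open>The shortest element is unique: it is the minimal representative of a coset of \<open>finW n\<close>.\<close>

definition u_elt :: "nat \<Rightarrow> (nat \<Rightarrow> int) \<Rightarrow> point \<Rightarrow> point" where
  "u_elt n l = (ARG_MIN (cox_length n) w. w \<in> affW n \<and> dot n w 0 = pt l)"


section \<open>Parameters and spectral points\<close>

record params =
  par_t0 :: complex
  par_u0 :: complex
  par_t :: complex
  par_tn :: complex
  par_un :: complex

definition sigma :: "params \<Rightarrow> params" where
  "sigma P = \<lparr>par_t0 = par_un P, par_u0 = par_u0 P, par_t = par_t P, par_tn = par_tn P, par_un = par_t0 P\<rparr>"

definition gamma0 :: "nat \<Rightarrow> params \<Rightarrow> point" where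
  "gamma0 n P = (\<lambda>i. if i \<in> {1..n} then par_t0 P + par_tn P + of_nat (n - i) * par_t P else 0)"

definition gamma :: "nat \<Rightarrow> params \<Rightarrow> (nat \<Rightarrow> int) \<Rightarrow> point" where
  "gamma n P l = dot n (u_elt n l) (gamma0 n P)"


section \<open>Operators\<close>

definition aff :: "nat \<Rightarrow> nat \<Rightarrow> cfun" where
  "aff n i x =
     (if i = 0 then 1 - 2 * x 1 else if i = n then 2 * x n else x i - x (i + 1))"

definition chi :: "nat \<Rightarrow> params \<Rightarrow> nat \<Rightarrow> complex" where
  "chi n P i = (if i = 0 then par_t0 P else if i = n then par_tn P else 1)"

definition dcoef :: "nat \<Rightarrow> params \<Rightarrow> nat \<Rightarrow> cfun" where
  "dcoef n P i x =
     (if i = 0 then ((par_t0 P)\<^sup>2 - (par_u0 P)\<^sup>2 + (1/2 - x 1)\<^sup>2) / (1 - 2 * x 1)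
      else if i = n then ((par_tn P)\<^sup>2 - (par_un P)\<^sup>2 + (x n)\<^sup>2) / (2 * x n)
      else par_t P / (x i - x (i + 1)))"

text \<open>
  The formula for \<open>T_op n P i p\<close> is an identity of rational functions.  It determines the polynomial
  through its values off the hyperplane where the denominator \<open>aff n i\<close> of \<open>dcoef n P i\<close>
  vanishes.
\<close>

definition T_op :: "nat \<Rightarrow> params \<Rightarrow> nat \<Rightarrow> cfun \<Rightarrow> cfun" where
  "T_op n P i p =
     (THE q. q \<in> polys n \<and>
        (\<forall>x. aff n i x \<noteq> 0 \<longrightarrow>
           q x = chi n P i * act (gen n i) p x + dcoef n P i x * (act (gen n i) p x - p x)))"

definition Tij :: "nat \<Rightarrow> params \<Rightarrow> nat \<Rightarrow> nat \<Rightarrow> cfun \<Rightarrow> cfun" where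
  "Tij n P i j = foldr (T_op n P) ([i..<j-1] @ [j-1] @ rev [i..<j-1])"

definition Y_op :: "nat \<Rightarrow> params \<Rightarrow> nat \<Rightarrow> cfun \<Rightarrow> cfun" where
  "Y_op n P i p =
     foldr (T_op n P) ([i..<n] @ [n] @ rev [i..<n]) p
     + foldr (T_op n P) (rev [1..<i] @ [0] @ [1..<i]) p
     + cscale (par_t P) (\<Sum>j = i+1..n. Tij n P i j p)"

text \<open>\<open>aY_op n P i\<close> is \<open>aff n i\<close> evaluated at \<open>(Y\<^sub>1, \<dots>, Y\<^sub>n)\<close>.\<close>

definition aY_op :: "nat \<Rightarrow> params \<Rightarrow> nat \<Rightarrow> cfun \<Rightarrow> cfun" where
  "aY_op n P i p =
     (if i = 0 then p - cscale 2 (Y_op n P 1 p)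
      else if i = n then cscale 2 (Y_op n P n p)
      else Y_op n P i p - Y_op n P (i + 1) p)"

definition U_op :: "nat \<Rightarrow> params \<Rightarrow> cfun \<Rightarrow> cfun" where
  "U_op n P p =
     foldr (T_op n P) [1..<n]
       ((\<lambda>q. - (\<lambda>x. x n * q x) - T_op n P n q) (foldr (T_op n P) (rev [1..<n]) p))"

definition commutator :: "(cfun \<Rightarrow> cfun) \<Rightarrow> (cfun \<Rightarrow> cfun) \<Rightarrow> cfun \<Rightarrow> cfun" where
  "commutator A B p = A (B p) - B (A p)"

definition S_gen :: "nat \<Rightarrow> params \<Rightarrow> nat \<Rightarrow> cfun \<Rightarrow> cfun" where
  "S_gen n P i = commutator (if i = 0 then U_op n P else T_op n P i) (aY_op n P i)"

text \<open>The \<open>S_gen n P i\<close> satisfy the braid relations, so any reduced word gives the same operator.\<close>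

definition S_op :: "nat \<Rightarrow> params \<Rightarrow> (point \<Rightarrow> point) \<Rightarrow> cfun \<Rightarrow> cfun" where
  "S_op n P w = foldr (S_gen n P) (reduced_word n w)"


section \<open>Wilson polynomials\<close>

definition nonsym_wilson :: "nat \<Rightarrow> params \<Rightarrow> (nat \<Rightarrow> int) \<Rightarrow> cfun" where
  "nonsym_wilson n P l = S_op n P (u_elt n l) 1"

definition orbit :: "nat \<Rightarrow> (nat \<Rightarrow> int) \<Rightarrow> (nat \<Rightarrow> int) set" where
  "orbit n l = {m \<in> Lam n. \<exists>w \<in> finW n. pt m = w (pt l)}"

definition P_space :: "nat \<Rightarrow> params \<Rightarrow> (nat \<Rightarrow> int) \<Rightarrow> cfun set" where
  "P_space n P l = cfun.span (nonsym_wilson n P ` orbit n l)"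

definition P_space_inv :: "nat \<Rightarrow> params \<Rightarrow> (nat \<Rightarrow> int) \<Rightarrow> cfun set" where
  "P_space_inv n P l = P_space n P l \<inter> invariants n"

text \<open>The normalization point is \<open>x\<^sub>0\<close>, that is, \<open>gamma0\<close> for the dual parameters.\<close>

definition sym_wilson_well_defined :: "nat \<Rightarrow> params \<Rightarrow> (nat \<Rightarrow> int) \<Rightarrow> bool" where
  "sym_wilson_well_defined n P l \<longleftrightarrow>
     cfun.dim (P_space_inv n P l) = 1 \<and>
     (\<forall>p \<in> P_space_inv n P l. p \<noteq> 0 \<longrightarrow> p (gamma0 n (sigma P)) \<noteq> 0)"

definition sym_wilson :: "nat \<Rightarrow> params \<Rightarrow> (nat \<Rightarrow> int) \<Rightarrow> cfun" where
  "sym_wilson n P l = (THE p. p \<in> P_space_inv n P l \<and> p (gamma0 n (sigma P)) = 1)"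

end

theory Submission
  imports Defs
begin

text \<open>
  Put \<open>Z\<^sub>i = - X\<^sub>i\<close>, let \<open>V\<^sub>i\<close> be the part of \<open>Y\<^sub>i\<close> that does not involve \<open>T\<^sub>0\<close>, and put
  \<open>R\<^sub>i = T\<^sub>i\<^sub>-\<^sub>1 \<dots> T\<^sub>0 \<dots> T\<^sub>i\<^sub>-\<^sub>1\<close>, so that \<open>Y\<^sub>i = V\<^sub>i + R\<^sub>i\<close>. Both \<open>Y\<^sub>i\<close> and \<open>Z\<^sub>i\<close> satisfy
  \<open>W\<^sub>i = T\<^sub>i W\<^sub>i\<^sub>+\<^sub>1 T\<^sub>i + t T\<^sub>i\<close>, and \<open>U\<^sub>n = Z\<^sub>1 - V\<^sub>1\<close> plays for \<open>Z\<close> the role that \<open>T\<^sub>0\<close> plays for \<open>Y\<close>.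
  Every relation between the \<open>T\<^sub>i\<close>, including the deformed type \<open>B\<^sub>2\<close> braid relations at both ends of the
  diagram, follows from the commutation rules with the \<open>X\<^sub>i\<close>, because an operator \<open>C\<close> with \<open>C 1 = 0\<close>
  and \<open>C X\<^sub>i \<in> (operators) C\<close> vanishes. Hence the \<open>Y\<^sub>i\<close> commute, and \<open>T\<^sub>1, \<dots>, T\<^sub>n, U\<^sub>n\<close> satisfy with
  the \<open>- Y\<^sub>i\<close> the cross relations that \<open>T\<^sub>1, \<dots>, T\<^sub>n, T\<^sub>0\<close> for the dual parameters satisfy with the \<open>X\<^sub>i\<close>.

  Evaluation at \<open>- x\<^sub>0\<close> is a character of the right action of \<open>T\<^sub>1, \<dots>, T\<^sub>n, U\<^sub>n\<close>. So for the pairing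
  \<open>\<langle>p, f\<rangle> = (f(-Y) p)(- x\<^sub>0)\<close> these operators are adjoint to the dual \<open>T\<^sub>1, \<dots>, T\<^sub>n, T\<^sub>0\<close>, hence \<open>X\<^sub>i\<close> is
  adjoint to the dual \<open>- Y\<^sub>i\<close>, which says that \<open>\<langle>p, f\<rangle> = \<langle>f, p\<rangle>\<^sub>\<sigma>\<close>. The intertwiners move the weights
  of the \<open>Y\<^sub>i\<close> by the dot action, so the symmetric Wilson polynomials are eigenvectors of \<open>f(Y)\<close> for all
  \<open>W\<^sub>0\<close>-invariant \<open>f\<close>; evaluating both sides of the symmetry on them gives the theorem.
\<close>

section \<open>Algebraic consequences of the Hecke relations\<close>

text \<open>\<open>C\<close> is the defect of the deformed length-four braid relation at an end of
  the diagram, with \<open>b\<close> the end generator, \<open>s\<close> its neighbour and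
  \<open>z\<close>, \<open>y\<close> the variables. Pushing the variables to the left of
  \<open>s\<close> and \<open>b\<close> brings both sides to one normal form. The signs reflect that
  the longest element of type B2 acts as minus one.\<close>

lemma deformed_B2:
  fixes s b z y t c q :: "'a::ring_1"
  assumes t: "s*t=t*s" "b*t=t*b" "z*t=t*z" "y*t=t*y"
   and c: "s*c=c*s" "b*c=c*b" "z*c=c*z" "y*c=c*y" "c*t=t*c"
   and q: "s*q=q*s" "b*q=q*b" "z*q=q*z" "y*q=q*y" "q*t=t*q" "q*c=c*q"
   and s: "s*s=1" "s*z = y*s - t" "s*y=z*s+t"
   and b: "b*b = q" "b*z = z*z - z*b + c" "b*y=y*b"
   and zy: "y*z=z*y"
  defines "v \<equiv> s*b*s+t*s"
  defines "C \<equiv> b*v-v*b"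
  shows "C*z = -(z*C)" "C*y=-(y*C)"
proof -
  note r = t c q s b zy
  have r': "s*(t*a)=t*(s*a)" "b*(t*a)=t*(b*a)" "z*(t*a)=t*(z*a)" "y*(t*a)=t*(y*a)"
   "s*(c*a)=c*(s*a)" "b*(c*a)=c*(b*a)" "z*(c*a)=c*(z*a)" "y*(c*a)=c*(y*a)" "c*(t*a)=t*(c*a)"
   "s*(q*a)=q*(s*a)" "b*(q*a)=q*(b*a)" "z*(q*a)=q*(z*a)" "y*(q*a)=q*(y*a)" "q*(t*a)=t*(q*a)" "q*(c*a)=c*(q*a)"
   "s*(s*a)=a" "s*(z*a) = y*(s*a) - t*a" "s*(y*a)=z*(s*a)+t*a"
   "b*(b*a) = q*a" "b*(z*a) = z*(z*a) - z*(b*a) + c*a" "b*(y*a)=y*(b*a)"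
   "y*(z*a)=z*(y*a)" for a
    using r by (simp_all add: mult.assoc[symmetric] algebra_simps(17,18) left_diff_distrib distrib_right)
  show "C*z = -(z*C)"
    unfolding C_def v_def
    by (simp add: r r' mult.assoc ring_distribs)
  show "C*y = -(y*C)"
    unfolding C_def v_def
    by (simp add: r r' mult.assoc ring_distribs)
qed

section \<open>Commuting elements and the abstract affine Hecke relations\<close>

definition commutes :: "'a::ring_1 \<Rightarrow> 'a \<Rightarrow> bool" where
  "commutes a b \<longleftrightarrow> a * b = b * a"

lemma commutes_sym: "commutes a b \<Longrightarrow> commutes b a"
  by (simp add: commutes_def)

lemma commutes_mult: "commutes a b \<Longrightarrow> commutes a c \<Longrightarrow> commutes a (b * c)"
  unfolding commutes_def by (metis mult.assoc)

lemma commutes_add: "commutes a b \<Longrightarrow> commutes a c \<Longrightarrow> commutes a (b + c)"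
  by (simp add: commutes_def algebra_simps)

lemma commutes_diff: "commutes a b \<Longrightarrow> commutes a c \<Longrightarrow> commutes a (b - c)"
  by (simp add: commutes_def algebra_simps)

lemma commutes_conj:
  assumes "s * s = 1" shows "commutes (s * a * s) (s * b * s) \<longleftrightarrow> commutes a b"
proof -
  have *: "s * a * s * (s * b * s) = s * (a * b) * s" for a b
    using assms by (metis mult.assoc mult.right_neutral)
  have inj: "s * a * s = s * b * s \<Longrightarrow> a = b" for a b
    using assms by (metis mult.assoc mult.right_neutral mult.left_neutral)
  show ?thesis
    unfolding commutes_def * by (auto dest: inj)
qed

text \<open>Stated over an arbitrary ring, so that one development serves \<open>P\<close> and
  \<open>sigma P\<close>. The last two assumptions replace the length-four braid relations:
  \<open>right_end\<close> amounts to \<open>T n\<close> commuting with \<open>V (n - 1)\<close>,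
  and \<open>left_end\<close> to \<open>R 1\<close> commuting with
  \<open>R 2 + t * T 1\<close>.\<close>

locale affine_hecke =
  fixes n :: nat and T :: "nat \<Rightarrow> 'a::ring_1" and t :: 'a
  assumes n2: "2 \<le> n"
    and t_central: "commutes t a"
    and quad: "1 \<le> i \<Longrightarrow> i < n \<Longrightarrow> T i * T i = 1"
    and far: "i + 1 < j \<Longrightarrow> j \<le> n \<Longrightarrow> commutes (T i) (T j)"
    and braid: "1 \<le> i \<Longrightarrow> i + 1 < n \<Longrightarrow> T i * T (i + 1) * T i = T (i + 1) * T i * T (i + 1)"
    and right_end: "commutes (T n) (T (n - 1) * T n * T (n - 1) + t * T (n - 1))"
    and left_end: "commutes (T 0) (T 1 * T 0 * T 1 + t * T 1)"
begin

lemma far': "i + 1 < j \<or> j + 1 < i \<Longrightarrow> i \<le> n \<Longrightarrow> j \<le> n \<Longrightarrow> commutes (T i) (T j)"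
  using far[of i j] far[of j i] by (auto intro: commutes_sym)

text \<open>Multiplying the recursion by \<open>T i\<close> and using \<open>T i * T i = 1\<close>
  turns it into the cross relations of a degenerate affine Hecke algebra.\<close>

lemma commutes_cross:
  assumes i: "1 \<le> i" "i < n"
    and rec: "w = T i * w' * T i + t * T i"
  shows "T i * w = w' * T i + t" "w * T i = T i * w' + t" "w' = T i * w * T i - t * T i"
proof -
  note q = quad[OF i] and tc = t_central[unfolded commutes_def]
  have tq: "T i * (t * T i) = t"
    using q by (metis mult.assoc mult.right_neutral tc)
  show "T i * w = w' * T i + t"
    unfolding rec using q tq by (simp add: distrib_left mult.assoc[symmetric])
  have "w * T i = T i * w' * (T i * T i) + t * (T i * T i)"
    unfolding rec by (simp add: distrib_right mult.assoc)
  then show *: "w * T i = T i * w' + t"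
    using q by simp
  have "T i * w * T i = T i * (T i * w' + t)"
    by (simp add: * mult.assoc)
  also have "\<dots> = w' + t * T i"
    using q tc[of "T i"] by (simp add: distrib_left mult.assoc[symmetric])
  finally show "w' = T i * w * T i - t * T i"
    by simp
qed

text \<open>Descending induction from \<open>W n\<close>. The one substantial case is
  \<open>j = i + 1\<close>: there \<open>W i\<close> is unfolded down to \<open>W (i + 2)\<close>,
  and the braid relation carries \<open>T (i + 1)\<close> across as \<open>T i\<close> and
  back.\<close>

lemma jucys_murphy_T:
  assumes rec: "\<And>i. 1 \<le> i \<Longrightarrow> i < n \<Longrightarrow> W i = T i * W (i + 1) * T i + t * T i"
    and base: "\<And>j. 1 \<le> j \<Longrightarrow> j + 1 < n \<Longrightarrow> commutes (T j) (W n)"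
    and "1 \<le> i" "i \<le> n" "1 \<le> j" "j < n" "j \<noteq> i" "j + 1 \<noteq> i"
  shows "commutes (T j) (W i)"
  using \<open>i \<le> n\<close> \<open>1 \<le> i\<close> \<open>1 \<le> j\<close> \<open>j < n\<close> \<open>j \<noteq> i\<close> \<open>j + 1 \<noteq> i\<close>
proof (induction i rule: inc_induct)
  case base
  then show ?case using assms(2)[of j] by auto
next
  case (step i)
  note tc = commutes_sym[OF t_central, of "T j"]
  show ?case
  proof (cases "j = i + 1")
    case False
    then have "j + 1 < i \<or> i + 1 < j"
      using step by linarith
    then have "commutes (T j) (W (i + 1))" "commutes (T j) (T i)"
      using step far'[of j i] by auto
    then show ?thesis
      using step tc by (auto simp: rec intro!: commutes_mult commutes_add)
  next
    case True
    let ?a = "T i" and ?b = "T (i + 1)" and ?w = "W (i + 2)"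
    have i: "i + 1 < n" "1 \<le> i" using step True by auto
    have aw: "?a * ?w = ?w * ?a"
    proof (cases "i + 2 = n")
      case True
      have "commutes (T i) (W n)" using assms(2)[of i] i by auto
      then show ?thesis using True by (simp add: commutes_def)
    next
      case False
      have "commutes (T i) (W (i + 2))"
      proof -
        have "k \<le> n \<Longrightarrow> i + 2 \<le> k \<Longrightarrow> commutes (T i) (W k)" for k
        proof (induction k rule: inc_induct)
          case base
          then show ?case using assms(2)[of i] i by auto
        next
          case (step k)
          then have "commutes (T i) (W (k + 1))" "commutes (T i) (T k)"
            using far' by auto
          then show ?case
            using step i commutes_sym[OF t_central, of "T i"]
            by (auto simp: rec intro!: commutes_mult commutes_add)
        qed
        then show ?thesis using i by auto
      qed
      then show ?thesis by (simp add: commutes_def)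
    qed
    note br = braid[OF i(2,1)]
    have W: "W i = ?a * ?b * ?w * ?b * ?a + t * (?a * ?b * ?a) + t * ?a"
    proof -
      have "W i = ?a * (?b * ?w * ?b + t * ?b) * ?a + t * ?a"
        using rec[of i] rec[of "i + 1"] i by simp
      then show ?thesis
        using t_central[of ?a, unfolded commutes_def]
        by (simp add: distrib_left distrib_right mult.assoc[symmetric])
    qed
    have "commutes ?b (?a * ?b * ?w * ?b * ?a)"
    proof -
      have "?b * (?a * ?b * ?w * ?b * ?a) = (?b * ?a * ?b) * ?w * ?b * ?a"
        by (simp add: mult.assoc)
      also have "\<dots> = ?a * ?b * (?a * ?w) * ?b * ?a"
        unfolding br[symmetric] by (simp add: mult.assoc)
      also have "\<dots> = ?a * ?b * ?w * (?a * ?b * ?a)"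
        unfolding aw by (simp add: mult.assoc)
      also have "\<dots> = ?a * ?b * ?w * ?b * ?a * ?b"
        unfolding br by (simp add: mult.assoc)
      finally show ?thesis by (simp add: commutes_def)
    qed
    moreover have "commutes ?b (t * (?a * ?b * ?a + ?a))"
    proof (intro commutes_mult)
      have "?b * ?b = 1" using quad[of "i+1"] i by simp
      then have "?b * (?a * ?b * ?a) = ?a * ?b" "?a * ?b * ?a * ?b = ?b * ?a"
        unfolding br by (simp_all add: mult.assoc) (simp add: mult.assoc[symmetric])
      then show "commutes ?b (?a * ?b * ?a + ?a)"
        by (simp add: commutes_def distrib_left distrib_right)
    qed (rule commutes_sym[OF t_central])
    ultimately show ?thesis
      unfolding W True by (simp add: distrib_left add.assoc commutes_add)
  qed
qed

text \<open>First \<open>W n\<close> commutes with every \<open>W k\<close>, descending from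
  \<open>base2\<close>. For \<open>i < k\<close> one descends on \<open>k\<close>:
  \<open>W k\<close> is built from \<open>W (k + 1)\<close> and \<open>T k\<close>, and
  \<open>T k\<close> commutes with \<open>W i\<close> because \<open>k\<close> exceeds
  \<open>i\<close>.\<close>

lemma jucys_murphy_commute:
  assumes rec: "\<And>i. 1 \<le> i \<Longrightarrow> i < n \<Longrightarrow> W i = T i * W (i + 1) * T i + t * T i"
    and base: "\<And>j. 1 \<le> j \<Longrightarrow> j + 1 < n \<Longrightarrow> commutes (T j) (W n)"
    and base2: "commutes (W n) (W (n - 1))"
    and ij: "1 \<le> i" "i \<le> n" "1 \<le> j" "j \<le> n"
  shows "commutes (W i) (W j)"
proof -
  have top: "k \<le> n \<Longrightarrow> 1 \<le> k \<Longrightarrow> commutes (W n) (W k)" for k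
  proof (induction k rule: inc_induct)
    case base
    show ?case by (simp add: commutes_def)
  next
    case (step k)
    show ?case
    proof (cases "k = n - 1")
      case True
      then show ?thesis using base2 by simp
    next
      case False
      then have "commutes (W n) (T k)" "commutes (W n) (W (k + 1))"
        using base[of k] step by (auto intro: commutes_sym)
      then show ?thesis
        using step commutes_sym[OF t_central, of "W n"]
        by (auto simp: rec intro!: commutes_mult commutes_add)
    qed
  qed
  have *: "k \<le> n \<Longrightarrow> i < k \<Longrightarrow> 1 \<le> i \<Longrightarrow> commutes (W i) (W k)" for i k
  proof (induction k rule: inc_induct)
    case base
    then show ?case using top[of i] by (auto intro: commutes_sym)
  next
    case (step k)
    have "commutes (T k) (W i)"
      by (rule jucys_murphy_T[OF rec assms(2)]) (use step in auto)
    moreover have "commutes (W i) (W (k + 1))" using step by auto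
    ultimately show ?case
      using step commutes_sym[OF t_central, of "W i"]
      by (auto simp: rec[of k] intro!: commutes_mult commutes_add commutes_sym[of "T k"])
  qed
  show ?thesis
    using *[of i j] *[of j i] ij commutes_sym
    by (cases i j rule: linorder_cases) (auto simp: commutes_def)
qed

section \<open>The elements V and R and their commuting sums Y\<close>

definition V :: "nat \<Rightarrow> 'a" where
  "V i = prod_list (map T ([i..<n] @ [n] @ rev [i..<n]))
     + t * (\<Sum>j = i+1..n. prod_list (map T ([i..<j-1] @ [j-1] @ rev [i..<j-1])))"

definition R :: "nat \<Rightarrow> 'a" where
  "R i = prod_list (map T (rev [1..<i] @ [0] @ [1..<i]))"

definition Y :: "nat \<Rightarrow> 'a" where
  "Y i = V i + R i"

lemma V_n: "V n = T n"
  by (simp add: V_def)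

text \<open>The outer letters \<open>T i\<close> are peeled off every word. The summand
  \<open>j = i + 1\<close> is the single letter \<open>T i\<close> and yields the extra term
  \<open>t * T i\<close>.\<close>

lemma V_rec:
  assumes "i < n" shows "V i = T i * V (i + 1) * T i + t * T i"
proof -
  let ?w = "\<lambda>i j. prod_list (map T ([i..<j-1] @ [j-1] @ rev [i..<j-1]))"
  have 1: "prod_list (map T ([i..<n] @ [n] @ rev [i..<n]))
      = T i * prod_list (map T ([i+1..<n] @ [n] @ rev [i+1..<n])) * T i"
    using assms by (simp add: upt_conv_Cons mult.assoc)
  have "(\<Sum>j = i+1..n. ?w i j) = ?w i (i+1) + (\<Sum>j = i+2..n. ?w i j)"
    using assms by (subst sum.atLeast_Suc_atMost) auto
  also have "(\<Sum>j = i+2..n. ?w i j) = (\<Sum>j = i+2..n. T i * ?w (i+1) j * T i)"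
    by (rule sum.cong) (auto simp: upt_conv_Cons mult.assoc)
  also have "\<dots> = T i * (\<Sum>j = i+2..n. ?w (i+1) j) * T i"
    by (simp add: sum_distrib_left sum_distrib_right)
  finally have 2: "(\<Sum>j = i+1..n. ?w i j) = T i + T i * (\<Sum>j = i+1+1..n. ?w (i+1) j) * T i"
    by simp
  show ?thesis
    unfolding V_def 1 2 using t_central[of "T i", unfolded commutes_def]
    by (simp add: distrib_left distrib_right mult.assoc[symmetric])
qed

lemma R_1: "R (Suc 0) = T 0"
  by (simp add: R_def)

lemma R_rec: "1 \<le> i \<Longrightarrow> R (i + 1) = T i * R i * T i"
  by (simp add: R_def mult.assoc)

lemma V_T:
  assumes "1 \<le> i" "i \<le> n" "1 \<le> j" "j < n" "j \<noteq> i" "j + 1 \<noteq> i"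
  shows "commutes (T j) (V i)"
  by (rule jucys_murphy_T[of V, OF V_rec _ assms]) (auto simp: V_n far)

lemma V_V:
  assumes "1 \<le> i" "i \<le> n" "1 \<le> j" "j \<le> n"
  shows "commutes (V i) (V j)"
proof (rule jucys_murphy_commute[of V, OF V_rec])
  show "commutes (V n) (V (n - 1))"
    using V_rec[of "n - 1"] right_end n2 by (simp add: V_n)
qed (use assms in \<open>auto simp: V_n far\<close>)

lemma V_Tn: "1 \<le> i \<Longrightarrow> i < n \<Longrightarrow> commutes (T n) (V i)"
  using V_V[of n i] n2 by (simp add: V_n)

lemma V_T0: "2 \<le> i \<Longrightarrow> i \<le> n \<Longrightarrow> commutes (T 0) (V i)"
proof (rotate_tac, induction i rule: inc_induct)
  case base
  then show ?case by (simp add: V_n far)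
next
  case (step i)
  then have "commutes (T 0) (V (i + 1))" "commutes (T 0) (T i)"
    by (auto intro: far)
  then show ?case
    using step commutes_sym[OF t_central, of "T 0"]
    by (auto simp: V_rec intro!: commutes_mult commutes_add)
qed

lemma R_T_gt: "1 \<le> i \<Longrightarrow> i < j \<Longrightarrow> j \<le> n \<Longrightarrow> commutes (T j) (R i)"
proof (induction i rule: nat_induct_at_least)
  case base
  then show ?case using R_1 far'[of j 0] by simp
next
  case (Suc i)
  then have "commutes (T j) (R i)" "commutes (T j) (T i)"
    by (auto intro: far')
  then show ?case
    using Suc R_rec[of i] by (auto intro!: commutes_mult)
qed

lemma R_T_lt: "j + 1 < i \<Longrightarrow> i \<le> n \<Longrightarrow> 1 \<le> j \<Longrightarrow> commutes (T j) (R i)"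
proof (induction i rule: less_induct)
  case (less i)
  show ?case
  proof (cases "i = j + 2")
    case False
    define k where "k = i - 1"
    have k: "i = k + 1" "1 \<le> k" "k < n" "j + 1 < k" using less False by (auto simp: k_def)
    have "commutes (T j) (R k)" "commutes (T j) (T k)"
      using less(1)[of k] k less.prems by (auto intro: far')
    then show ?thesis
      using R_rec[of k] k by (auto intro!: commutes_mult)
  next
    case True
    let ?a = "T j" and ?b = "T (j + 1)" and ?w = "R j"
    have j: "1 \<le> j" "j + 1 < n" using less True by auto
    have R: "R i = ?b * ?a * ?w * ?a * ?b"
      using R_rec[of "j + 1"] R_rec[of j] j True by (simp add: mult.assoc)
    note br = braid[OF j]
    have bw: "?b * ?w = ?w * ?b" using R_T_gt[of j "j+1"] j by (simp add: commutes_def)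
    have "?a * (?b * ?a * ?w * ?a * ?b) = (?a * ?b * ?a) * ?w * ?a * ?b"
      by (simp add: mult.assoc)
    also have "\<dots> = ?b * ?a * (?b * ?w) * ?a * ?b"
      unfolding br by (simp add: mult.assoc)
    also have "\<dots> = ?b * ?a * ?w * (?b * ?a * ?b)"
      unfolding bw by (simp add: mult.assoc)
    also have "\<dots> = ?b * ?a * ?w * ?a * ?b * ?a"
      unfolding br[symmetric] by (simp add: mult.assoc)
    finally show ?thesis by (simp add: commutes_def R)
  qed
qed

text \<open>Transports \<open>left_end\<close> along the diagram: the relation for \<open>i\<close>
  is conjugated by \<open>T (i + 1)\<close>, which fixes \<open>R i\<close>, rewritten by the braid
  relation, and conjugated by \<open>T i\<close>.\<close>

lemma R_R_step: "1 \<le> i \<Longrightarrow> i < n \<Longrightarrow> commutes (R i) (T i * R i * T i + t * T i)"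
proof (induction i rule: nat_induct_at_least)
  case base
  then show ?case using left_end by (simp add: R_1)
next
  case (Suc i)
  let ?a = "T i" and ?b = "T (i + 1)" and ?w = "R i"
  have i: "1 \<le> i" "i + 1 < n" using Suc by auto
  have aa: "?a * ?a = 1" and bb: "?b * ?b = 1" using quad i by auto
  note br = braid[OF i] and tc = t_central[unfolded commutes_def]
  have bw: "?b * ?w = ?w * ?b" using R_T_gt[of i "i+1"] i by (simp add: commutes_def)
  have ta: "x * (t * y) = t * (x * y)" for x y
    using tc[of x] by (simp add: mult.assoc[symmetric])
  have "commutes ?w (?a * ?w * ?a + t * ?a)" using Suc by auto
  then have "commutes (?b * ?w * ?b) (?b * (?a * ?w * ?a + t * ?a) * ?b)"
    using commutes_conj[OF bb] by blast
  moreover have "?b * ?w * ?b = ?w"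
    unfolding bw mult.assoc bb by simp
  moreover have "?a * (?b * (?a * ?w * ?a) * ?b + t * ?b) * ?a = ?b * (?a * ?w * ?a + t * ?a) * ?b"
  proof -
    have "?a * (?b * (?a * ?w * ?a) * ?b + t * ?b) * ?a
        = (?a * ?b * ?a) * ?w * (?a * ?b * ?a) + t * (?a * ?b * ?a)"
      by (simp add: distrib_left distrib_right mult.assoc ta)
    also have "\<dots> = ?b * ?a * (?b * ?w) * ?b * ?a * ?b + t * (?b * ?a * ?b)"
      unfolding br by (simp add: mult.assoc)
    also have "\<dots> = ?b * ?a * ?w * (?b * ?b) * ?a * ?b + t * (?b * ?a * ?b)"
      unfolding bw by (simp add: mult.assoc)
    also have "\<dots> = ?b * (?a * ?w * ?a + t * ?a) * ?b"
      unfolding bb by (simp add: distrib_left distrib_right mult.assoc ta)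
    finally show ?thesis .
  qed
  ultimately have "commutes ?w (?a * (?b * (?a * ?w * ?a) * ?b + t * ?b) * ?a)"
    by simp
  then have "commutes (?a * ?w * ?a) (?a * (?a * (?b * (?a * ?w * ?a) * ?b + t * ?b) * ?a) * ?a)"
    using commutes_conj[OF aa] by blast
  moreover have "?a * (?a * x * ?a) * ?a = x" for x
    using aa by (metis mult.assoc mult.left_neutral mult.right_neutral)
  ultimately have "commutes (?a * ?w * ?a) (?b * (?a * ?w * ?a) * ?b + t * ?b)"
    by simp
  then show ?case
    using R_rec[of i] i by simp
qed

text \<open>As \<open>T i\<close> is an involution, \<open>R i = T i * R (i + 1) * T i\<close> with
  no \<open>t\<close> term, so adding \<open>R\<close> to \<open>V\<close> preserves the
  recursion.\<close>

lemma Y_rec: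
  assumes "1 \<le> i" "i < n" shows "Y i = T i * Y (i + 1) * T i + t * T i"
proof -
  have "T i * R (i + 1) * T i = R i"
    using R_rec[of i] assms quad[of i] by (metis mult.assoc mult.left_neutral mult.right_neutral)
  then show ?thesis
    using V_rec[of i] assms by (simp add: Y_def distrib_left distrib_right)
qed

lemma Y_base: "1 \<le> j \<Longrightarrow> j + 1 < n \<Longrightarrow> commutes (T j) (Y n)"
  unfolding Y_def by (intro commutes_add) (auto simp: V_n far R_T_lt)

lemma Y_T:
  assumes "1 \<le> i" "i \<le> n" "1 \<le> j" "j < n" "j \<noteq> i" "j + 1 \<noteq> i"
  shows "commutes (T j) (Y i)"
  by (rule jucys_murphy_T[of Y, OF Y_rec Y_base assms])

lemma Y_Tn: "1 \<le> i \<Longrightarrow> i < n \<Longrightarrow> commutes (T n) (Y i)"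
  unfolding Y_def by (intro commutes_add) (auto simp: V_Tn R_T_gt)

lemma Y_base2: "commutes (Y n) (Y (n - 1))"
proof -
  define k where "k = n - 1"
  have k: "1 \<le> k" "k < n" "n = k + 1" using n2 by (auto simp: k_def)
  let ?s = "T k"
  note tc = t_central[unfolded commutes_def]
  have ta: "x * (t * y) = t * (x * y)" for x y
    using tc[of x] by (simp add: mult.assoc[symmetric])
  have ss: "?s * ?s = 1" using quad k by auto
  have ss': "?s * (?s * x) = x" for x
    using ss by (simp add: mult.assoc[symmetric])
  have Tn: "T n * R k = R k * T n" using R_T_gt[of k n] k by (simp add: commutes_def)
  have Tn': "T n * (R k * x) = R k * (T n * x)" for x
    using Tn by (simp add: mult.assoc[symmetric])
  have Rn: "R n = ?s * R k * ?s" using R_rec[of k] k by simp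
  have Vk: "V k = ?s * T n * ?s + t * ?s" using V_rec[of k] k V_n by simp
  have 1: "V n * V k = V k * V n" using V_V[of n k] k by (simp add: commutes_def)
  have 2: "R k * (?s * R k * ?s) + t * (R k * ?s) = ?s * R k * ?s * R k + t * (?s * R k)"
    using R_R_step[of k] k by (simp add: commutes_def distrib_left distrib_right mult.assoc ta)
  have 3: "R n * V k = ?s * R k * T n * ?s + t * (?s * R k)"
    unfolding Rn Vk by (simp add: distrib_left mult.assoc ta ss' ss)
  have 4: "V k * R n = ?s * R k * T n * ?s + t * (R k * ?s)"
    unfolding Rn Vk by (simp add: distrib_right mult.assoc ta ss' ss Tn')
  \<comment> \<open>The factors of \<open>V n * V k\<close> and of \<open>T n * R k\<close> commute.
    The mixed products in 3 and 4 differ by \<open>t\<close> times the commutator of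
    \<open>T k\<close> and \<open>R k\<close>, which 2 cancels against the commutator of
    \<open>R n\<close> and \<open>R k\<close>.\<close>
  have "Y n * Y k = V n * V k + T n * R k + R n * V k + R n * R k"
    by (simp add: Y_def V_n distrib_left distrib_right)
  also have "\<dots> = V k * V n + R k * T n + V k * R n + R k * R n"
    unfolding 1 3 4 Tn using 2 by (simp add: Rn algebra_simps)
  also have "\<dots> = Y k * Y n"
    by (simp add: Y_def V_n distrib_left distrib_right)
  finally show ?thesis by (simp add: commutes_def k_def)
qed

lemma Y_Y: "1 \<le> i \<Longrightarrow> i \<le> n \<Longrightarrow> 1 \<le> j \<Longrightarrow> j \<le> n \<Longrightarrow> commutes (Y i) (Y j)"
  by (rule jucys_murphy_commute[of Y, OF Y_rec Y_base Y_base2])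

lemma R_square:
  assumes "T 0 * T 0 = q" "\<And>a. commutes q a" "1 \<le> i" "i \<le> n"
  shows "R i * R i = q"
  using \<open>1 \<le> i\<close> \<open>i \<le> n\<close>
proof (induction i rule: nat_induct_at_least)
  case base
  then show ?case using assms(1) by (simp add: R_1)
next
  case (Suc i)
  have ss: "T i * T i = 1" using quad[of i] Suc by auto
  have ss': "T i * (T i * x) = x" for x
    using ss by (simp add: mult.assoc[symmetric])
  have "R (Suc i) * R (Suc i) = T i * (R i * R i) * T i"
    using R_rec[of i] Suc(1) by (simp add: mult.assoc ss')
  also have "\<dots> = q"
    using Suc assms(2)[of "T i"] by (simp add: commutes_def mult.assoc ss')
  finally show ?case .
qed

end

section \<open>Ring identities behind the intertwiners\<close>

lemma commutes_anticommutator: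
  fixes a y q k :: "'a::ring_1"
  assumes a: "a * a = q" and ay: "(a - y) * (a - y) = k"
    and q: "commutes q a" "commutes q y" and k: "commutes k a" "commutes k y"
  shows "y * (a * y - y * a) = - ((a * y - y * a) * y)"
proof -
  have yy: "y * y = a * y + y * a - q + k"
    using ay a by (simp add: algebra_simps)
  \<comment> \<open>Equivalent to the claim. Up to \<open>q\<close> and \<open>k\<close>, the square
    of \<open>y\<close> is \<open>a * y + y * a\<close>, which commutes with \<open>a\<close>
    because \<open>a * a = q\<close> commutes with \<open>y\<close>.\<close>
  have "a * (y * y) = (y * y) * a"
  proof -
    have "a * (a * y + y * a) = (a * y + y * a) * a"
      using q(2) by (simp add: distrib_left distrib_right mult.assoc[symmetric] a)
        (simp add: mult.assoc a commutes_def)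
    then show ?thesis
      using q(1) k(1) unfolding yy
      by (simp add: distrib_left distrib_right left_diff_distrib right_diff_distrib commutes_def)
  qed
  then show ?thesis
    by (simp add: algebra_simps)
qed

text \<open>With \<open>a\<close> moved to the right the commutator is twice
  \<open>(y - x) * a + t\<close>; multiplying by \<open>x\<close> or \<open>y\<close> on the right
  and moving \<open>a\<close> again exchanges the two.\<close>

lemma commutes_intertwiner:
  fixes a x y t :: "'a::ring_1"
  assumes ax: "a * x = y * a + t" and xa: "x * a = a * y + t"
    and xy: "x * y = y * x" and t: "x * t = t * x" "y * t = t * y"
  shows "x * (a * x - a * y - x * a + y * a) = (a * x - a * y - x * a + y * a) * y"
    "y * (a * x - a * y - x * a + y * a) = (a * x - a * y - x * a + y * a) * x"
proof -
  have ay: "a * y = x * a - t" using xa by (simp add: algebra_simps)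
  have ay': "a * (y * z) = x * (a * z) - t * z" for z
    using ay by (metis left_diff_distrib mult.assoc)
  have ax': "a * (x * z) = y * (a * z) + t * z" for z
    using ax by (metis distrib_right mult.assoc)
  have xy': "x * (y * z) = y * (x * z)" for z
    using xy by (simp add: mult.assoc[symmetric])
  show "x * (a * x - a * y - x * a + y * a) = (a * x - a * y - x * a + y * a) * y"
    "y * (a * x - a * y - x * a + y * a) = (a * x - a * y - x * a + y * a) * x"
    by (simp_all add: distrib_left distrib_right left_diff_distrib right_diff_distrib
      mult.assoc ax ay ax' ay' xy xy' t)
qed

text \<open>\<open>Z i\<close> stands for minus the i-th variable and \<open>h\<close> for one half;
  \<open>q0\<close>, \<open>qn\<close>, \<open>qu0\<close>, \<open>qun\<close> are the squares of
  \<open>par_t0\<close>, \<open>par_tn\<close>, \<open>par_u0\<close>, \<open>par_un\<close>. The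
  cross relations at the two ends are packed into the squares of \<open>Z n - T n\<close> and
  \<open>T 0 + h + Z 1\<close>.\<close>

locale double_affine_hecke = affine_hecke n T t for n and T :: "nat \<Rightarrow> 'a::ring_1" and t +
  fixes Z :: "nat \<Rightarrow> 'a" and h q0 qn qu0 qun :: 'a
  assumes Z_cross: "1 \<le> i \<Longrightarrow> i < n \<Longrightarrow> T i * Z i = Z (i + 1) * T i + t"
    and Z_T: "1 \<le> j \<Longrightarrow> j \<le> n \<Longrightarrow> i \<le> n \<Longrightarrow> i \<noteq> j \<Longrightarrow> j \<noteq> i + 1 \<Longrightarrow> commutes (T i) (Z j)"
    and h: "commutes h a"
    and T0_sq: "T 0 * T 0 = q0" and q0: "commutes q0 a"
    and Tn_sq: "T n * T n = qn" and qn: "commutes qn a"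
    and TnZ_sq: "(Z n - T n) * (Z n - T n) = qun" and qun: "commutes qun a"
    and T0Z_sq: "(T 0 + h + Z 1) * (T 0 + h + Z 1) = qu0" and qu0: "commutes qu0 a"
begin

definition U :: 'a where
  "U = Z 1 - V 1"

lemma Z_rec:
  assumes "1 \<le> i" "i < n" shows "Z i = T i * Z (i + 1) * T i + t * T i"
proof -
  have "T i * (T i * Z i) = T i * (Z (i + 1) * T i + t)"
    using Z_cross[OF assms] by simp
  then show ?thesis
    using quad[OF assms] t_central[of "T i"]
    by (simp add: distrib_left mult.assoc[symmetric] commutes_def)
qed

text \<open>\<open>Z\<close> and \<open>V\<close> obey the same recursion, so the \<open>t\<close>
  terms cancel. All differences are thus conjugate to \<open>Z n - T n\<close> and share its
  square.\<close>

lemma ZV_rec: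
  assumes "1 \<le> i" "i < n" shows "Z i - V i = T i * (Z (i + 1) - V (i + 1)) * T i"
  unfolding Z_rec[OF assms] V_rec[OF assms(2)]
  by (simp add: left_diff_distrib right_diff_distrib)

lemma ZV_rec':
  assumes "1 \<le> i" "i < n" shows "Z (i + 1) - V (i + 1) = T i * (Z i - V i) * T i"
proof -
  have ss: "T i * T i = 1" using quad[OF assms] .
  have ss': "T i * (T i * x) = x" for x
    using ss by (simp add: mult.assoc[symmetric])
  show ?thesis
    unfolding ZV_rec[OF assms] by (simp add: mult.assoc ss' ss)
qed

lemma ZV_sq: "1 \<le> i \<Longrightarrow> i \<le> n \<Longrightarrow> (Z i - V i) * (Z i - V i) = qun"
proof (rotate_tac, induction i rule: inc_induct)
  case base
  then show ?case using TnZ_sq by (simp add: V_n)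
next
  case (step i)
  have ss: "T i * T i = 1" using quad[of i] step by auto
  have ss': "T i * (T i * x) = x" for x
    using ss by (simp add: mult.assoc[symmetric])
  have "(Z i - V i) * (Z i - V i) = T i * ((Z (i+1) - V (i+1)) * (Z (i+1) - V (i+1))) * T i"
    using step(1-2,4) by (simp add: ZV_rec mult.assoc ss')
  also have "\<dots> = qun"
  proof -
    have "(Z (i+1) - V (i+1)) * (Z (i+1) - V (i+1)) = qun" using step by simp
    then show ?thesis
      using qun[of "T i"] by (simp only: commutes_def mult.assoc ss ss' mult_1_right)
  qed
  finally show ?case .
qed

lemma U_sq: "U * U = qun"
  unfolding U_def using ZV_sq[of 1] n2 by simp

lemma U_word:
  "U = prod_list (map T [1..<n]) * (Z n - T n) * prod_list (map T (rev [1..<n]))"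
proof -
  have "i \<le> n \<Longrightarrow> 1 \<le> i \<Longrightarrow>
      Z i - V i = prod_list (map T [i..<n]) * (Z n - T n) * prod_list (map T (rev [i..<n]))" for i
  proof (induction i rule: inc_induct)
    case base
    then show ?case by (simp add: V_n)
  next
    case (step i)
    then show ?case by (simp add: ZV_rec upt_conv_Cons[of i n] mult.assoc)
  qed
  from this[of 1] show ?thesis using n2 by (simp add: U_def)
qed

lemma U_T: "2 \<le> j \<Longrightarrow> j \<le> n \<Longrightarrow> commutes (T j) U"
  unfolding U_def
  by (cases "j = n") (use n2 in \<open>auto intro!: commutes_diff Z_T V_T V_Tn\<close>)

lemma U_V: "2 \<le> j \<Longrightarrow> j \<le> n \<Longrightarrow> commutes U (V j)"
proof (rotate_tac, induction j rule: inc_induct)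
  case base
  then show ?case using U_T[of n] by (simp add: V_n commutes_sym)
next
  case (step j)
  then have "commutes U (V (j + 1))" "commutes U (T j)"
    using commutes_sym[OF U_T[of j]] by auto
  then show ?case
    using step commutes_sym[OF t_central, of U]
    by (auto simp: V_rec intro!: commutes_mult commutes_add)
qed

text \<open>For \<open>j = 2\<close>, conjugating the commuting elements \<open>T 0\<close> and
  \<open>Z 2 - V 2\<close> by \<open>T 1\<close> yields \<open>R 2\<close> and \<open>U\<close>.
  Larger \<open>j\<close> only add letters that commute with \<open>U\<close>.\<close>

lemma U_R: "2 \<le> j \<Longrightarrow> j \<le> n \<Longrightarrow> commutes U (R j)"
proof (induction j rule: nat_induct_at_least)
  case base
  have "commutes (T 0) (Z 2 - V 2)"
    using n2 by (auto intro!: commutes_diff Z_T V_T0)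
  then have "commutes (T 1 * T 0 * T 1) (T 1 * (Z 2 - V 2) * T 1)"
    using commutes_conj quad[of 1] n2 by auto
  then show ?case
    using R_rec[of 1] ZV_rec[of 1] n2 R_1 by (simp add: U_def numeral_2_eq_2 commutes_sym)
next
  case (Suc j)
  then show ?case
    using R_rec[of j] by (auto intro!: commutes_mult commutes_sym[OF U_T])
qed

lemma U_Y: "2 \<le> j \<Longrightarrow> j \<le> n \<Longrightarrow> commutes U (Y j)"
  unfolding Y_def by (intro commutes_add U_V U_R)

text \<open>The symmetry between \<open>U\<close> and \<open>T 0\<close>: since
  \<open>U = Z 1 - V 1\<close> and \<open>Y 1 = V 1 + T 0\<close>, the elements
  \<open>U + Y 1\<close> and \<open>T 0 + Z 1\<close> coincide.\<close>

lemma U_Y1_sq: "(U + h + Y 1) * (U + h + Y 1) = qu0"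
proof -
  have "U + h + Y 1 = T 0 + h + Z 1"
    using R_1 by (simp add: U_def Y_def)
  then show ?thesis using T0Z_sq by (simp only:)
qed

lemma Yn_sq: "(Y n - T n) * (Y n - T n) = q0"
  using R_square[OF T0_sq q0, of n] n2 by (simp add: Y_def V_n)

definition S :: "nat \<Rightarrow> 'a" where
  "S i = (if i = 0 then U * (1 - (Y 1 + Y 1)) - (1 - (Y 1 + Y 1)) * U
     else if i = n then T n * (Y n + Y n) - (Y n + Y n) * T n
     else T i * (Y i - Y (i + 1)) - (Y i - Y (i + 1)) * T i)"

lemma Y_S_far:
  assumes "i \<le> n" "1 \<le> j" "j \<le> n" "j \<noteq> i" "j \<noteq> i + 1"
  shows "commutes (Y j) (S i)"
proof -
  have 1: "commutes (Y j) 1" by (simp add: commutes_def)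
  note rules = commutes_diff commutes_mult commutes_add 1 Y_Y
  consider "i = 0" | "i = n" | "1 \<le> i" "i < n" using assms(1) by linarith
  then show ?thesis
  proof cases
    case 1
    then have "commutes (Y j) U" using assms by (intro commutes_sym[OF U_Y]) auto
    then show ?thesis
      using 1 assms n2 unfolding S_def by (auto intro!: rules)
  next
    case 2
    then have "commutes (Y j) (T n)" using assms by (intro commutes_sym[OF Y_Tn]) auto
    then show ?thesis
      using 2 assms n2 unfolding S_def by (auto intro!: rules)
  next
    case 3
    then have "commutes (Y j) (T i)" using assms by (intro commutes_sym[OF Y_T]) auto
    then show ?thesis
      using 3 assms n2 unfolding S_def by (auto intro!: rules)
  qed
qed

lemma Y_S_n: "Y n * S n = - (S n * Y n)"
proof -
  have *: "Y n * (T n * Y n - Y n * T n) = - ((T n * Y n - Y n * T n) * Y n)"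
  proof (rule commutes_anticommutator[OF Tn_sq])
    show "(T n - Y n) * (T n - Y n) = q0"
      using Yn_sq by (simp add: algebra_simps)
  qed (rule qn q0)+
  have "S n = (T n * Y n - Y n * T n) + (T n * Y n - Y n * T n)"
    using n2 by (simp add: S_def algebra_simps)
  then show ?thesis
    using * by (simp add: distrib_left distrib_right)
qed

lemma Y_S_0: "(h + Y 1) * S 0 = - (S 0 * (h + Y 1))"
proof -
  \<comment> \<open>Chosen so that \<open>U - ?y\<close> has square \<open>qu0\<close>; the
    commutator of \<open>U\<close> with it is half of \<open>S 0\<close>.\<close>
  let ?y = "- (h + Y 1)"
  have *: "?y * (U * ?y - ?y * U) = - ((U * ?y - ?y * U) * ?y)"
  proof (rule commutes_anticommutator[OF U_sq])
    show "(U - ?y) * (U - ?y) = qu0"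
      using U_Y1_sq by (simp only: diff_minus_eq_add add.assoc)
  qed (rule qun qu0)+
  have "S 0 = (U * ?y - ?y * U) + (U * ?y - ?y * U)"
    using h[of U] by (simp add: S_def algebra_simps commutes_def)
  moreover have "y * k = - (k * y) \<Longrightarrow> s = k + k \<Longrightarrow> (- y) * s = - (s * (- y))" for y k s :: 'a
    by (simp add: distrib_left distrib_right)
  ultimately have "(- ?y) * S 0 = - (S 0 * (- ?y))"
    using * by blast
  then show ?thesis
    by (simp only: minus_minus)
qed

lemma Y_S_mid:
  assumes i: "1 \<le> i" "i < n"
  shows "Y i * S i = S i * Y (i + 1)" "Y (i + 1) * S i = S i * Y i"
proof -
  note cr = commutes_cross[OF i Y_rec[OF i]]
  have S: "S i = T i * Y i - T i * Y (i + 1) - Y i * T i + Y (i + 1) * T i"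
    using i by (simp add: S_def algebra_simps)
  have "Y i * Y (i + 1) = Y (i + 1) * Y i" using Y_Y[of i "i+1"] i by (simp add: commutes_def)
  then show "Y i * S i = S i * Y (i + 1)" "Y (i + 1) * S i = S i * Y i"
    unfolding S using commutes_intertwiner[OF cr(1,2)] t_central by (auto simp: commutes_def)
qed

end

section \<open>Polynomials and operators on them\<close>

text \<open>A type cannot depend on \<open>n\<close>, so the type of operators below is based on
  polynomials in arbitrarily many variables.\<close>

definition Polys :: "cfun set" where
  "Polys = (\<Union>n. polys n)"

lemma polys_mono: "p \<in> polys n \<Longrightarrow> n \<le> m \<Longrightarrow> p \<in> polys m"
  by (induction rule: polys.induct) (auto intro: polys.intros)

lemma polys_Polys: "p \<in> polys n \<Longrightarrow> p \<in> Polys"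
  by (auto simp: Polys_def)

lemma Polys_obtain2:
  assumes "p \<in> Polys" "q \<in> Polys"
  obtains m where "p \<in> polys m" "q \<in> polys m" "m \<ge> n"
proof -
  obtain a b where "p \<in> polys a" "q \<in> polys b"
    using assms by (auto simp: Polys_def)
  then show ?thesis
    using that[of "max n (max a b)"] polys_mono by force
qed

lemma polys_plus: "p \<in> polys n \<Longrightarrow> q \<in> polys n \<Longrightarrow> p + q \<in> polys n"
  using polys.add[of p n q] by (simp add: plus_fun_def)

lemma polys_cscale: "p \<in> polys n \<Longrightarrow> cscale c p \<in> polys n"
  using polys.mult[OF polys.const] by (simp add: cscale_def)

lemma polys_uminus: "p \<in> polys n \<Longrightarrow> - p \<in> polys n"
  using polys_cscale[of p n "-1"] by (simp add: cscale_def fun_Compl_def)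

lemma polys_diff: "p \<in> polys n \<Longrightarrow> q \<in> polys n \<Longrightarrow> p - q \<in> polys n"
  using polys_plus[OF _ polys_uminus, of p n q] by simp

lemma polys_diff': "p \<in> polys n \<Longrightarrow> q \<in> polys n \<Longrightarrow> (\<lambda>x. p x - q x) \<in> polys n"
  using polys_diff[of p n q] by (simp add: fun_diff_def)

lemma polys_uminus': "p \<in> polys n \<Longrightarrow> (\<lambda>x. - p x) \<in> polys n"
  using polys_uminus[of p n] by (simp add: fun_Compl_def)

lemma polys_power: "p \<in> polys n \<Longrightarrow> (\<lambda>x. p x ^ k) \<in> polys n"
  by (induction k) (auto intro: polys.intros)

lemmas polys_intros = polys.intros polys_diff' polys_uminus' polys_power

lemma polys_0: "0 \<in> polys n" and polys_1: "1 \<in> polys n"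
  using polys.const[of 0 n] polys.const[of 1 n] by (simp_all add: zero_fun_def one_fun_def)

lemma Polys_0 [simp]: "0 \<in> Polys" and Polys_1 [simp]: "1 \<in> Polys"
  using polys_0 polys_1 polys_Polys by blast+

lemma Polys_plus [intro]: "p \<in> Polys \<Longrightarrow> q \<in> Polys \<Longrightarrow> p + q \<in> Polys"
  by (metis Polys_obtain2 polys_Polys polys_plus)

lemma Polys_mult [intro]: "p \<in> Polys \<Longrightarrow> q \<in> Polys \<Longrightarrow> (\<lambda>x. p x * q x) \<in> Polys"
  by (metis Polys_obtain2 polys_Polys polys.mult)

lemma Polys_cscale [intro]: "p \<in> Polys \<Longrightarrow> cscale c p \<in> Polys"
  by (auto simp: Polys_def intro: polys_cscale)

lemma Polys_uminus [intro]: "p \<in> Polys \<Longrightarrow> - p \<in> Polys"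
  by (auto simp: Polys_def intro: polys_uminus)

lemma Polys_diff [intro]: "p \<in> Polys \<Longrightarrow> q \<in> Polys \<Longrightarrow> p - q \<in> Polys"
  by (metis Polys_obtain2 polys_Polys polys_diff)

lemma polys_local:
  "p \<in> polys n \<Longrightarrow> (\<And>i. i \<in> {1..n} \<Longrightarrow> x i = y i) \<Longrightarrow> p x = p y"
  by (induction rule: polys.induct) auto

lemma polys_comp:
  "p \<in> polys n \<Longrightarrow> (\<And>i. i \<in> {1..n} \<Longrightarrow> (\<lambda>x. g x i) \<in> polys m) \<Longrightarrow> (\<lambda>x. p (g x)) \<in> polys m"
  by (induction rule: polys.induct) (auto intro: polys.intros)

section \<open>Reflections and divided differences of polynomials\<close>

lemma gen_gen [simp]: "gen n i (gen n i x) = x"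
  by (auto simp: gen_def fun_eq_iff)

lemma inv_gen: "inv (gen n i) = gen n i"
  by (rule inv_unique_comp) (auto simp: fun_eq_iff)

lemma polys_gen:
  assumes "p \<in> polys m" "1 \<le> n" "i \<le> n" "n \<le> m"
  shows "(\<lambda>x. p (gen n i x)) \<in> polys m"
proof (rule polys_comp[OF assms(1)])
  fix j assume "j \<in> {1..m}"
  then show "(\<lambda>x. gen n i x j) \<in> polys m"
    using assms by (cases "i = 0"; cases "i = n"; cases "j = i"; cases "j = i + 1"; cases "j = 1")
      (auto simp: gen_def intro!: polys_intros)
qed

lemma Polys_gen:
  assumes "p \<in> Polys" "1 \<le> n" "i \<le> n"
  shows "(\<lambda>x. p (gen n i x)) \<in> Polys"
  by (metis Polys_obtain2 assms polys_Polys polys_gen)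

text \<open>Polynomials are continuous along coordinate lines, and moving one coordinate leaves the
  mirror at once, so agreement off the mirror extends to it.\<close>

lemma polys_cancel_aff:
  assumes "q \<in> Polys" "q' \<in> Polys" "1 \<le> n" "i \<le> n"
    and eq: "\<And>x. aff n i x \<noteq> 0 \<Longrightarrow> q x = q' x"
  shows "q = q'"
proof
  fix x
  obtain m where m: "q \<in> polys m" "q' \<in> polys m"
    using assms by (metis Polys_obtain2)
  show "q x = q' x"
  proof (cases "aff n i x = 0")
    case True
    let ?k = "if i = 0 then 1 else i"
    let ?y = "\<lambda>s. x(?k := x ?k + s)"
    have coord: "isCont (\<lambda>s. ?y s j) 0" for j
      by (cases "j = ?k") (auto intro!: continuous_intros)
    have cont: "p \<in> polys m \<Longrightarrow> isCont (\<lambda>s. p (?y s)) 0" for p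
      by (induction rule: polys.induct) (use coord in \<open>auto intro: continuous_intros\<close>)
    have "aff n i (?y s) = aff n i x + (if i = 0 then -2 else if i = n then 2 else 1) * s" for s
      using assms by (auto simp: aff_def algebra_simps)
    then have "q (?y s) = q' (?y s)" if "s \<noteq> 0" for s
      using that True by (intro eq) auto
    then have ev: "\<forall>\<^sub>F s in at 0. q (?y s) = q' (?y s)"
      by (auto simp: eventually_at intro: exI[of _ 1])
    have lim: "((\<lambda>s. q (?y s)) \<longlongrightarrow> q (?y 0)) (at 0)" "((\<lambda>s. q' (?y s)) \<longlongrightarrow> q' (?y 0)) (at 0)"
      using cont[OF m(1)] cont[OF m(2)] unfolding isCont_def by blast+
    have "((\<lambda>s. q' (?y s)) \<longlongrightarrow> q (?y 0)) (at 0)"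
      using lim(1) ev by (rule Lim_transform_eventually)
    then have "q (?y 0) = q' (?y 0)"
      using lim(2) by (rule tendsto_unique[OF at_neq_bot])
    then show ?thesis by simp
  qed (rule eq)
qed

text \<open>Coordinates have constant quotients, and products follow the twisted Leibniz rule, in
  which the first factor is reflected.\<close>

lemma divided_difference_exists:
  assumes "p \<in> polys m" "1 \<le> n" "i \<le> n" "n \<le> m"
  shows "\<exists>q \<in> polys m. \<forall>x. aff n i x * q x = p (gen n i x) - p x"
  using assms(1)
proof (induction rule: polys.induct)
  case (const c)
  show ?case by (rule bexI[of _ "\<lambda>x. 0"]) (auto intro: polys.intros)
next
  case (var j)
  let ?c = "if i = 0 then (if j = 1 then 1 else 0) else if i = n then (if j = n then -1 else 0)
    else if j = i then -1 else if j = i + 1 then 1 else 0 :: complex"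
  show ?case by (rule bexI[of _ "\<lambda>x. ?c"]) (use assms in \<open>auto simp: aff_def gen_def intro: polys.intros\<close>)
next
  case (add p q)
  then obtain p' q' where *: "p' \<in> polys m" "q' \<in> polys m"
     "\<And>x. aff n i x * p' x = p (gen n i x) - p x" "\<And>x. aff n i x * q' x = q (gen n i x) - q x"
    by blast
  show ?case
    by (rule bexI[of _ "\<lambda>x. p' x + q' x"]) (auto simp: distrib_left * intro: polys.intros)
next
  case (mult p q)
  then obtain p' q' where *: "p' \<in> polys m" "q' \<in> polys m"
     "\<And>x. aff n i x * p' x = p (gen n i x) - p x" "\<And>x. aff n i x * q' x = q (gen n i x) - q x"
    by blast
  have "aff n i x * (p (gen n i x) * q' x + p' x * q x) =
     p (gen n i x) * q (gen n i x) - p x * q x" for x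
  proof -
    have "aff n i x * (p (gen n i x) * q' x + p' x * q x) =
      p (gen n i x) * (aff n i x * q' x) + (aff n i x * p' x) * q x"
      by (simp add: algebra_simps)
    then show ?thesis unfolding * by (simp add: algebra_simps)
  qed
  then show ?case
    using * mult assms
    by (intro bexI[of _ "\<lambda>x. p (gen n i x) * q' x + p' x * q x"])
       (auto intro!: polys.intros polys_gen)
qed

definition dd :: "nat \<Rightarrow> nat \<Rightarrow> cfun \<Rightarrow> cfun" where
  "dd n i p = (THE q. q \<in> Polys \<and> (\<forall>x. aff n i x * q x = p (gen n i x) - p x))"

lemma dd_eqI:
  assumes "1 \<le> n" "i \<le> n" "q \<in> Polys" "\<And>x. aff n i x * q x = p (gen n i x) - p x"
  shows "dd n i p = q"
  unfolding dd_def
proof (rule the_equality)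
  fix q' assume q': "q' \<in> Polys \<and> (\<forall>x. aff n i x * q' x = p (gen n i x) - p x)"
  then have "aff n i x * q' x = aff n i x * q x" for x using assms by auto
  then show "q' = q"
    by (intro polys_cancel_aff[OF _ assms(3,1,2)]) (use q' in auto)
qed (use assms in auto)

lemma dd_polys:
  assumes "1 \<le> n" "i \<le> n" "n \<le> m" "p \<in> polys m"
  shows "dd n i p \<in> polys m"
proof -
  obtain q where "q \<in> polys m" "\<And>x. aff n i x * q x = p (gen n i x) - p x"
    using divided_difference_exists assms by blast
  with assms dd_eqI[of n i q p] show ?thesis by (auto intro: polys_Polys)
qed

lemma dd_Polys: "1 \<le> n \<Longrightarrow> i \<le> n \<Longrightarrow> p \<in> Polys \<Longrightarrow> dd n i p \<in> Polys"
  by (metis Polys_obtain2 polys_Polys dd_polys)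

lemma aff_dd:
  assumes "1 \<le> n" "i \<le> n" "p \<in> Polys"
  shows "aff n i x * dd n i p x = p (gen n i x) - p x"
proof -
  obtain m where "n \<le> m" "p \<in> polys m" using assms Polys_obtain2 by metis
  then obtain q where "q \<in> polys m" "\<And>x. aff n i x * q x = p (gen n i x) - p x"
    using divided_difference_exists assms by blast
  with assms dd_eqI[of n i q p] show ?thesis by (auto intro: polys_Polys)
qed

section \<open>The ring of linear operators on polynomials\<close>

definition linear_on_Polys :: "(cfun \<Rightarrow> cfun) \<Rightarrow> bool" where
  "linear_on_Polys f \<longleftrightarrow> (\<forall>p \<in> Polys. f p \<in> Polys) \<and>
     (\<forall>p \<in> Polys. \<forall>q \<in> Polys. f (p + q) = f p + f q) \<and>
     (\<forall>c. \<forall>p \<in> Polys. f (cscale c p) = cscale c (f p))"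

text \<open>Operators vanish outside \<open>Polys\<close>, so that they are determined by their action on polynomials.\<close>

typedef op = "{f. linear_on_Polys f \<and> (\<forall>p. p \<notin> Polys \<longrightarrow> f p = 0)}"
  morphisms app Abs_op
  by (rule exI[of _ "\<lambda>_. 0"]) (auto simp: linear_on_Polys_def)

definition mk :: "(cfun \<Rightarrow> cfun) \<Rightarrow> op" where
  "mk f = Abs_op (\<lambda>p. if p \<in> Polys then f p else 0)"

lemma app_mk: "linear_on_Polys f \<Longrightarrow> app (mk f) p = (if p \<in> Polys then f p else 0)"
  unfolding mk_def by (subst Abs_op_inverse) (auto simp: linear_on_Polys_def)

lemma app_linear: "linear_on_Polys (app A)" and app_outside: "p \<notin> Polys \<Longrightarrow> app A p = 0"
  using app[of A] by auto

lemma app_Polys [intro, simp]: "app A p \<in> Polys"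
  using app_linear[of A] app_outside[of p A] by (cases "p \<in> Polys") (auto simp: linear_on_Polys_def)

lemma app_add: "p \<in> Polys \<Longrightarrow> q \<in> Polys \<Longrightarrow> app A (p + q) = app A p + app A q"
  and app_cscale: "p \<in> Polys \<Longrightarrow> app A (cscale c p) = cscale c (app A p)"
  using app_linear[of A] by (auto simp: linear_on_Polys_def)

lemma app_0 [simp]: "app A 0 = 0"
  using app_cscale[of 0 A 0] by simp

lemma app_uminus: "p \<in> Polys \<Longrightarrow> app A (- p) = - app A p"
  using app_cscale[of p A "-1"] by (simp add: cscale_def fun_Compl_def)

lemma app_diff: "p \<in> Polys \<Longrightarrow> q \<in> Polys \<Longrightarrow> app A (p - q) = app A p - app A q"
  using app_add[of p "- q" A] by (auto simp: app_uminus)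

lemma op_eqI: "(\<And>p. p \<in> Polys \<Longrightarrow> app A p = app B p) \<Longrightarrow> A = B"
  by (metis app_inject app_outside ext)

instantiation op :: ring_1
begin

definition "0 = mk (\<lambda>_. 0)"
definition "1 = mk (\<lambda>p. p)"
definition "A + B = mk (\<lambda>p. app A p + app B p)"
definition "- A = mk (\<lambda>p. - app A p)"
definition "A - B = mk (\<lambda>p. app A p - app B p)"
definition "A * B = mk (\<lambda>p. app A (app B p))"

lemma app_zero_op [simp]: "app 0 p = 0"
  unfolding zero_op_def by (subst app_mk) (auto simp: linear_on_Polys_def)

lemma app_one_op: "app 1 p = (if p \<in> Polys then p else 0)"
  unfolding one_op_def by (subst app_mk) (auto simp: linear_on_Polys_def)

lemma app_plus_op: "app (A + B) p = app A p + app B p"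
  unfolding plus_op_def
  by (subst app_mk) (auto simp: linear_on_Polys_def app_add app_cscale app_outside
      cfun.scale_right_distrib cfun.scale_right_diff_distrib)

lemma app_uminus_op: "app (- A) p = - app A p"
  unfolding uminus_op_def
  by (subst app_mk) (auto simp: linear_on_Polys_def app_add app_cscale app_outside
      cfun.scale_right_distrib cfun.scale_right_diff_distrib)

lemma app_minus_op: "app (A - B) p = app A p - app B p"
  unfolding minus_op_def
  by (subst app_mk) (auto simp: linear_on_Polys_def app_add app_cscale app_outside
      cfun.scale_right_distrib cfun.scale_right_diff_distrib)

lemma app_times_op: "app (A * B) p = app A (app B p)"
  unfolding times_op_def
  by (subst app_mk) (auto simp: linear_on_Polys_def app_add app_cscale app_outside)

instance
proof
  show "(0::op) \<noteq> 1"
  proof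
    assume "(0::op) = 1"
    then have "app 0 1 = app 1 1" by simp
    then show False by (simp add: app_one_op fun_eq_iff)
  qed
qed (auto intro!: op_eqI simp: app_plus_op app_uminus_op app_minus_op app_times_op app_one_op
  app_add app_uminus app_diff app_outside fun_eq_iff)

end

lemmas app_simps = app_plus_op app_uminus_op app_minus_op app_times_op

text \<open>The braid defect \<open>C\<close> carries the variables as the longest permutation of
  three letters does, exchanging \<open>x\<close> and \<open>z\<close>; normal ordering verifies
  it.\<close>

lemma conjugate_braid_relation:
  fixes s r x y z t :: "'a::ring_1"
  assumes t: "s*t=t*s" "r*t=t*r" "x*t=t*x" "y*t=t*y" "z*t=t*z"
    and s: "s*s=1" "s*x=y*s+t" "s*y=x*s-t" "s*z=z*s"
    and r: "r*r=1" "r*y=z*r+t" "r*z=y*r-t" "r*x=x*r"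
  defines "C \<equiv> s*r*s - r*s*r"
  shows "C*x=z*C" "C*y=y*C" "C*z=x*C"
proof -
  note rules = t s r
  have rules': "s*(t*a)=t*(s*a)" "r*(t*a)=t*(r*a)" "x*(t*a)=t*(x*a)" "y*(t*a)=t*(y*a)" "z*(t*a)=t*(z*a)"
    "s*(s*a)=a" "s*(x*a)=y*(s*a)+t*a" "s*(y*a)=x*(s*a)-t*a" "s*(z*a)=z*(s*a)"
    "r*(r*a)=a" "r*(y*a)=z*(r*a)+t*a" "r*(z*a)=y*(r*a)-t*a" "r*(x*a)=x*(r*a)" for a
    using rules by (simp_all add: mult.assoc[symmetric] left_diff_distrib distrib_right)
  show "C*x=z*C" "C*y=y*C" "C*z=x*C"
    unfolding C_def by (simp_all add: rules rules' mult.assoc distrib_left distrib_right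
      left_diff_distrib right_diff_distrib)
qed

lemma commutator_cross:
  fixes a b f A B :: "'a::ring_1"
  assumes "a * f = A * a + B" "commutes b f" "commutes b A" "commutes b B"
  shows "(a * b - b * a) * f = A * (a * b - b * a)"
proof -
  have "a * b * f = a * f * b"
    using assms(2) by (simp add: commutes_def mult.assoc)
  also have "\<dots> = (A * a + B) * b"
    by (simp only: assms(1))
  finally have 1: "a * b * f = A * (a * b) + B * b"
    by (simp only: distrib_right mult.assoc)
  have "b * a * f = b * (A * a + B)"
    by (simp only: assms(1) mult.assoc)
  also have "\<dots> = b * A * a + b * B"
    by (simp only: distrib_left mult.assoc)
  also have "\<dots> = A * b * a + B * b"
    using assms(3,4) by (simp only: commutes_def)
  finally have 2: "b * a * f = A * (b * a) + B * b"
    by (simp only: mult.assoc)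
  show ?thesis
    unfolding left_diff_distrib right_diff_distrib 1 2 by simp
qed

lemma square_cross:
  fixes b z c :: "'a::ring_1"
  assumes "b * z = z * z - z * b + c" "commutes c b" "commutes c z"
  shows "b * b * z = z * (b * b)"
proof -
  have cz: "z * c = c * z" "b * c = c * b" "b * (c * a) = c * (b * a)" "z * (c * a) = c * (z * a)" for a
    using assms(2,3) by (simp_all only: commutes_def mult.assoc[symmetric])
  have "b * (z * a) = b * z * a" for a
    by (simp only: mult.assoc)
  then have bz: "b * (z * a) = z * (z * a) - z * (b * a) + c * a" for a
    unfolding assms(1) by (simp only: distrib_right left_diff_distrib mult.assoc)
  show ?thesis
    by (simp add: bz assms(1) mult.assoc distrib_left right_diff_distrib cz)
qed

section \<open>Multiplication, reflection and divided difference operators\<close>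

definition Mul :: "cfun \<Rightarrow> op" where
  "Mul f = mk (\<lambda>p x. f x * p x)"

definition scal :: "complex \<Rightarrow> op" where
  "scal c = Mul (\<lambda>_. c)"

definition Sg :: "nat \<Rightarrow> nat \<Rightarrow> op" where
  "Sg n i = mk (\<lambda>p x. p (gen n i x))"

definition DD :: "nat \<Rightarrow> nat \<Rightarrow> op" where
  "DD n i = mk (dd n i)"

lemma app_Mul: "f \<in> Polys \<Longrightarrow> app (Mul f) p = (if p \<in> Polys then (\<lambda>x. f x * p x) else 0)"
  unfolding Mul_def
  by (subst app_mk) (auto simp: linear_on_Polys_def cscale_def fun_eq_iff algebra_simps)

lemma Polys_const [simp]: "(\<lambda>_. c) \<in> Polys"
  using polys.const polys_Polys by blast

lemma Polys_var [simp]: "1 \<le> j \<Longrightarrow> (\<lambda>x. x j) \<in> Polys"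
  using polys.var[of j j] polys_Polys by auto

lemma app_scal: "app (scal c) p = cscale c (app 1 p)"
  unfolding scal_def by (auto simp: app_Mul app_one_op cscale_def)

lemma app_Sg: "1 \<le> n \<Longrightarrow> i \<le> n \<Longrightarrow> app (Sg n i) p = (if p \<in> Polys then (\<lambda>x. p (gen n i x)) else 0)"
  unfolding Sg_def
  by (subst app_mk) (auto simp: linear_on_Polys_def cscale_def fun_eq_iff Polys_gen)

lemma dd_linear:
  assumes "1 \<le> n" "i \<le> n" shows "linear_on_Polys (dd n i)"
  unfolding linear_on_Polys_def
proof (intro conjI ballI allI)
  fix p q assume pq: "p \<in> Polys" "q \<in> Polys"
  show "dd n i (p + q) = dd n i p + dd n i q"
    using assms pq by (intro dd_eqI) (auto simp: aff_dd dd_Polys distrib_left)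
next
  fix c p assume p: "p \<in> Polys"
  have "aff n i x * (c * dd n i p x) = c * p (gen n i x) - c * p x" for x
  proof -
    have "aff n i x * (c * dd n i p x) = c * (aff n i x * dd n i p x)" by simp
    then show ?thesis using aff_dd[OF assms p] by (simp add: right_diff_distrib)
  qed
  then show "dd n i (cscale c p) = cscale c (dd n i p)"
    using assms p by (intro dd_eqI) (auto simp: cscale_def[of c] dd_Polys Polys_cscale[unfolded cscale_def])
qed (use assms in \<open>auto simp: dd_Polys\<close>)

lemma app_DD: "1 \<le> n \<Longrightarrow> i \<le> n \<Longrightarrow> app (DD n i) p = (if p \<in> Polys then dd n i p else 0)"
  unfolding DD_def by (subst app_mk) (auto simp: dd_linear)

lemma dd_mult:
  assumes "1 \<le> n" "i \<le> n" "p \<in> Polys" "q \<in> Polys"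
  shows "dd n i (\<lambda>x. p x * q x) = (\<lambda>x. p (gen n i x) * dd n i q x + dd n i p x * q x)"
proof (rule dd_eqI)
  fix x
  have "aff n i x * (p (gen n i x) * dd n i q x + dd n i p x * q x) =
    p (gen n i x) * (aff n i x * dd n i q x) + (aff n i x * dd n i p x) * q x"
    by (simp add: algebra_simps)
  then show "aff n i x * (p (gen n i x) * dd n i q x + dd n i p x * q x) =
      p (gen n i x) * q (gen n i x) - p x * q x"
    unfolding aff_dd[OF assms(1,2,3)] aff_dd[OF assms(1,2,4)] by (simp add: algebra_simps)
next
  have "(\<lambda>x. p (gen n i x) * dd n i q x) + (\<lambda>x. dd n i p x * q x) \<in> Polys"
    using assms by (intro Polys_plus Polys_mult Polys_gen dd_Polys)
  then show "(\<lambda>x. p (gen n i x) * dd n i q x + dd n i p x * q x) \<in> Polys"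
    by (simp add: plus_fun_def)
qed (use assms in auto)

lemma Mul_add: "f \<in> Polys \<Longrightarrow> g \<in> Polys \<Longrightarrow> Mul (\<lambda>x. f x + g x) = Mul f + Mul g"
  using Polys_plus[of f g]
  by (intro op_eqI) (auto simp: app_Mul app_plus_op plus_fun_def distrib_right)

lemma Mul_mult: "f \<in> Polys \<Longrightarrow> g \<in> Polys \<Longrightarrow> Mul (\<lambda>x. f x * g x) = Mul f * Mul g"
  by (intro op_eqI) (auto simp: app_Mul app_times_op mult.assoc Polys_mult)

lemma Mul_uminus: "f \<in> Polys \<Longrightarrow> Mul (\<lambda>x. - f x) = - Mul f"
  using Polys_uminus[of f]
  by (intro op_eqI) (auto simp: app_Mul app_uminus_op fun_Compl_def)

lemma scal_central: "commutes (scal c) A"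
  unfolding commutes_def
  by (rule op_eqI) (auto simp: app_times_op app_scal app_one_op app_cscale)

lemma scal_1: "scal 1 = 1"
  by (rule op_eqI) (simp add: app_scal)

lemma scal_add: "scal (c + d) = scal c + scal d"
  unfolding scal_def by (rule Mul_add) auto

lemma scal_uminus: "scal (- c) = - scal c"
  unfolding scal_def by (rule Mul_uminus) auto

lemma scal_0: "scal 0 = 0"
  by (rule op_eqI) (simp add: app_scal)

lemma scal_diff: "scal (c - d) = scal c - scal d"
  using scal_add[of c "-d"] by (simp add: scal_uminus)

text \<open>Polynomials are generated from \<open>1\<close> by the variables.\<close>

lemma op_zeroI:
  assumes C1: "app C 1 = 0"
    and step: "\<And>j. 1 \<le> j \<Longrightarrow> \<exists>D. C * Mul (\<lambda>x. x j) = D * C"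
  shows "C = 0"
proof (rule op_eqI)
  \<comment> \<open>Strengthened from \<open>1\<close> to every polynomial \<open>q\<close> killed
    by \<open>C\<close>, because the hypothesis \<open>step\<close> says that the kernel is closed
    under multiplication by variables.\<close>
  have *: "p \<in> polys m \<Longrightarrow> q \<in> Polys \<Longrightarrow> app C q = 0 \<Longrightarrow> app C (\<lambda>x. p x * q x) = 0" for p q m
  proof (induction arbitrary: q rule: polys.induct)
    case (const c)
    then show ?case using app_cscale[of q C c] by (simp add: cscale_def[of c])
  next
    case (var i)
    then obtain D where D: "C * Mul (\<lambda>x. x i) = D * C" using step[of i] by auto
    have "app (C * Mul (\<lambda>x. x i)) q = 0"
      unfolding D app_times_op var.prems(2) by (rule app_0)
    then show ?case using var by (simp add: app_times_op app_Mul)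
  next
    case (add p p')
    have "(\<lambda>x. p x * q x) \<in> Polys" "(\<lambda>x. p' x * q x) \<in> Polys"
      using add.hyps add.prems(1) by (simp_all only: polys_Polys Polys_mult)
    then have "app C ((\<lambda>x. p x * q x) + (\<lambda>x. p' x * q x)) = 0 + 0"
      using add.IH add.prems by (simp only: app_add)
    then show ?case by (simp add: plus_fun_def distrib_right)
  next
    case (mult p p')
    have "(\<lambda>x. p' x * q x) \<in> Polys"
      using mult.hyps mult.prems(1) by (simp only: polys_Polys Polys_mult)
    with mult have "app C (\<lambda>x. p x * (p' x * q x)) = 0" by blast
    then show ?case by (simp only: mult.assoc)
  qed
  fix p assume "p \<in> Polys"
  then obtain m where "p \<in> polys m" by (auto simp: Polys_def)
  from *[OF this, of 1] C1 show "app C p = app 0 p" by simp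
qed

section \<open>The generators \<open>Top\<close> and their cross relations with the
  variables\<close>

locale wilson =
  fixes n :: nat and P :: params
  assumes n_ge_2: "2 \<le> n"
begin

text \<open>The numerator of \<open>dcoef\<close> over the denominator \<open>aff\<close>. It makes
  \<open>T_op\<close> a multiple of a reflection plus \<open>nu\<close> times a divided difference,
  free of division.\<close>

definition nu :: "nat \<Rightarrow> cfun" where
  "nu i x = (if i = 0 then (par_t0 P)\<^sup>2 - (par_u0 P)\<^sup>2 + (1/2 - x 1)\<^sup>2
     else if i = n then (par_tn P)\<^sup>2 - (par_un P)\<^sup>2 + (x n)\<^sup>2
     else par_t P)"

definition Top :: "nat \<Rightarrow> op" where
  "Top i = scal (chi n P i) * Sg n i + Mul (nu i) * DD n i"

definition Z :: "nat \<Rightarrow> op" where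
  "Z j = - Mul (\<lambda>x. x j)"

lemma nu_polys: "i \<le> n \<Longrightarrow> nu i \<in> polys n"
  unfolding nu_def[abs_def] using n_ge_2
  by (cases "i = 0"; cases "i = n") (auto intro!: polys_intros)

lemma nu_Polys: "i \<le> n \<Longrightarrow> nu i \<in> Polys"
  using nu_polys polys_Polys by blast

lemma app_Top:
  assumes "i \<le> n" "p \<in> Polys"
  shows "app (Top i) p = (\<lambda>x. chi n P i * p (gen n i x) + nu i x * dd n i p x)"
  unfolding Top_def using assms n_ge_2
  by (simp add: app_simps app_scal app_one_op app_Sg app_Mul app_DD nu_Polys dd_Polys Polys_gen
      cscale_def plus_fun_def)

lemma app_Top_1: "i \<le> n \<Longrightarrow> app (Top i) 1 = cscale (chi n P i) 1"
proof -
  assume i: "i \<le> n"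
  have "dd n i 1 = 0" using i n_ge_2 by (intro dd_eqI) auto
  then show ?thesis using i by (simp add: app_Top cscale_def)
qed

text \<open>The twisted Leibniz rule read as a relation between operators; the cross relations below
  are instances.\<close>

lemma Top_Mul:
  assumes "i \<le> n" "f \<in> Polys"
  shows "Top i * Mul f = Mul (\<lambda>x. f (gen n i x)) * Top i + Mul (\<lambda>x. nu i x * dd n i f x)"
proof (rule op_eqI)
  fix p assume p: "p \<in> Polys"
  have n1: "1 \<le> n" using n_ge_2 by simp
  have "app (Top i) p \<in> Polys" by simp
  then show "app (Top i * Mul f) p =
      app (Mul (\<lambda>x. f (gen n i x)) * Top i + Mul (\<lambda>x. nu i x * dd n i f x)) p"
    using assms p n1
    by (simp add: app_simps app_Mul Polys_gen Polys_mult dd_Polys nu_Polys app_Top dd_mult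
        plus_fun_def algebra_simps)
qed

lemma Top_Z:
  assumes "i \<le> n" "1 \<le> j"
    and gj: "\<And>x. gen n i x j = f x" and f: "f \<in> Polys"
    and dj: "\<And>x. aff n i x * d = f x - x j"
  shows "Top i * Z j = - (Mul f * Top i) - Mul (\<lambda>x. nu i x * d)"
proof -
  have "dd n i (\<lambda>x. x j) = (\<lambda>_. d)"
    using assms n_ge_2 by (intro dd_eqI) (auto simp: gj)
  then show ?thesis
    using Top_Mul[of i "\<lambda>x. x j"] assms by (simp add: Z_def gj algebra_simps)
qed

lemma Top_Z_far:
  assumes "i \<le> n" "1 \<le> j" "j \<noteq> i" "i = n \<or> j \<noteq> i + 1"
  shows "commutes (Top i) (Z j)"
proof -
  have "Top i * Z j = - (Mul (\<lambda>x. x j) * Top i) - Mul (\<lambda>x. nu i x * 0)"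
    using assms n_ge_2 by (intro Top_Z) (auto simp: gen_def)
  then show ?thesis by (simp add: commutes_def Z_def scal_0[unfolded scal_def])
qed

lemma Top_Z_cross:
  assumes "1 \<le> i" "i < n"
  shows "Top i * Z i = Z (i + 1) * Top i + scal (par_t P)"
    and "Top i * Z (i + 1) = Z i * Top i - scal (par_t P)"
proof -
  have nu: "nu i x = par_t P" for x using assms by (simp add: nu_def)
  have "Top i * Z i = - (Mul (\<lambda>x. x (i + 1)) * Top i) - Mul (\<lambda>x. nu i x * (-1))"
    using assms by (intro Top_Z) (auto simp: gen_def aff_def)
  then show "Top i * Z i = Z (i + 1) * Top i + scal (par_t P)"
    by (simp add: Z_def nu scal_def[symmetric] scal_uminus)
  have "Top i * Z (i + 1) = - (Mul (\<lambda>x. x i) * Top i) - Mul (\<lambda>x. nu i x * 1)"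
    using assms by (intro Top_Z) (auto simp: gen_def aff_def)
  then show "Top i * Z (i + 1) = Z i * Top i - scal (par_t P)"
    by (simp add: Z_def nu scal_def[symmetric])
qed

lemma Top_Z_n: "Top n * Z n = Z n * Z n - Z n * Top n + scal ((par_tn P)\<^sup>2 - (par_un P)\<^sup>2)"
proof -
  have v: "(\<lambda>x. x n) \<in> Polys" using n_ge_2 by simp
  have "Top n * Z n = - (Mul (\<lambda>x. - x n) * Top n) - Mul (\<lambda>x. nu n x * (-1))"
    using n_ge_2 Polys_uminus[OF v] by (intro Top_Z) (auto simp: gen_def aff_def fun_Compl_def)
  moreover have "Mul (\<lambda>x. - x n) = Z n"
    using v by (simp add: Z_def Mul_uminus)
  moreover have "Mul (\<lambda>x. nu n x * (-1)) = - Mul (nu n)"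
    using nu_Polys[of n] by (simp add: Mul_uminus)
  moreover have "Mul (nu n) = scal ((par_tn P)\<^sup>2 - (par_un P)\<^sup>2) + Z n * Z n"
  proof -
    have "nu n = (\<lambda>x. ((par_tn P)\<^sup>2 - (par_un P)\<^sup>2) + x n * x n)"
      using n_ge_2 by (auto simp: nu_def fun_eq_iff power2_eq_square)
    then show ?thesis
      using v by (simp add: Mul_add Mul_mult scal_def Z_def Polys_mult)
  qed
  ultimately show ?thesis by simp
qed

text \<open>\<open>z\<close> is multiplication by \<open>x 1 - 1/2\<close>, the coordinate in which
  \<open>gen n 0\<close> is a sign change. The relation then has the shape of
  \<open>Top_Z_n\<close>.\<close>

lemma Top_Z_0:
  defines "z \<equiv> - (Z 1 + scal (1/2))"
  shows "Top 0 * z = z * z - z * Top 0 + scal ((par_t0 P)\<^sup>2 - (par_u0 P)\<^sup>2)"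
proof -
  define f :: cfun where "f = (\<lambda>x. x 1 - 1/2)"
  have v: "f \<in> Polys" unfolding f_def by (rule polys_Polys[of _ 1]) (auto intro!: polys_intros)
  have z: "z = Mul f"
    using Mul_add[of "\<lambda>x. x 1" "\<lambda>_. - 1/2"] by (simp add: z_def Z_def f_def scal_def Mul_uminus)
  have "aff n 0 x * 1 = f (gen n 0 x) - f x" for x
    by (simp add: aff_def gen_def f_def)
  then have "dd n 0 f = (\<lambda>_. 1)"
    using n_ge_2 by (intro dd_eqI) auto
  then have "Top 0 * Mul f = Mul (\<lambda>x. - f x) * Top 0 + Mul (nu 0)"
    using Top_Mul[of 0 f] v by (simp add: f_def gen_def)
  moreover have "Mul (nu 0) = scal ((par_t0 P)\<^sup>2 - (par_u0 P)\<^sup>2) + Mul f * Mul f"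
  proof -
    have "nu 0 = (\<lambda>x. ((par_t0 P)\<^sup>2 - (par_u0 P)\<^sup>2) + f x * f x)"
      by (auto simp: nu_def fun_eq_iff power2_eq_square f_def algebra_simps)
    then show ?thesis
      using v by (simp add: Mul_add Mul_mult scal_def Polys_mult)
  qed
  ultimately show ?thesis using v by (simp add: z Mul_uminus)
qed

end

section \<open>The relations between the operators\<close>

context wilson
begin

text \<open>The coordinates moved by the i-th reflection: the guard \<open>1 \<le> l\<close> removes
  coordinate 0 when \<open>i = 0\<close>, and \<open>i \<noteq> n\<close> removes
  \<open>n + 1\<close>.\<close>

definition touches :: "nat \<Rightarrow> nat \<Rightarrow> bool" where
  "touches i l \<longleftrightarrow> 1 \<le> l \<and> (l = i \<or> i \<noteq> n \<and> l = i + 1)"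

lemma scal_right: "A * scal c = scal c * A" and scal_assoc: "A * (scal c * B) = scal c * (A * B)"
proof -
  show *: "A * scal c = scal c * A" for A
    using scal_central[of c A] by (simp only: commutes_def)
  show "A * (scal c * B) = scal c * (A * B)"
    using *[of A] by (simp only: mult.assoc[symmetric])
qed

lemma commutes_scal: "commutes A (scal c)"
  by (rule commutes_sym[OF scal_central])

lemma commutes_uminus: "commutes A B \<Longrightarrow> commutes A (- B)" for A B :: op
  by (simp add: commutes_def)

lemma Top_Z_untouched: "i \<le> n \<Longrightarrow> 1 \<le> j \<Longrightarrow> \<not> touches i j \<Longrightarrow> commutes (Top i) (Z j)"
  by (rule Top_Z_far) (auto simp: touches_def)

lemma Z_commute:
  assumes "1 \<le> i" "1 \<le> j" shows "commutes (Z i) (Z j)"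
proof -
  have "Mul (\<lambda>x. x i) * Mul (\<lambda>x. x j) = Mul (\<lambda>x. x j) * Mul (\<lambda>x. x i)"
    using assms by (simp add: Mul_mult[symmetric] mult.commute)
  then show ?thesis by (simp add: commutes_def Z_def)
qed

lemma Z_zeroI:
  assumes "app C 1 = 0" "\<And>j. 1 \<le> j \<Longrightarrow> \<exists>D. C * Z j = D * C"
  shows "C = 0"
proof (rule op_zeroI[OF assms(1)])
  fix j :: nat assume "1 \<le> j"
  then obtain D where "C * Z j = D * C" using assms(2) by blast
  then have "C * Mul (\<lambda>x. x j) = (- D) * C" by (simp add: Z_def minus_equation_iff[of "C * _"])
  then show "\<exists>D. C * Mul (\<lambda>x. x j) = D * C" ..
qed

lemma Top_0_Z_1:
  defines "z \<equiv> - (Z 1 + scal (1/2))"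
  shows "Top 0 * Z 1 = (z - scal (1/2)) * Top 0 + - (z * z + scal ((par_t0 P)\<^sup>2 - (par_u0 P)\<^sup>2))"
proof -
  have "Top 0 * Z 1 = - (Top 0 * z) - Top 0 * scal (1/2)"
    by (simp add: z_def algebra_simps)
  also have "\<dots> = - (z * z - z * Top 0 + scal ((par_t0 P)\<^sup>2 - (par_u0 P)\<^sup>2)) - scal (1/2) * Top 0"
    using Top_Z_0 by (simp only: z_def scal_right)
  finally show ?thesis by (simp add: algebra_simps)
qed

text \<open>\<open>A\<close> and \<open>B\<close> are expressions in the touched \<open>Z l\<close>;
  the closure properties record this in the form that \<open>commutator_cross\<close>
  consumes.\<close>

lemma Top_Z_touched:
  assumes "i \<le> n" "touches i k"
  obtains A B where "Top i * Z k = A * Top i + B"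
    "\<And>C. (\<And>l. touches i l \<Longrightarrow> commutes C (Z l)) \<Longrightarrow> commutes C A"
    "\<And>C. (\<And>l. touches i l \<Longrightarrow> commutes C (Z l)) \<Longrightarrow> commutes C B"
proof -
  note rules = commutes_add commutes_diff commutes_mult commutes_uminus commutes_scal
  consider "i = 0" "k = 1" | "i = n" "k = n" | "1 \<le> i" "i < n" "k = i" | "1 \<le> i" "i < n" "k = i + 1"
    using assms n_ge_2 unfolding touches_def by force
  then show thesis
  proof cases
    case 1
    have "touches 0 1" using n_ge_2 by (simp add: touches_def)
    then show thesis
      using 1 Top_0_Z_1 by (intro that[of _ _]) (auto intro!: rules)
  next
    case 2
    have "touches n n" using n_ge_2 by (simp add: touches_def)
    moreover have "Top n * Z n = (- Z n) * Top n + (Z n * Z n + scal ((par_tn P)\<^sup>2 - (par_un P)\<^sup>2))"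
      using Top_Z_n by simp
    ultimately show thesis
      using 2 by (intro that[of "- Z n"]) (auto intro!: rules)
  next
    case 3
    have "touches i (i + 1)" using 3 by (simp add: touches_def)
    then show thesis
      using 3 Top_Z_cross(1)[of i] by (intro that[of "Z (i + 1)"]) (auto intro!: rules)
  next
    case 4
    have "touches i i" using 4 by (simp add: touches_def)
    moreover have "Top i * Z (i + 1) = Z i * Top i + - scal (par_t P)"
      using 4 Top_Z_cross(2)[of i] by simp
    ultimately show thesis
      using 4 by (intro that[of "Z i"]) (auto intro!: rules)
  qed
qed

lemma app_Top_chi: "i \<le> n \<Longrightarrow> app (Top i) (cscale c 1) = cscale (c * chi n P i) 1"
  by (simp add: app_cscale app_Top_1)

text \<open>The commutator kills \<open>1\<close>, since generators act on constants by scalars, and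
  it can be moved past every variable, since distant generators touch disjoint coordinates; so
  \<open>Z_zeroI\<close> applies.\<close>

lemma Top_far:
  assumes "i + 1 < j" "j \<le> n"
  shows "commutes (Top i) (Top j)"
proof -
  let ?C = "Top i * Top j - Top j * Top i"
  have sep: "\<not> (touches i l \<and> touches j l)" for l
    using assms by (auto simp: touches_def)
  have "?C = 0"
  proof (rule Z_zeroI)
    show "app ?C 1 = 0"
      using assms by (simp add: app_simps app_Top_1 app_Top_chi)
    fix k :: nat assume k: "1 \<le> k"
    consider "touches i k" | "touches j k" | "\<not> touches i k" "\<not> touches j k" by blast
    then show "\<exists>D. ?C * Z k = D * ?C"
    proof cases
      case 1
      have i: "i \<le> n" using assms by simp
      have tj: "commutes (Top j) (Z l)" if "touches i l" for l
        using that sep assms by (intro Top_Z_untouched) (auto simp: touches_def)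
      obtain A B where "Top i * Z k = A * Top i + B" "commutes (Top j) A" "commutes (Top j) B"
        by (rule Top_Z_touched[OF i 1]) (use tj in blast)
      moreover have "commutes (Top j) (Z k)"
        using tj 1 .
      ultimately show ?thesis using commutator_cross by blast
    next
      case 2
      have ti: "commutes (Top i) (Z l)" if "touches j l" for l
        using that sep assms by (intro Top_Z_untouched) (auto simp: touches_def)
      obtain A B where "Top j * Z k = A * Top j + B" "commutes (Top i) A" "commutes (Top i) B"
        by (rule Top_Z_touched[OF assms(2) 2]) (use ti in blast)
      moreover have "commutes (Top i) (Z k)"
        using ti 2 .
      ultimately have "(Top j * Top i - Top i * Top j) * Z k = A * (Top j * Top i - Top i * Top j)"
        using commutator_cross by blast
      then have "?C * Z k = A * ?C" by (simp add: algebra_simps)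
      then show ?thesis by - (rule exI)
    next
      case 3
      then have "commutes (Z k) (Top i)" "commutes (Z k) (Top j)"
        using assms k by (auto intro!: commutes_sym[OF Top_Z_untouched])
      then have "commutes (Z k) ?C" by (intro commutes_diff commutes_mult)
      then have "?C * Z k = Z k * ?C" by (simp only: commutes_def)
      then show ?thesis by - (rule exI)
    qed
  qed
  then show ?thesis by (simp add: commutes_def)
qed

section \<open>Quadratic and braid relations by the same vanishing criterion\<close>

lemma Top_quad:
  assumes "1 \<le> i" "i < n" shows "Top i * Top i = 1"
proof -
  note cr = Top_Z_cross[OF assms]
  have "Top i * Top i - 1 = 0"
  proof (rule Z_zeroI)
    show "app (Top i * Top i - 1) 1 = 0"
      using assms app_Top_1[of i] by (simp add: app_simps app_one_op chi_def)
    fix k :: nat assume k: "1 \<le> k"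
    have "Top i * Top i * Z k = Z k * (Top i * Top i)"
    proof (cases "touches i k")
      case True
      have "Top i * Top i * Z i = Top i * (Z (i + 1) * Top i + scal (par_t P))"
        by (simp only: cr mult.assoc)
      also have "\<dots> = Top i * Z (i + 1) * Top i + scal (par_t P) * Top i"
        by (simp only: distrib_left scal_right mult.assoc)
      also have "\<dots> = Z i * (Top i * Top i)"
        unfolding cr by (simp add: left_diff_distrib mult.assoc)
      finally have 1: "Top i * Top i * Z i = Z i * (Top i * Top i)" .
      have "Top i * Top i * Z (i + 1) = Top i * (Z i * Top i - scal (par_t P))"
        by (simp only: cr mult.assoc)
      also have "\<dots> = Top i * Z i * Top i - scal (par_t P) * Top i"
        by (simp only: right_diff_distrib scal_right mult.assoc)
      also have "\<dots> = Z (i + 1) * (Top i * Top i)"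
        unfolding cr by (simp add: distrib_right mult.assoc)
      finally show ?thesis using 1 True by (auto simp: touches_def)
    next
      case False
      then have "commutes (Z k) (Top i * Top i)"
        using k assms by (intro commutes_mult commutes_sym[OF Top_Z_untouched]) auto
      then show ?thesis by (simp add: commutes_def)
    qed
    then have "(Top i * Top i - 1) * Z k = Z k * (Top i * Top i - 1)"
      by (simp add: left_diff_distrib right_diff_distrib)
    then show "\<exists>D. (Top i * Top i - 1) * Z k = D * (Top i * Top i - 1)" ..
  qed
  then show ?thesis by simp
qed

lemma Top_end_sq:
  assumes "i = 0 \<or> i = n" shows "Top i * Top i = scal ((chi n P i)\<^sup>2)"
proof -
  let ?C = "Top i * Top i - scal ((chi n P i)\<^sup>2)"
  have "?C = 0"
  proof (rule Z_zeroI)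
    show "app ?C 1 = 0"
      using assms
      by (auto simp: app_simps app_scal app_one_op app_Top_1 app_Top_chi power2_eq_square)
    fix k :: nat assume k: "1 \<le> k"
    have "Top i * Top i * Z k = Z k * (Top i * Top i)"
    proof (cases "touches i k")
      case True
      show ?thesis
      proof (cases "i = 0")
        case i: True
        let ?z = "- (Z 1 + scal (1/2))"
        have "Top 0 * Top 0 * ?z = ?z * (Top 0 * Top 0)"
          by (rule square_cross[OF Top_Z_0]) (rule scal_central)+
        then show ?thesis
          using i True by (auto simp: touches_def left_diff_distrib right_diff_distrib scal_right)
      next
        case False
        have "Top n * Top n * Z n = Z n * (Top n * Top n)"
          by (rule square_cross[OF Top_Z_n]) (rule scal_central)+
        then show ?thesis
          using False assms True by (auto simp: touches_def)
      qed
    next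
      case False
      then have "commutes (Z k) (Top i * Top i)"
        using k assms by (intro commutes_mult commutes_sym[OF Top_Z_untouched]) auto
      then show ?thesis by (simp add: commutes_def)
    qed
    then have "?C * Z k = Z k * ?C"
      by (simp add: left_diff_distrib right_diff_distrib scal_right)
    then show "\<exists>D. ?C * Z k = D * ?C" ..
  qed
  then show ?thesis by simp
qed

text \<open>\<open>conjugate_braid_relation\<close> moves the defect past the three touched
  variables; both generators commute with all others, and both words fix \<open>1\<close>.\<close>

lemma Top_braid:
  assumes "1 \<le> i" "i + 1 < n"
  shows "Top i * Top (i + 1) * Top i = Top (i + 1) * Top i * Top (i + 1)"
proof -
  let ?C = "Top i * Top (i + 1) * Top i - Top (i + 1) * Top i * Top (i + 1)"
  have far: "Top i * Z (i + 1 + 1) = Z (i + 1 + 1) * Top i" "Top (i + 1) * Z i = Z i * Top (i + 1)"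
    using Top_Z_untouched[of i "i + 1 + 1"] Top_Z_untouched[of "i + 1" i] assms
    by (auto simp: touches_def commutes_def)
  have i: "i < n" "1 \<le> i + 1" using assms by auto
  note rel = conjugate_braid_relation[OF scal_right scal_right scal_right scal_right scal_right
    Top_quad[OF assms(1) i(1)] Top_Z_cross[OF assms(1) i(1)] far(1)
    Top_quad[OF i(2) assms(2)] Top_Z_cross[OF i(2) assms(2)] far(2)]
  have "?C = 0"
  proof (rule Z_zeroI)
    show "app ?C 1 = 0"
      using assms by (simp add: app_simps app_Top_1 app_Top_chi chi_def)
    fix k :: nat assume k: "1 \<le> k"
    consider "k = i" | "k = i + 1" | "k = i + 1 + 1" | "\<not> touches i k" "\<not> touches (i + 1) k"
      unfolding touches_def by blast
    then show "\<exists>D. ?C * Z k = D * ?C"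
    proof cases
      case 4
      then have "commutes (Z k) (Top i)" "commutes (Z k) (Top (i + 1))"
        using assms k by (auto intro!: commutes_sym[OF Top_Z_untouched])
      then have "commutes (Z k) ?C" by (intro commutes_diff commutes_mult)
      then have "?C * Z k = Z k * ?C" by (simp only: commutes_def)
      then show ?thesis by - (rule exI)
    qed (use rel in blast)+
  qed
  then show ?thesis by simp
qed

text \<open>An instance of \<open>deformed_B2\<close> with \<open>b = Top n\<close>,
  \<open>s = Top (n - 1)\<close>, \<open>z = Z n\<close> and \<open>y = Z (n - 1)\<close>: the
  defect anticommutes with both variables and kills \<open>1\<close>.\<close>

lemma Top_right_end:
  "commutes (Top n) (Top (n - 1) * Top n * Top (n - 1) + scal (par_t P) * Top (n - 1))"
proof -
  define m where "m = n - 1"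
  have m: "1 \<le> m" "m < n" "m + 1 = n" using n_ge_2 by (auto simp: m_def)
  let ?v = "Top m * Top n * Top m + scal (par_t P) * Top m"
  let ?C = "Top n * ?v - ?v * Top n"
  have n: "Top n * Z m = Z m * Top n" "Z m * Z n = Z n * Z m" "Top n * Top n = scal ((par_tn P)\<^sup>2)"
    "Top n * Z n = Z n * Z n - Z n * Top n + scal ((par_tn P)\<^sup>2 - (par_un P)\<^sup>2)"
    using Top_Z_untouched[of n m] Z_commute[of m n] m Top_end_sq[of n] Top_Z_n
    by (auto simp: touches_def commutes_def chi_def)
  note rel = deformed_B2[OF scal_right scal_right scal_right scal_right
    scal_right scal_right scal_right scal_right scal_right
    scal_right scal_right scal_right scal_right scal_right scal_right
    Top_quad[OF m(1,2)] Top_Z_cross(2,1)[OF m(1,2), unfolded m(3)] n(3,4,1,2)]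
  have "?C = 0"
  proof (rule Z_zeroI)
    show "app ?C 1 = 0"
      using m by (simp add: app_simps app_Top_1 app_Top_chi chi_def app_scal app_one_op app_add
        app_cscale Polys_cscale cfun.scale_right_distrib mult.commute)
    fix k :: nat assume k: "1 \<le> k"
    consider "k = n" | "k = m" | "\<not> touches m k" "\<not> touches n k"
      unfolding touches_def m(3) by blast
    then show "\<exists>D. ?C * Z k = D * ?C"
    proof cases
      case 1
      have "?C * Z k = (- Z n) * ?C"
        unfolding 1 mult_minus_left by (rule rel(1))
      then show ?thesis by - (rule exI)
    next
      case 2
      have "?C * Z k = (- Z m) * ?C"
        unfolding 2 mult_minus_left by (rule rel(2))
      then show ?thesis by - (rule exI)
    next
      case 3
      have "m \<le> n" using m(2) by (rule less_imp_le)
      then have "commutes (Z k) (Top m)" "commutes (Z k) (Top n)"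
        using 3 k by (blast intro: commutes_sym[OF Top_Z_untouched])+
      then have "commutes (Z k) ?C"
        by (intro commutes_diff commutes_mult commutes_add commutes_scal)
      then have "?C * Z k = Z k * ?C" by (simp only: commutes_def)
      then show ?thesis by - (rule exI)
    qed
  qed
  then show ?thesis by (simp add: commutes_def m_def)
qed

lemma Top_left_end:
  "commutes (Top 0) (Top 1 * Top 0 * Top 1 + scal (par_t P) * Top 1)"
proof -
  have m: "(1::nat) \<le> 1" "1 < n" using n_ge_2 by auto
  let ?v = "Top 1 * Top 0 * Top 1 + scal (par_t P) * Top 1"
  let ?C = "Top 0 * ?v - ?v * Top 0"
  define h where "h = scal (1/2)"
  have h: "A * h = h * A" for A unfolding h_def by (rule scal_right)
  \<comment> \<open>\<open>deformed_B2\<close> applies to the variables centred at one half; this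
    turns anticommutation with a centred variable into a relation for the variable itself.\<close>
  have shift: "C * x = (- (x + h) - h) * C" if "C * (- (x + h)) = - (- (x + h) * C)" for C x
  proof -
    have "C * x = - (C * (- (x + h))) - C * h" by (simp add: right_diff_distrib)
    also have "\<dots> = - (x + h) * C - h * C" by (simp only: that h minus_minus)
    finally show ?thesis by (simp only: left_diff_distrib)
  qed
  let ?z = "- (Z 1 + h)" and ?y = "- (Z 2 + h)"
  have c: "Top 0 * Z 2 = Z 2 * Top 0" "Z 2 * Z 1 = Z 1 * Z 2"
    using Top_Z_untouched[of 0 2] Z_commute[of 2 1] m
    by (auto simp: touches_def commutes_def)
  have c': "Top 0 * ?y = ?y * Top 0" "?y * ?z = ?z * ?y"
    using h[of "Top 0"] h[of "Z 1"] h[of "Z 2"] by (simp_all add: left_diff_distrib right_diff_distrib c[simplified])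
  have s: "Top 1 * ?z = ?y * Top 1 - scal (par_t P)" "Top 1 * ?y = ?z * Top 1 + scal (par_t P)"
    using Top_Z_cross[OF m, unfolded one_add_one] h[of "Top 1"]
    by (simp_all add: left_diff_distrib right_diff_distrib)
  have b: "Top 0 * Top 0 = scal ((par_t0 P)\<^sup>2)"
    using Top_end_sq[of 0] by (simp add: chi_def)
  note rel = deformed_B2[OF scal_right scal_right scal_right scal_right
    scal_right scal_right scal_right scal_right scal_right
    scal_right scal_right scal_right scal_right scal_right scal_right
    Top_quad[OF m] s b Top_Z_0[folded h_def] c']
  have "?C = 0"
  proof (rule Z_zeroI)
    show "app ?C 1 = 0"
      using m by (simp add: app_simps app_Top_1 app_Top_chi chi_def app_scal app_one_op app_add
        app_cscale Polys_cscale cfun.scale_right_distrib mult.commute)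
    fix k :: nat assume k: "1 \<le> k"
    consider "k = 1" | "k = 2" | "\<not> touches 1 k" "\<not> touches 0 k"
      using that by (cases "k = 1"; cases "k = 2") (auto simp: touches_def numeral_2_eq_2)
    then show "\<exists>D. ?C * Z k = D * ?C"
    proof cases
      case 1
      show ?thesis unfolding 1 by (rule exI, rule shift, rule rel(1))
    next
      case 2
      show ?thesis unfolding 2 by (rule exI, rule shift, rule rel(2))
    next
      case 3
      then have "commutes (Z k) (Top 1)" "commutes (Z k) (Top 0)"
        using m k by (auto intro!: commutes_sym[OF Top_Z_untouched])
      then have "commutes (Z k) ?C"
        by (intro commutes_diff commutes_mult commutes_add commutes_scal)
      then have "?C * Z k = Z k * ?C" by (simp only: commutes_def)
      then show ?thesis by - (rule exI)
    qed
  qed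
  then show ?thesis by (simp add: commutes_def)
qed

sublocale double_affine_hecke n Top "scal (par_t P)" Z "scal (1/2)" "scal ((par_t0 P)\<^sup>2)"
  "scal ((par_tn P)\<^sup>2)" "scal ((par_u0 P)\<^sup>2)" "scal ((par_un P)\<^sup>2)"
proof
  show "(Z n - Top n) * (Z n - Top n) = scal ((par_un P)\<^sup>2)"
    using Top_Z_n Top_end_sq[of n] n_ge_2 by (simp add: algebra_simps chi_def scal_diff)
  show "(Top 0 + scal (1/2) + Z 1) * (Top 0 + scal (1/2) + Z 1) = scal ((par_u0 P)\<^sup>2)"
  proof -
    define z where "z = - (Z 1 + scal (1/2))"
    have 1: "Top 0 + scal (1/2) + Z 1 = Top 0 - z" by (simp add: z_def)
     have "(Top 0 - z) * (Top 0 - z) = scal ((par_u0 P)\<^sup>2)"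
      using Top_Z_0 Top_end_sq[of 0] unfolding z_def[symmetric]
      by (simp add: algebra_simps chi_def scal_diff)
    then show ?thesis by (simp only: 1)
  qed
  show "commutes (Top i) (Z j)" if "1 \<le> j" "j \<le> n" "i \<le> n" "i \<noteq> j" "j \<noteq> i + 1" for i j
    using that by (intro Top_Z_far) auto
qed (use n_ge_2 Top_quad Top_far Top_braid Top_right_end Top_left_end scal_central Top_Z_cross(1)
      Top_end_sq[of 0] Top_end_sq[of n] in \<open>auto simp: chi_def\<close>)

end

section \<open>Polynomials in the Cherednik operators\<close>

text \<open>\<open>A\<close> is a value of \<open>f\<close> at the operators \<open>y\<close>. A
  relation rather than a function, because a polynomial function has no preferred expression; each
  lemma treats an arbitrary derivation.\<close>

inductive peval :: "nat \<Rightarrow> (nat \<Rightarrow> op) \<Rightarrow> cfun \<Rightarrow> op \<Rightarrow> bool" for n :: nat and y :: "nat \<Rightarrow> op" where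
  const: "peval n y (\<lambda>_. c) (scal c)"
| var: "i \<in> {1..n} \<Longrightarrow> peval n y (\<lambda>x. x i) (y i)"
| add: "peval n y f A \<Longrightarrow> peval n y g B \<Longrightarrow> peval n y (\<lambda>x. f x + g x) (A + B)"
| mult: "peval n y f A \<Longrightarrow> peval n y g B \<Longrightarrow> peval n y (\<lambda>x. f x * g x) (A * B)"

lemma peval_polys: "peval n y f A \<Longrightarrow> f \<in> polys n"
  by (induction rule: peval.induct) (auto intro: polys.intros)

lemma peval_exists: "f \<in> polys n \<Longrightarrow> \<exists>A. peval n y f A"
  by (induction rule: polys.induct) (blast intro: peval.intros)+

lemma peval_uminus: "peval n y f A \<Longrightarrow> peval n y (\<lambda>x. - f x) (- A)"
  using peval.mult[OF peval.const[of n y "-1"], of f A] by (simp add: scal_uminus scal_1)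

lemma peval_diff: "peval n y f A \<Longrightarrow> peval n y g B \<Longrightarrow> peval n y (\<lambda>x. f x - g x) (A - B)"
  using peval.add[OF _ peval_uminus, of n y f A g B] by simp

lemma peval_eigen:
  assumes "peval n y f A" "p \<in> Polys" "\<And>i. i \<in> {1..n} \<Longrightarrow> app (y i) p = cscale (w i) p"
  shows "app A p = cscale (f w) p"
  using assms(1)
proof (induction rule: peval.induct)
  case (mult f A g B)
  then show ?case using assms(2) by (simp add: app_times_op app_cscale mult.commute)
qed (use assms in \<open>auto simp: app_scal app_one_op app_plus_op cfun.scale_left_distrib\<close>)

lemma peval_commutes:
  assumes "peval n y f A" "\<And>i. i \<in> {1..n} \<Longrightarrow> commutes B (y i)"
  shows "commutes B A"
  using assms(1)
  by (induction rule: peval.induct)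
     (auto intro!: commutes_add commutes_mult assms(2) commutes_sym[OF scal_central])

lemma dd_mult':
  assumes "1 \<le> n" "i \<le> n" "p \<in> Polys" "q \<in> Polys"
  shows "dd n i (\<lambda>x. p x * q x) = (\<lambda>x. dd n i p x * q (gen n i x) + p x * dd n i q x)"
  using dd_mult[of n i q p] assms by (simp add: mult.commute)

text \<open>Lusztig's relation, propagated from the variables to all polynomials.\<close>

lemma peval_cross:
  assumes n: "1 \<le> n" "i \<le> n"
    and var: "\<And>j. j \<in> {1..n} \<Longrightarrow> \<exists>A' A''. peval n y (\<lambda>x. gen n i x j) A' \<and>
        peval n y (dd n i (\<lambda>x. x j)) A'' \<and> y j * a = a * A' + N * A''"
    and N: "\<And>j. j \<in> {1..n} \<Longrightarrow> commutes N (y j)"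
    and f: "peval n y f A"
  shows "\<exists>A' A''. peval n y (\<lambda>x. f (gen n i x)) A' \<and> peval n y (dd n i f) A'' \<and> A * a = a * A' + N * A''"
  using f
proof (induction rule: peval.induct)
  case (const c)
  have "dd n i (\<lambda>_. c) = (\<lambda>_. 0)" using n by (intro dd_eqI) auto
  then show ?case
    using peval.const[of n y c] peval.const[of n y 0] scal_central[of c a]
    by (intro exI[of _ "scal c"] exI[of _ "scal 0"]) (simp add: scal_0 commutes_def)
next
  case (var j)
  then show ?case by (rule assms(3))
next
  case (add f A g B)
  then obtain A' A'' B' B'' where *: "peval n y (\<lambda>x. f (gen n i x)) A'" "peval n y (dd n i f) A''"
    "A * a = a * A' + N * A''" "peval n y (\<lambda>x. g (gen n i x)) B'" "peval n y (dd n i g) B''"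
    "B * a = a * B' + N * B''" by blast
  have fg: "f \<in> Polys" "g \<in> Polys" using add peval_polys polys_Polys by blast+
  have "dd n i (\<lambda>x. f x + g x) = (\<lambda>x. dd n i f x + dd n i g x)"
    using dd_linear[OF n] fg unfolding linear_on_Polys_def by (simp add: plus_fun_def)
  then have "peval n y (dd n i (\<lambda>x. f x + g x)) (A'' + B'')"
    using peval.add[OF *(2,5)] by simp
  moreover have "(A + B) * a = a * (A' + B') + N * (A'' + B'')"
    by (simp add: distrib_left distrib_right *)
  ultimately show ?case
    using peval.add[OF *(1,4)] by blast
next
  case (mult f A g B)
  then obtain A' A'' B' B'' where *: "peval n y (\<lambda>x. f (gen n i x)) A'" "peval n y (dd n i f) A''"
    "A * a = a * A' + N * A''" "peval n y (\<lambda>x. g (gen n i x)) B'" "peval n y (dd n i g) B''"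
    "B * a = a * B' + N * B''" by blast
  have fg: "f \<in> Polys" "g \<in> Polys" using mult peval_polys polys_Polys by blast+
  have "peval n y (dd n i (\<lambda>x. f x * g x)) (A'' * B' + A * B'')"
    unfolding dd_mult'[OF n fg] using * mult by (intro peval.intros)
  moreover have "A * B * a = a * (A' * B') + N * (A'' * B' + A * B'')"
  proof -
    \<comment> \<open>This brings \<open>N\<close> to the front; its coefficient is then the Leibniz
      rule in the form \<open>dd_mult'\<close>, with the second factor reflected.\<close>
    have "A * N = N * A"
      using peval_commutes[OF mult(1) N] by (simp add: commutes_def)
    then have "A * (N * B'') = N * (A * B'')" by (simp only: mult.assoc[symmetric])
    moreover have "A * (a * B') = a * (A' * B') + N * (A'' * B')"
      by (simp only: mult.assoc[symmetric] * distrib_right)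
    ultimately show ?thesis
      by (simp only: mult.assoc * distrib_left add.assoc)
  qed
  ultimately show ?case
    using peval.mult[OF *(1,4)] by blast
qed

section \<open>Agreement with the defined operators, and the action on constants\<close>

context wilson
begin

text \<open>Off the mirror, dividing \<open>aff_dd\<close> by \<open>aff\<close> gives the rational
  formula; \<open>polys_cancel_aff\<close> makes the polynomial with these values unique.\<close>

lemma T_op_eq:
  assumes "i \<le> n" "p \<in> polys n"
  shows "T_op n P i p = app (Top i) p" "app (Top i) p \<in> polys n"
proof -
  have p: "p \<in> Polys" and n: "1 \<le> n" using assms polys_Polys n_ge_2 by auto
  have "(\<lambda>x. chi n P i * p (gen n i x) + nu i x * dd n i p x) \<in> polys n"
    using assms n nu_polys dd_polys by (intro polys.intros polys_gen) auto
  then show *: "app (Top i) p \<in> polys n" using assms p by (simp add: app_Top)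
  have val: "app (Top i) p x =
      chi n P i * act (gen n i) p x + dcoef n P i x * (act (gen n i) p x - p x)"
    if "aff n i x \<noteq> 0" for x
  proof -
    have "dcoef n P i x = nu i x / aff n i x"
      using assms n by (auto simp: dcoef_def nu_def aff_def)
    moreover have "dd n i p x = (p (gen n i x) - p x) / aff n i x"
      using aff_dd[OF n assms(1) p, of x] that by (simp add: field_simps)
    ultimately show ?thesis
      using assms p by (simp add: app_Top act_def inv_gen)
  qed
  show "T_op n P i p = app (Top i) p"
    unfolding T_op_def
  proof (rule the_equality)
    fix q assume q: "q \<in> polys n \<and> (\<forall>x. aff n i x \<noteq> 0 \<longrightarrow> q x = chi n P i * act (gen n i) p x
      + dcoef n P i x * (act (gen n i) p x - p x))"
    show "q = app (Top i) p"
      by (rule polys_cancel_aff[OF _ _ n assms(1)]) (use q val polys_Polys in auto)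
  qed (use * val in auto)
qed

lemma T_word:
  "set ws \<subseteq> {0..n} \<Longrightarrow> p \<in> polys n \<Longrightarrow> foldr (T_op n P) ws p = app (prod_list (map Top ws)) p
    \<and> app (prod_list (map Top ws)) p \<in> polys n"
proof (induction ws)
  case Nil
  then show ?case by (simp add: app_one_op polys_Polys)
next
  case (Cons i ws)
  then show ?case using T_op_eq[of i] by (auto simp: app_times_op)
qed

lemma app_sum: "app (sum A I) p = (\<Sum>i\<in>I. app (A i) p)"
  by (induction I rule: infinite_finite_induct) (auto simp: app_plus_op)

lemma Y_op_eq:
  assumes "1 \<le> i" "i \<le> n" "p \<in> polys n"
  shows "Y_op n P i p = app (Y i) p" "app (Y i) p \<in> polys n"
proof -
  let ?w1 = "[i..<n] @ [n] @ rev [i..<n]" and ?w2 = "rev [1..<i] @ [0] @ [1..<i]"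
  let ?w3 = "\<lambda>j. [i..<j-1] @ [j-1] @ rev [i..<j-1]"
  have sub: "set ?w1 \<subseteq> {0..n}" "set ?w2 \<subseteq> {0..n}" "\<And>j. j \<in> {i+1..n} \<Longrightarrow> set (?w3 j) \<subseteq> {0..n}"
    using assms by auto
  have sum: "(\<Sum>j = i+1..n. Tij n P i j p) = (\<Sum>j = i+1..n. app (prod_list (map Top (?w3 j))) p)"
    unfolding Tij_def using T_word[OF sub(3) assms(3)] by (intro sum.cong) auto
  have p: "p \<in> Polys" using assms polys_Polys by blast
  have PP: "(\<Sum>j\<in>J. app (prod_list (map Top (?w3 j))) p) \<in> Polys" for J
    by (induction J rule: infinite_finite_induct) (auto simp del: plus_fun_apply zero_fun_apply)
  show "Y_op n P i p = app (Y i) p"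
    unfolding Y_op_def Y_def V_def R_def sum app_plus_op app_times_op app_scal app_sum
    using T_word[OF sub(1) assms(3)] T_word[OF sub(2) assms(3)] PP
    by (simp only: app_one_op if_True ac_simps)
  have "(\<Sum>j\<in>J. app (prod_list (map Top (?w3 j))) p) \<in> polys n" if "J \<subseteq> {i+1..n}" for J
    using finite_subset[OF that finite_atLeastAtMost] that
  proof (induction J rule: finite_induct)
    case (insert j J)
    then show ?case using T_word[OF sub(3) assms(3), of j]
      by (auto simp del: plus_fun_apply zero_fun_apply intro!: polys_plus)
  qed (simp add: polys_0 del: zero_fun_apply)
  from this[of "{i+1..n}"] show "app (Y i) p \<in> polys n"
    unfolding Y_def V_def R_def app_plus_op app_times_op app_scal app_sum
    using T_word[OF sub(1) assms(3)] T_word[OF sub(2) assms(3)] PP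
    by (simp only: app_one_op if_True polys_plus polys_cscale order_refl)
qed

lemma U_op_eq:
  assumes "p \<in> polys n"
  shows "U_op n P p = app U p" "app U p \<in> polys n"
proof -
  have sub: "set [1..<n] \<subseteq> {0..n}" "set (rev [1..<n]) \<subseteq> {0..n}" by auto
  define q where "q = app (prod_list (map Top (rev [1..<n]))) p"
  have q: "foldr (T_op n P) (rev [1..<n]) p = q" "q \<in> polys n"
    using T_word[OF sub(2) assms] by (auto simp: q_def)
  then have qP: "q \<in> Polys" using polys_Polys by blast
  define r where "r = app (Z n - Top n) q"
  have m: "app (Z n) q = - (\<lambda>x. x n * q x)" "(\<lambda>x. x n * q x) \<in> polys n"
    using q qP n_ge_2 by (auto simp: Z_def app_uminus_op app_Mul intro!: polys.intros)
  have r: "- (\<lambda>x. x n * q x) - T_op n P n q = r" "r \<in> polys n"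
    using q m T_op_eq[of n q] by (auto simp: r_def app_simps intro!: polys_diff polys_uminus)
  have U: "app U p = app (prod_list (map Top [1..<n])) r"
    unfolding U_word r_def q_def by (simp add: app_times_op)
  show "U_op n P p = app U p" "app U p \<in> polys n"
    using T_word[OF sub(1) r(2)] unfolding U U_op_def q(1) r(1) by auto
qed

lemma S_gen_eq:
  assumes "i \<le> n" "p \<in> polys n"
  shows "S_gen n P i p = app (S i) p" "app (S i) p \<in> polys n"
proof -
  define a where "a = (if i = 0 then U else Top i)"
  define b where "b = (if i = 0 then 1 - (Y 1 + Y 1) else if i = n then Y n + Y n else Y i - Y (i + 1))"
  have S: "S i = a * b - b * a" by (auto simp: S_def a_def b_def)
  have a: "(if i = 0 then U_op n P else T_op n P i) q = app a q" "app a q \<in> polys n" if "q \<in> polys n" for q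
    using that U_op_eq T_op_eq assms by (auto simp: a_def)
  have two: "cscale 2 q = q + q" for q by (simp add: cscale_def fun_eq_iff)
  have b: "aY_op n P i q = app b q \<and> app b q \<in> polys n" if q: "q \<in> polys n" for q
  proof -
    consider "i = 0" | "i = n" | "1 \<le> i" "i < n" using assms(1) by linarith
    then show ?thesis
    proof cases
      case 1
      then show ?thesis using Y_op_eq[OF order_refl _ q] n_ge_2 q polys_Polys[OF q]
        by (simp only: 1 aY_op_def b_def two app_simps app_one_op if_True polys_diff polys_plus One_nat_def[symmetric])
    next
      case 2
      have n0: "(n = 0) = False" using n_ge_2 by simp
      have n1: "1 \<le> n" using n_ge_2 by simp
      show ?thesis
        by (simp only: 2 n0 if_False if_True aY_op_def b_def two app_simps polys_plus
            Y_op_eq[OF n1 order_refl q] simp_thms)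
    next
      case 3
      then show ?thesis using Y_op_eq[of i q] Y_op_eq[of "i+1" q] n_ge_2 q
        by (auto simp: aY_op_def b_def app_simps intro!: polys_diff)
    qed
  qed
  show "S_gen n P i p = app (S i) p" "app (S i) p \<in> polys n"
    using a b assms by (auto simp: S_gen_def commutator_def S app_simps intro!: polys_diff)
qed

text \<open>The letters below \<open>n\<close> fix \<open>1\<close>, \<open>Top n\<close> gives
  \<open>par_tn\<close>, and each step of the recursion adds one \<open>par_t\<close>. Together with
  \<open>par_t0\<close> from \<open>R i\<close> this is \<open>gamma0\<close>.\<close>

lemma V_1_eigen: "1 \<le> i \<Longrightarrow> i \<le> n \<Longrightarrow> app (V i) 1 = cscale (par_tn P + of_nat (n - i) * par_t P) 1"
proof (rotate_tac, induction i rule: inc_induct)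
  case base
  show ?case using n_ge_2 by (simp add: V_n app_Top_1 chi_def del: one_fun_apply)
next
  case (step i)
  define v where "v = par_tn P + of_nat (n - Suc i) * par_t P"
  have T1: "app (Top i) 1 = 1"
    using step by (simp add: app_Top_1 chi_def del: one_fun_apply)
  have V1: "app (V (i + 1)) 1 = cscale v 1"
    using step by (simp add: v_def del: one_fun_apply)
  have "V i = Top i * V (i + 1) * Top i + scal (par_t P) * Top i"
    using V_rec step by blast
  then have "app (V i) 1 = cscale v 1 + cscale (par_t P) 1"
    by (simp only: app_simps app_scal T1 V1 app_cscale Polys_1 app_one_op if_True)
  also have "\<dots> = cscale (v + par_t P) 1"
    by (simp only: cfun.scale_left_distrib)
  also have "v + par_t P = par_tn P + of_nat (n - i) * par_t P"
  proof -
    have "n - i = Suc (n - Suc i)" using step by simp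
    then show ?thesis by (simp add: v_def algebra_simps)
  qed
  finally show ?case .
qed

lemma R_1_eigen: "1 \<le> i \<Longrightarrow> i \<le> n \<Longrightarrow> app (R i) 1 = cscale (par_t0 P) 1"
proof (induction i rule: nat_induct_at_least)
  case base
  show ?case by (simp add: R_1 app_Top_1 chi_def del: one_fun_apply)
next
  case (Suc i)
  then show ?case
    using R_rec[of i] by (simp add: app_simps app_Top_1 app_Top_chi chi_def del: one_fun_apply)
qed

lemma Y_1_eigen: "i \<in> {1..n} \<Longrightarrow> app (Y i) 1 = cscale (gamma0 n P i) 1"
  using V_1_eigen[of i] R_1_eigen[of i]
  by (simp add: Y_def app_plus_op gamma0_def cfun.scale_left_distrib add_ac del: one_fun_apply plus_fun_apply)

end

section \<open>Weights and the duality pairing\<close>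

context wilson
begin

definition weight :: "cfun \<Rightarrow> point \<Rightarrow> bool" where
  "weight p w \<longleftrightarrow> p \<in> polys n \<and> (\<forall>i \<in> {1..n}. app (Y i) p = cscale (w i) p)"

text \<open>The exchange relations between \<open>Y\<close> and \<open>S\<close>, read on an
  eigenvector; the shift by one half in \<open>Y_S_0\<close> produces the dot action.\<close>

lemma weight_S:
  assumes w: "weight p w" and i: "i \<le> n"
  shows "weight (app (S i) p) (dot_gen n i w)"
  unfolding weight_def
proof (intro conjI ballI)
  have p: "p \<in> polys n" "p \<in> Polys" using w polys_Polys by (auto simp: weight_def)
  have Yp: "app (Y j) p = cscale (w j) p" if "1 \<le> j" "j \<le> n" for j
    using w that by (auto simp: weight_def)
  show "app (S i) p \<in> polys n" using S_gen_eq(2)[OF i p(1)] .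
  let ?q = "app (S i) p"
  fix j assume j: "j \<in> {1..n}"
  then have j': "1 \<le> j" "j \<le> n" by auto
  have mv: "app (Y j) ?q = cscale (w k) ?q" if "Y j * S i = S i * Y k" "1 \<le> k" "k \<le> n" for k
  proof -
    have "app (Y j) ?q = app (S i * Y k) p"
      by (simp only: that(1)[symmetric] app_times_op)
    then show ?thesis using Yp[OF that(2,3)] p by (simp add: app_times_op app_cscale)
  qed
  consider "i = 0" "j = 1" | "i = n" "j = n" | "1 \<le> i" "i < n" "j = i" | "1 \<le> i" "i < n" "j = i + 1"
    | "j \<noteq> i" "j \<noteq> i + 1"
    using i j' n_ge_2 by linarith
  then show "app (Y j) ?q = cscale (dot_gen n i w j) ?q"
  proof cases
    case 1
    have "app ((scal (1/2) + Y 1) * S 0) p = app (- (S 0 * (scal (1/2) + Y 1))) p"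
      by (simp only: Y_S_0)
    then have E0: "cscale (1/2) (app (S 0) p) + app (Y 1) (app (S 0) p)
        = - (cscale (1/2) (app (S 0) p) + cscale (w 1) (app (S 0) p))"
      using p Yp[of 1] n_ge_2
      by (simp add: app_simps app_scal app_one_op app_add app_cscale Polys_cscale)
    have E: "(1/2) * app (S 0) p x + app (Y 1) (app (S 0) p) x
        = - ((1/2) * app (S 0) p x + w 1 * app (S 0) p x)" for x
      using fun_cong[OF E0, of x] by (simp only: cscale_def plus_fun_apply uminus_apply)
    have aux: "b = (- v - 1) * a" if "(1/2) * a + b = - ((1/2) * a + v * a)" for a b v :: complex
    proof -
      have "b = - (v * a) - (a / 2 + a / 2)"
        using that by (simp add: algebra_simps)
      then show ?thesis by (simp add: algebra_simps)
    qed
    have "app (Y 1) (app (S 0) p) = cscale (- w 1 - 1) (app (S 0) p)"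
      unfolding cscale_def by (rule ext) (rule aux[OF E])
    then show ?thesis using 1 by (simp add: dot_gen_def)
  next
    case 2
    have "app (Y n * S n) p = app (- (S n * Y n)) p"
      by (simp only: Y_S_n)
    then have "app (Y n) (app (S n) p) = - cscale (w n) (app (S n) p)"
      using p Yp[of n] n_ge_2 by (simp add: app_simps app_cscale)
    then show ?thesis using 2 n_ge_2 by (simp add: dot_gen_def gen_def)
  next
    case 3
    have "app (Y j) ?q = cscale (w (i + 1)) ?q"
      using 3 Y_S_mid(1)[OF 3(1,2)] by (intro mv) auto
    then show ?thesis using 3 by (simp add: dot_gen_def gen_def)
  next
    case 4
    have "app (Y j) ?q = cscale (w i) ?q" using 4 Y_S_mid(2)[OF 4(1,2)] by (intro mv) auto
    then show ?thesis using 4 by (simp add: dot_gen_def gen_def)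
  next
    case 5
    have "Y j * S i = S i * Y j"
      using Y_S_far[OF i j' 5] by (simp add: commutes_def)
    moreover have "dot_gen n i w j = w j"
      using 5 j' by (auto simp: dot_gen_def gen_def)
    ultimately show ?thesis using mv j' by simp
  qed
qed

lemma weight_1: "weight 1 (gamma0 n P)"
  using Y_1_eigen by (simp add: weight_def polys_1)

lemma weight_word:
  "set ws \<subseteq> {0..n} \<Longrightarrow> weight (foldr (S_gen n P) ws 1) (foldr (dot_gen n) ws (gamma0 n P))"
proof (induction ws)
  case Nil
  show ?case using weight_1 by (simp del: one_fun_apply)
next
  case (Cons i ws)
  then have w: "weight (foldr (S_gen n P) ws 1) (foldr (dot_gen n) ws (gamma0 n P))" and i: "i \<le> n"
    by (auto simp del: one_fun_apply)
  then have "S_gen n P i (foldr (S_gen n P) ws 1) = app (S i) (foldr (S_gen n P) ws 1)"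
    by (intro S_gen_eq) (auto simp: weight_def)
  with weight_S[OF w i] show ?case by (simp del: one_fun_apply)
qed

text \<open>\<open>S_op\<close> and \<open>dot\<close> use the same chosen reduced word, so
  \<open>weight_word\<close> pairs the polynomial with its spectral point.\<close>

lemma weight_nonsym_wilson:
  assumes "u_elt n l \<in> affW n"
  shows "weight (nonsym_wilson n P l) (gamma n P l)"
  unfolding nonsym_wilson_def S_op_def gamma_def dot_def
  by (rule weight_word) (use word_of_reduced_word(1)[OF assms] in \<open>simp add: word_of_def\<close>)

end

section \<open>The duality pairing\<close>

locale wilson_pair = wilson n P + dual: wilson n "sigma P" for n :: nat and P :: params
begin

definition W :: "nat \<Rightarrow> op" where
  "W i = - Y i"

text \<open>The counterpart of \<open>dual.Top i\<close>, with \<open>U\<close> in the place of the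
  affine generator.\<close>

definition dual_gen :: "nat \<Rightarrow> op" where
  "dual_gen i = (if i = 0 then U else Top i)"

definition dual_nu :: "nat \<Rightarrow> op" where
  "dual_nu i = (if i = 0 then scal ((par_un P)\<^sup>2 - (par_u0 P)\<^sup>2) + (scal (1/2) - W 1) * (scal (1/2) - W 1)
     else if i = n then scal ((par_tn P)\<^sup>2 - (par_t0 P)\<^sup>2) + W n * W n
     else scal (par_t P))"

definition ev :: "cfun \<Rightarrow> complex" where
  "ev p = p (- gamma0 n (sigma P))"

lemma sigma_sel: "par_t0 (sigma P) = par_un P" "par_u0 (sigma P) = par_u0 P"
  "par_t (sigma P) = par_t P" "par_tn (sigma P) = par_tn P" "par_un (sigma P) = par_t0 P"
  by (simp_all add: sigma_def)

lemma peval_dual_nu: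
  assumes "i \<le> n" shows "peval n W (dual.nu i) (dual_nu i)"
proof -
  have v: "peval n W (\<lambda>x. x j) (W j)" if "1 \<le> j" "j \<le> n" for j
    using that by (intro peval.var) auto
  consider "i = 0" | "i = n" | "i \<noteq> 0" "i \<noteq> n" by blast
  then show ?thesis
  proof cases
    case 1
    have "dual.nu i = (\<lambda>x. ((par_un P)\<^sup>2 - (par_u0 P)\<^sup>2) + (1/2 - x 1) * (1/2 - x 1))"
      using 1 by (simp add: dual.nu_def sigma_sel fun_eq_iff power2_eq_square)
    then show ?thesis
      unfolding dual_nu_def using 1 n_ge_2
      by (auto intro!: peval.add peval.mult peval_diff v peval.const)
  next
    case 2
    have "dual.nu i = (\<lambda>x. ((par_tn P)\<^sup>2 - (par_t0 P)\<^sup>2) + x n * x n)"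
      using 2 n_ge_2 by (simp add: dual.nu_def sigma_sel fun_eq_iff power2_eq_square)
    then show ?thesis
      unfolding dual_nu_def using 2 n_ge_2
      by (auto intro!: peval.add peval.mult v peval.const)
  next
    case 3
    then show ?thesis
      using peval.const[of n W "par_t P"] by (simp add: dual.nu_def[abs_def] sigma_sel dual_nu_def)
  qed
qed

lemma W_W: "1 \<le> i \<Longrightarrow> i \<le> n \<Longrightarrow> 1 \<le> j \<Longrightarrow> j \<le> n \<Longrightarrow> commutes (W i) (W j)"
  using Y_Y[of i j] by (simp add: W_def commutes_def)

text \<open>Case by case these are \<open>U_Y1_sq\<close>, \<open>Yn_sq\<close>,
  \<open>Y_rec\<close> and commutation, rewritten for \<open>W = - Y\<close>: the cross relations of
  the dual generators with the variables, with products reversed.\<close>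

lemma W_cross:
  assumes i: "i \<le> n" and j: "j \<in> {1..n}"
  shows "\<exists>A' A''. peval n W (\<lambda>x. gen n i x j) A' \<and> peval n W (dd n i (\<lambda>x. x j)) A'' \<and>
    W j * dual_gen i = dual_gen i * A' + dual_nu i * A''"
proof -
  have n1: "1 \<le> n" and j': "1 \<le> j" "j \<le> n" using j n_ge_2 by auto
  have v: "peval n W (\<lambda>x. x k) (W k)" if "1 \<le> k" "k \<le> n" for k
    using that by (intro peval.var) auto
  have dd: "dd n i (\<lambda>x. x j) = (\<lambda>_. d)" if "\<And>x. aff n i x * d = gen n i x j - x j" for d
    by (rule dd_eqI[OF n1 i]) (use that in auto)
  consider "i = 0" "j = 1" | "i = n" "j = n" | "1 \<le> i" "i < n" "j = i" | "1 \<le> i" "i < n" "j = i + 1"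
    | "j \<noteq> i" "j \<noteq> i + 1 \<or> i = n"
    using i j' n_ge_2 by linarith
  then show ?thesis
  proof cases
    case 1
    have "dd n i (\<lambda>x. x j) = (\<lambda>_. 1)" using 1 by (intro dd) (auto simp: aff_def gen_def)
    moreover have "peval n W (\<lambda>x. gen n i x j) (scal 1 - W 1)"
      using peval_diff[OF peval.const v, of 1 1] n1 1 by (simp add: gen_def)
    moreover have "W j * dual_gen i = dual_gen i * (scal 1 - W 1) + dual_nu i * scal 1"
    proof -
      \<comment> \<open>Two halves make the \<open>1\<close> of the reflection \<open>1 - x\<close>;
        expanding \<open>U_Y1_sq\<close> with \<open>U * U\<close> known leaves the cross
        relation.\<close>
      define h where "h = scal (1/2)"
      have h: "h + h = 1" unfolding h_def scal_add[symmetric] by (simp add: scal_1)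
      have hc: "U * h = h * U" "Y 1 * h = h * Y 1"
        unfolding h_def by (rule scal_right)+
      have uu: "U * U = scal ((par_un P)\<^sup>2)" by (rule U_sq)
      have "(U + h + Y 1) * (U + h + Y 1) = scal ((par_u0 P)\<^sup>2)"
        unfolding h_def by (rule U_Y1_sq)
      moreover have "(U + h + Y 1) * (U + h + Y 1)
          = U * U + U * (h + h) + U * Y 1 + Y 1 * U + (h + Y 1) * (h + Y 1)"
        by (simp add: algebra_simps hc)
      ultimately have "scal ((par_un P)\<^sup>2) + U + U * Y 1 + Y 1 * U + (h + Y 1) * (h + Y 1) = scal ((par_u0 P)\<^sup>2)"
        by (simp add: h uu)
      then show ?thesis
        using 1 by (simp add: dual_gen_def dual_nu_def W_def scal_1 scal_diff h_def[symmetric] algebra_simps)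
    qed
    ultimately show ?thesis using peval.const by metis
  next
    case 2
    have "dd n i (\<lambda>x. x j) = (\<lambda>_. - 1)" using 2 n1 by (intro dd) (auto simp: aff_def gen_def)
    moreover have "peval n W (\<lambda>x. gen n i x j) (- W n)"
      using peval_uminus[OF v, of n] n1 2 by (simp add: gen_def)
    moreover have "W j * dual_gen i = dual_gen i * (- W n) + dual_nu i * scal (- 1)"
      using Yn_sq Tn_sq 2 n1
      by (simp add: dual_gen_def dual_nu_def W_def scal_1 scal_diff scal_uminus algebra_simps)
    ultimately show ?thesis using peval.const by metis
  next
    case 3
    have "dd n i (\<lambda>x. x j) = (\<lambda>_. - 1)" using 3 by (intro dd) (auto simp: aff_def gen_def)
    moreover have "peval n W (\<lambda>x. gen n i x j) (W (i + 1))"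
      using v[of "i + 1"] 3 by (simp add: gen_def)
    moreover have "W j * dual_gen i = dual_gen i * W (i + 1) + dual_nu i * scal (- 1)"
      using commutes_cross(2)[OF 3(1,2) Y_rec[OF 3(1,2)]] 3
      by (simp add: dual_gen_def dual_nu_def W_def scal_1 scal_uminus)
    ultimately show ?thesis using peval.const by metis
  next
    case 4
    have "dd n i (\<lambda>x. x j) = (\<lambda>_. 1)" using 4 by (intro dd) (auto simp: aff_def gen_def)
    moreover have "peval n W (\<lambda>x. gen n i x j) (W i)"
      using v[of i] 4 by (simp add: gen_def)
    moreover have "W j * dual_gen i = dual_gen i * W i + dual_nu i * scal 1"
      using commutes_cross(1)[OF 4(1,2) Y_rec[OF 4(1,2)]] 4
      by (simp add: dual_gen_def dual_nu_def W_def scal_1)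
    ultimately show ?thesis using peval.const by metis
  next
    case 5
    have g: "gen n i x j = x j" for x using 5 j' by (auto simp: gen_def)
    have "dd n i (\<lambda>x. x j) = (\<lambda>_. 0)" by (intro dd) (simp add: g)
    moreover have "peval n W (\<lambda>x. gen n i x j) (W j)"
      using v j' by (simp add: g)
    moreover have "commutes (dual_gen i) (Y j)"
      using i j' 5 unfolding dual_gen_def by (auto intro!: U_Y Y_T Y_Tn simp: le_less)
    then have "W j * dual_gen i = dual_gen i * W j + dual_nu i * scal 0"
      by (simp add: W_def scal_0 commutes_def)
    ultimately show ?thesis using peval.const by metis
  qed
qed

lemma dual_nu_W: "i \<le> n \<Longrightarrow> j \<in> {1..n} \<Longrightarrow> commutes (dual_nu i) (W j)"
  using peval_commutes[OF peval_dual_nu[of i], of "W j"] W_W[of j] by (auto intro: commutes_sym)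

text \<open>At minus the normalization point \<open>nu i\<close> equals
  \<open>- chi n P i * aff n i\<close>, so the reflected value of \<open>q\<close> cancels.\<close>

lemma ev_Top:
  assumes "1 \<le> i" "i \<le> n" "q \<in> Polys"
  shows "ev (app (Top i) q) = chi n P i * ev q"
proof -
  define x where "x = - gamma0 n (sigma P)"
  have "nu i x = - chi n P i * aff n i x"
    using assms by (auto simp: x_def sigma_sel nu_def chi_def aff_def gamma0_def power2_eq_square algebra_simps of_nat_diff)
  then have "nu i x * dd n i q x = - chi n P i * (aff n i x * dd n i q x)"
    by simp
  also have "aff n i x * dd n i q x = q (gen n i x) - q x"
    using assms n_ge_2 by (intro aff_dd) auto
  finally show ?thesis
    using assms by (simp add: ev_def x_def[symmetric] app_Top algebra_simps)
qed

lemma ev_add: "ev (p + q) = ev p + ev q" and ev_diff: "ev (p - q) = ev p - ev q"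
  and ev_cscale: "ev (cscale c p) = c * ev p"
  by (simp_all add: ev_def cscale_def)

lemma ev_word: "set ws \<subseteq> {1..<n} \<Longrightarrow> q \<in> Polys \<Longrightarrow> ev (app (prod_list (map Top ws)) q) = ev q"
proof (induction ws)
  case Nil
  then show ?case by (simp add: app_one_op)
next
  case (Cons i ws)
  then show ?case using ev_Top[of i] by (simp add: app_times_op chi_def)
qed

text \<open>The letters on both sides evaluate to one; in the middle \<open>Z n\<close> contributes
  \<open>par_tn P + par_un P\<close>, and \<open>- Top n\<close> removes
  \<open>par_tn P\<close>.\<close>

lemma ev_U:
  assumes "q \<in> Polys" shows "ev (app U q) = par_un P * ev q"
proof -
  define r where "r = app (prod_list (map Top (rev [1..<n]))) q"
  have r: "r \<in> Polys" "ev r = ev q" using ev_word[of "rev [1..<n]" q] assms by (auto simp: r_def)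
  have "ev (app U q) = ev (app (Z n - Top n) r)"
    unfolding U_word r_def app_times_op by (rule ev_word) auto
  also have "\<dots> = ev (app (Z n) r) - par_tn P * ev r"
    using ev_Top[of n r] r n_ge_2 by (simp add: app_minus_op ev_diff chi_def)
  also have "ev (app (Z n) r) = (par_tn P + par_un P) * ev r"
    using r n_ge_2 by (simp add: Z_def ev_def app_uminus_op app_Mul gamma0_def sigma_sel algebra_simps)
  finally show ?thesis by (simp add: r algebra_simps)
qed

lemma ev_dual_gen: "i \<le> n \<Longrightarrow> q \<in> Polys \<Longrightarrow> ev (app (dual_gen i) q) = chi n (sigma P) i * ev q"
  using ev_Top[of i q] ev_U[of q] by (auto simp: dual_gen_def chi_def sigma_sel)

text \<open>\<open>A\<close> and \<open>A'\<close> are adjoint for the pairing \<open>\<langle>p, f\<rangle> = (f (-Y) p) (-x\<^sub>0)\<close>.\<close>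

definition adjoint :: "op \<Rightarrow> op \<Rightarrow> bool" where
  "adjoint A A' \<longleftrightarrow> (\<forall>f F. peval n W f F \<longrightarrow>
     (\<exists>F'. peval n W (app A' f) F' \<and> (\<forall>p \<in> Polys. ev (app (F * A) p) = ev (app F' p))))"

lemma peval_W_Polys: "peval n W f F \<Longrightarrow> f \<in> Polys"
  using peval_polys polys_Polys by blast

lemma adjoint_mult: "adjoint A A' \<Longrightarrow> adjoint B B' \<Longrightarrow> adjoint (A * B) (B' * A')"
  unfolding adjoint_def app_times_op
proof (intro allI impI)
  fix f F
  assume A: "\<forall>f F. peval n W f F \<longrightarrow> (\<exists>F'. peval n W (app A' f) F' \<and> (\<forall>p\<in>Polys. ev (app F (app A p)) = ev (app F' p)))"
    and B: "\<forall>f F. peval n W f F \<longrightarrow> (\<exists>F'. peval n W (app B' f) F' \<and> (\<forall>p\<in>Polys. ev (app F (app B p)) = ev (app F' p)))"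
    and "peval n W f F"
  then obtain F' where F': "peval n W (app A' f) F'" "\<forall>p\<in>Polys. ev (app F (app A p)) = ev (app F' p)"
    by blast
  with B obtain F'' where "peval n W (app B' (app A' f)) F''" "\<forall>p\<in>Polys. ev (app F' (app B p)) = ev (app F'' p)"
    by blast
  with F' show "\<exists>F'. peval n W (app B' (app A' f)) F' \<and> (\<forall>p\<in>Polys. ev (app F (app A (app B p))) = ev (app F' p))"
    by auto
qed

lemma adjoint_add: "adjoint A A' \<Longrightarrow> adjoint B B' \<Longrightarrow> adjoint (A + B) (A' + B')"
  unfolding adjoint_def
proof (intro allI impI)
  fix f F
  assume A: "\<forall>f F. peval n W f F \<longrightarrow> (\<exists>F'. peval n W (app A' f) F' \<and> (\<forall>p\<in>Polys. ev (app (F * A) p) = ev (app F' p)))"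
    and B: "\<forall>f F. peval n W f F \<longrightarrow> (\<exists>F'. peval n W (app B' f) F' \<and> (\<forall>p\<in>Polys. ev (app (F * B) p) = ev (app F' p)))"
    and "peval n W f F"
  then obtain F' F'' where F: "peval n W (app A' f) F'" "\<forall>p\<in>Polys. ev (app (F * A) p) = ev (app F' p)"
    "peval n W (app B' f) F''" "\<forall>p\<in>Polys. ev (app (F * B) p) = ev (app F'' p)"
    by metis
  then have "peval n W (app (A' + B') f) (F' + F'')"
    using peval.add[OF F(1,3)] by (simp add: app_plus_op plus_fun_def)
  moreover have "\<forall>p\<in>Polys. ev (app (F * (A + B)) p) = ev (app (F' + F'') p)"
    using F by (simp add: distrib_left app_plus_op ev_add)
  ultimately show "\<exists>F'. peval n W (app (A' + B') f) F' \<and> (\<forall>p\<in>Polys. ev (app (F * (A + B)) p) = ev (app F' p))"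
    by blast
qed

lemma adjoint_scal: "adjoint (scal c) (scal c)"
  unfolding adjoint_def
proof (intro allI impI)
  fix f F assume f: "peval n W f F"
  have "peval n W (app (scal c) f) (scal c * F)"
    using peval.mult[OF peval.const f, of c] peval_W_Polys[OF f]
    by (simp add: app_scal app_one_op cscale_def[abs_def])
  moreover have "ev (app (F * scal c) p) = ev (app (scal c * F) p)" for p
    by (simp only: scal_right)
  ultimately show "\<exists>F'. peval n W (app (scal c) f) F' \<and> (\<forall>p\<in>Polys. ev (app (F * scal c) p) = ev (app F' p))"
    by blast
qed

lemma adjoint_uminus: "adjoint A A' \<Longrightarrow> adjoint (- A) (- A')"
  using adjoint_mult[OF adjoint_scal, of A A' "-1"] by (simp add: scal_uminus scal_1)

text \<open>\<open>peval_cross\<close> moves the generator to the far left, where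
  \<open>ev_dual_gen\<close> turns it into a scalar. What remains is the value at \<open>W\<close>
  of \<open>dual.Top i\<close> applied to \<open>f\<close>.\<close>

lemma adjoint_gen:
  assumes i: "i \<le> n" shows "adjoint (dual_gen i) (dual.Top i)"
  unfolding adjoint_def
proof (intro allI impI)
  fix f F assume f: "peval n W f F"
  have n1: "1 \<le> n" using n_ge_2 by simp
  obtain A' A'' where A: "peval n W (\<lambda>x. f (gen n i x)) A'" "peval n W (dd n i f) A''"
    "F * dual_gen i = dual_gen i * A' + dual_nu i * A''"
    using peval_cross[OF n1 i W_cross[OF i] dual_nu_W[OF i] f] by blast
  have "peval n W (app (dual.Top i) f) (scal (chi n (sigma P) i) * A' + dual_nu i * A'')"
    using dual.app_Top[OF i peval_W_Polys[OF f]] A(1,2) peval_dual_nu[OF i]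
    by (auto intro!: peval.intros)
  moreover have "ev (app (F * dual_gen i) p) = ev (app (scal (chi n (sigma P) i) * A' + dual_nu i * A'') p)" for p
    using i by (simp add: A(3) app_simps ev_add ev_dual_gen app_scal app_one_op ev_cscale)
  ultimately show "\<exists>F'. peval n W (app (dual.Top i) f) F' \<and> (\<forall>p\<in>Polys. ev (app (F * dual_gen i) p) = ev (app F' p))"
    by blast
qed

lemma adjoint_Top: "1 \<le> i \<Longrightarrow> i \<le> n \<Longrightarrow> adjoint (Top i) (dual.Top i)"
  using adjoint_gen[of i] by (simp add: dual_gen_def)

lemma adjoint_conj: "1 \<le> i \<Longrightarrow> i \<le> n \<Longrightarrow> adjoint A A' \<Longrightarrow> adjoint (Top i * A * Top i) (dual.Top i * A' * dual.Top i)"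
  using adjoint_mult[OF adjoint_mult[OF adjoint_Top] adjoint_Top, of i A A' i] by (simp add: mult.assoc)

text \<open>\<open>V\<close> and \<open>dual.V\<close> obey the same recursion, whose palindromic
  form is compatible with reversing products.\<close>

lemma adjoint_V: "1 \<le> i \<Longrightarrow> i \<le> n \<Longrightarrow> adjoint (V i) (dual.V i)"
proof (rotate_tac, induction i rule: inc_induct)
  case base
  then show ?case using adjoint_Top[of n] by (simp add: V_n dual.V_n)
next
  case (step i)
  have "adjoint (scal (par_t P)) (scal (par_t (sigma P)))"
    using adjoint_scal by (simp add: sigma_sel)
  then have "adjoint (scal (par_t P) * Top i) (dual.Top i * scal (par_t (sigma P)))"
    using step by (intro adjoint_mult adjoint_Top) auto
  then show ?case
    using step V_rec[of i] dual.V_rec[of i] adjoint_conj[of i "V (Suc i)"]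
    by (auto simp: scal_right intro!: adjoint_add)
qed

text \<open>\<open>Z 1 - V 1\<close> is \<open>U\<close>, adjoint to the dual affine generator
  \<open>dual.R 1\<close>; both are then conjugated by corresponding letters.\<close>

lemma adjoint_ZV: "1 \<le> i \<Longrightarrow> i \<le> n \<Longrightarrow> adjoint (Z i - V i) (dual.R i)"
proof (induction i rule: nat_induct_at_least)
  case base
  then show ?case using adjoint_gen[of 0] dual.R_1 by (simp add: dual_gen_def U_def)
next
  case (Suc i)
  then show ?case
    using ZV_rec'[of i] dual.R_rec[of i] adjoint_conj[of i "Z i - V i"] by auto
qed

lemma adjoint_Z: "1 \<le> i \<Longrightarrow> i \<le> n \<Longrightarrow> adjoint (Z i) (dual.Y i)"
  using adjoint_add[OF adjoint_V adjoint_ZV, of i i] by (simp add: dual.Y_def)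

lemma adjoint_Mul:
  assumes "peval n (\<lambda>i. - dual.Y i) p B" shows "adjoint (Mul p) B"
  using assms
proof (induction rule: peval.induct)
  case (const c)
  then show ?case using adjoint_scal[of c] by (simp add: scal_def)
next
  case (var i)
  then show ?case using adjoint_uminus[OF adjoint_Z, of i] by (simp add: Z_def)
next
  case (add f A g B)
  then have "f \<in> Polys" "g \<in> Polys" using peval_polys polys_Polys by blast+
  then show ?case using add by (simp add: Mul_add adjoint_add)
next
  case (mult f A g B)
  then have "f \<in> Polys" "g \<in> Polys" using peval_polys polys_Polys by blast+
  then have "Mul (\<lambda>x. f x * g x) = Mul g * Mul f"
    by (simp add: Mul_mult[symmetric] mult.commute)
  then show ?case using mult by (simp add: adjoint_mult)
qed

text \<open>Write \<open>p\<close> as \<open>Mul p\<close> applied to \<open>1\<close> and move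
  \<open>Mul p\<close> to the other side. The result is a polynomial in \<open>W\<close> acting on
  \<open>1\<close>, where \<open>W\<close> has eigenvalues \<open>- gamma0 n P\<close>.\<close>

theorem pairing_symmetric:
  assumes p: "peval n (\<lambda>i. - dual.Y i) p B" and f: "peval n (\<lambda>i. - Y i) f F"
  shows "app F p (- gamma0 n (sigma P)) = app B f (- gamma0 n P)"
proof -
  have W: "(\<lambda>i. - Y i) = W" by (simp add: W_def fun_eq_iff)
  have pP: "p \<in> Polys" using p peval_polys polys_Polys by blast
  obtain F' where F': "peval n W (app B f) F'" "ev (app (F * Mul p) 1) = ev (app F' 1)"
    using adjoint_Mul[OF p] f Polys_1 unfolding W adjoint_def by blast
  have "app (Mul p) 1 = p" using pP by (simp add: app_Mul)
  then have "ev (app F p) = ev (app F' 1)" using F'(2) by (simp add: app_times_op)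
  also have "app F' 1 = cscale (app B f (- gamma0 n P)) 1"
  proof (rule peval_eigen[OF F'(1) Polys_1])
    fix i assume "i \<in> {1..n}"
    then show "app (W i) 1 = cscale ((- gamma0 n P) i) 1"
      by (simp only: W_def app_uminus_op Y_1_eigen uminus_apply cfun.scale_minus_left)
  qed
  finally show ?thesis by (simp add: ev_def cscale_def)
qed

end

section \<open>Shortest elements and spectral points\<close>

definition dot_int :: "nat \<Rightarrow> nat \<Rightarrow> (nat \<Rightarrow> int) \<Rightarrow> nat \<Rightarrow> int" where
  "dot_int n i l =
     (if i = 0 then l(1 := - l 1 - 1) else if i = n then l(n := - l n)
      else l(i := l (i + 1), i + 1 := l i))"

lemma pt_dot_int: "pt (dot_int n i l) = dot_gen n i (pt l)"
  by (auto simp: pt_def dot_int_def dot_gen_def gen_def fun_eq_iff)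

lemma pt_foldr_dot_int: "pt (foldr (dot_int n) ws l) = foldr (dot_gen n) ws (pt l)"
  by (induction ws) (auto simp: pt_dot_int)

lemma pt_inject: "pt l = pt m \<longleftrightarrow> l = m"
  by (auto simp: pt_def fun_eq_iff)

lemma pt_zero: "pt (\<lambda>_. 0) = 0"
  by (simp add: pt_def fun_eq_iff)

definition reachable :: "nat \<Rightarrow> (nat \<Rightarrow> int) \<Rightarrow> bool" where
  "reachable n l \<longleftrightarrow> (\<exists>ws. set ws \<subseteq> {0..n} \<and> foldr (dot_int n) ws (\<lambda>_. 0) = l)"

lemma reachable_0: "reachable n (\<lambda>_. 0)"
  unfolding reachable_def by (rule exI[of _ "[]"]) simp

lemma reachable_dot: "reachable n l \<Longrightarrow> i \<le> n \<Longrightarrow> reachable n (dot_int n i l)"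
  unfolding reachable_def by (metis (no_types, lifting) atLeastAtMost_iff foldr.simps(2) insert_subset
      le0 list.simps(15) o_apply)

text \<open>Conjugating \<open>s\<^sub>n\<close> and \<open>s\<^sub>0\<close> by adjacent transpositions gives sign changes and
  reflections \<open>z \<mapsto> - z - 1\<close> in an arbitrary coordinate; together they are the unit translations.\<close>

lemma reachable_neg:
  assumes "1 \<le> i" "i \<le> n" "reachable n l" shows "reachable n (l(i := - l i))"
  using assms(2,1,3)
proof (induction i arbitrary: l rule: inc_induct)
  case base
  then show ?case using reachable_dot[of n l n] by (simp add: dot_int_def del: fun_upd_apply)
next
  case (step i)
  let ?m = "dot_int n i l"
  have "reachable n ((?m)(Suc i := - ?m (Suc i)))"
    using step reachable_dot[of n l i] by (auto simp del: fun_upd_apply)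
  then have "reachable n (dot_int n i ((?m)(Suc i := - ?m (Suc i))))"
    using step reachable_dot by (auto simp del: fun_upd_apply)
  moreover have "dot_int n i ((?m)(Suc i := - ?m (Suc i))) = l(i := - l i)"
    using step by (auto simp: dot_int_def fun_eq_iff)
  ultimately show ?case by (simp only:)
qed

lemma reachable_flip:
  assumes "1 \<le> i" "i \<le> n" "reachable n l" shows "reachable n (l(i := - l i - 1))"
  using assms
proof (induction i arbitrary: l rule: nat_induct_at_least)
  case base
  then show ?case using reachable_dot[of n l 0] by (simp add: dot_int_def del: fun_upd_apply)
next
  case (Suc i)
  let ?m = "dot_int n i l"
  have "reachable n ((?m)(i := - ?m i - 1))"
    using Suc reachable_dot[of n l i] by (auto simp del: fun_upd_apply)
  then have "reachable n (dot_int n i ((?m)(i := - ?m i - 1)))"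
    using Suc reachable_dot by (auto simp del: fun_upd_apply)
  moreover have "dot_int n i ((?m)(i := - ?m i - 1)) = l(Suc i := - l (Suc i) - 1)"
    using Suc by (auto simp: dot_int_def fun_eq_iff)
  ultimately show ?case by (simp only:)
qed

lemma reachable_shift:
  assumes i: "1 \<le> i" "i \<le> n" and l: "reachable n l" shows "reachable n (l(i := z))"
proof -
  have up: "reachable n (m(i := m i + 1))" if "reachable n m" for m
    using reachable_neg[OF i reachable_flip[OF i that]] by (simp add: add.commute)
  have down: "reachable n (m(i := m i - 1))" if "reachable n m" for m
    using reachable_flip[OF i reachable_neg[OF i that]] by simp
  show ?thesis
  proof (induction z rule: int_induct[where k = "l i"])
    case base
    then show ?case using l by (simp only: fun_upd_triv)
  next
    case (step1 z)
    show ?case using up[OF step1(2)] by (simp only: fun_upd_same fun_upd_upd)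
  next
    case (step2 z)
    show ?case using down[OF step2(2)] by (simp only: fun_upd_same fun_upd_upd)
  qed
qed

lemma reachable_Lam:
  assumes "l \<in> Lam n" shows "reachable n l"
proof -
  have "k \<le> n \<Longrightarrow> reachable n (\<lambda>i. if i \<le> k then l i else 0)" for k
  proof (induction k)
    case 0
    have "(\<lambda>i. if i \<le> 0 then l i else 0) = (\<lambda>_. 0)"
      using assms by (auto simp: Lam_def)
    then show ?case using reachable_0 by simp
  next
    case (Suc k)
    then have "reachable n ((\<lambda>i. if i \<le> k then l i else 0)(Suc k := l (Suc k)))"
      by (intro reachable_shift) auto
    moreover have "(\<lambda>i. if i \<le> k then l i else 0)(Suc k := l (Suc k)) = (\<lambda>i. if i \<le> Suc k then l i else 0)"
      by (auto simp: fun_eq_iff)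
    ultimately show ?case by simp
  qed
  from this[of n] have "reachable n (\<lambda>i. if i \<le> n then l i else 0)" by simp
  moreover have "(\<lambda>i. if i \<le> n then l i else 0) = l"
    using assms by (auto simp: Lam_def fun_eq_iff)
  ultimately show ?thesis by simp
qed

text \<open>Minimality among group elements becomes minimality among words, because
  \<open>reduced_word\<close> attains \<open>cox_length\<close> and any word bounds the length of
  its product.\<close>

lemma u_elt_geodesic:
  assumes "l \<in> Lam n"
  shows "u_elt n l \<in> affW n"
    and "foldr (dot_int n) (reduced_word n (u_elt n l)) (\<lambda>_. 0) = l"
    and "\<And>ws. set ws \<subseteq> {0..n} \<Longrightarrow> foldr (dot_int n) ws (\<lambda>_. 0) = l \<Longrightarrow>
      length (reduced_word n (u_elt n l)) \<le> length ws"
proof -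
  let ?Q = "\<lambda>w. w \<in> affW n \<and> dot n w 0 = pt l"
  have Q: "?Q (foldr (gen n) ws)" "cox_length n (foldr (gen n) ws) \<le> length ws"
    if "set ws \<subseteq> {0..n}" "foldr (dot_int n) ws (\<lambda>_. 0) = l" for ws
  proof -
    have w: "word_of n (foldr (gen n) ws) ws" using that by (simp add: word_of_def)
    then show "?Q (foldr (gen n) ws)"
      using that by (auto simp: generated_def dot_word_of pt_foldr_dot_int pt_zero simp flip: that(2))
    show "cox_length n (foldr (gen n) ws) \<le> length ws"
      unfolding cox_length_def by (rule Least_le) (use w in blast)
  qed
  obtain ws where ws: "set ws \<subseteq> {0..n}" "foldr (dot_int n) ws (\<lambda>_. 0) = l"
    using reachable_Lam[OF assms] by (auto simp: reachable_def)
  have min: "?Q (u_elt n l)" "\<And>w. ?Q w \<Longrightarrow> cox_length n (u_elt n l) \<le> cox_length n w"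
    unfolding u_elt_def using arg_min_nat_lemma[of ?Q, OF Q(1)[OF ws]] by blast+
  show aff: "u_elt n l \<in> affW n" using min(1) by blast
  note red = word_of_reduced_word[OF aff]
  have "pt (foldr (dot_int n) (reduced_word n (u_elt n l)) (\<lambda>_. 0)) = pt l"
    using min(1) by (simp add: pt_foldr_dot_int pt_zero dot_def)
  then show "foldr (dot_int n) (reduced_word n (u_elt n l)) (\<lambda>_. 0) = l"
    by (simp add: pt_inject)
  fix ws' assume "set ws' \<subseteq> {0..n}" "foldr (dot_int n) ws' (\<lambda>_. 0) = l"
  then show "length (reduced_word n (u_elt n l)) \<le> length ws'"
    using min(2)[OF Q(1)] Q(2) red(2) order.trans by metis
qed

section \<open>Explicit spectral points\<close>

definition eta :: "int \<Rightarrow> complex" where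
  "eta z = (if 0 \<le> z then 1 else - 1)"

text \<open>The tie \<open>z = 0\<close> is decided by the order of the indices, so that for
  distinct \<open>i\<close> and \<open>j\<close>, exchanging them and negating \<open>z\<close>
  changes the sign.\<close>

definition eta_lex :: "nat \<Rightarrow> nat \<Rightarrow> int \<Rightarrow> complex" where
  "eta_lex i j z = (if i < j then eta z else - eta (- z))"

definition gvec_pair :: "(nat \<Rightarrow> int) \<Rightarrow> nat \<Rightarrow> nat \<Rightarrow> complex" where
  "gvec_pair l i j = eta_lex i j (l i - l j) + eta (l i + l j)"

text \<open>
  An explicit form of \<open>gamma n P l\<close>: the Weyl group element carrying \<open>gamma0\<close> to \<open>gamma n P l - l\<close>
  is recorded by the sides of the mirrors through \<open>l\<close> on which the base alcove lies.
\<close>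

definition gvec :: "nat \<Rightarrow> params \<Rightarrow> (nat \<Rightarrow> int) \<Rightarrow> point" where
  "gvec n P l i = (if i \<in> {1..n} then of_int (l i) + (par_t0 P + par_tn P) * eta (l i)
      + par_t P / 2 * (\<Sum>j \<in> {1..n} - {i}. gvec_pair l i j) else 0)"

lemma eta_minus: "z \<noteq> 0 \<Longrightarrow> eta (- z) = - eta z"
  by (simp add: eta_def)

lemma eta_reflect: "eta (- z - 1) = - eta z"
  by (simp add: eta_def)

lemma gvec_0: "gvec n P (\<lambda>_. 0) = gamma0 n P"
proof
  fix i
  have "(\<Sum>j \<in> {1..n} - {i}. gvec_pair (\<lambda>_. 0) i j) = 2 * of_nat (n - i)" if "i \<in> {1..n}"
  proof -
    have "(\<Sum>j \<in> {1..n} - {i}. gvec_pair (\<lambda>_. 0) i j) = (\<Sum>j \<in> {1..n} - {i}. if j \<in> {i<..n} then 2 else 0)"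
      by (rule sum.cong) (auto simp: gvec_pair_def eta_lex_def eta_def)
    also have "\<dots> = (\<Sum>j \<in> ({1..n} - {i}) \<inter> {i<..n}. 2)"
      by (subst sum.inter_restrict) auto
    also have "({1..n} - {i}) \<inter> {i<..n} = {i<..n}" by auto
    finally show ?thesis by simp
  qed
  then show "gvec n P (\<lambda>_. 0) i = gamma0 n P i"
    by (simp add: gvec_def gamma0_def eta_def)
qed

text \<open>A weight on the mirror would stay fixed while its spectral point is reflected, whence
  the assumption \<open>move\<close>. For a moved weight the signs in \<open>gvec\<close> change as
  the reflection dictates.\<close>

lemma gvec_step:
  assumes n: "1 \<le> n" and i: "i \<le> n" and move: "dot_int n i l \<noteq> l"
  shows "gvec n P (dot_int n i l) = dot_gen n i (gvec n P l)"
proof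
  fix k
  show "gvec n P (dot_int n i l) k = dot_gen n i (gvec n P l) k"
  proof (cases "k \<in> {1..n}")
    case False
    then show ?thesis
      using n i by (auto simp: gvec_def dot_gen_def gen_def)
  next
    case k: True
    let ?l = "dot_int n i l"
    consider "i = 0" | "i = n" "i \<noteq> 0" | "1 \<le> i" "i < n" using i by linarith
    then show ?thesis
    proof cases
      case 1
      have l: "?l = l(1 := - l 1 - 1)" "dot_int n 0 l = l(1 := - l 1 - 1)"
        using 1 by (simp_all add: dot_int_def)
      \<comment> \<open>By \<open>eta_reflect\<close>, each of the two signs in a pair becomes minus
        the other when \<open>k = 1\<close>, and becomes the other when
        \<open>j = 1\<close>.\<close>
      have pair: "gvec_pair ?l k j = (if k = 1 then - gvec_pair l k j else gvec_pair l k j)"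
        if "j \<in> {1..n} - {k}" for j
        using that k by (auto simp: l gvec_pair_def eta_lex_def eta_def)
      have "(\<Sum>j \<in> {1..n} - {k}. gvec_pair ?l k j) =
          (if k = 1 then - (\<Sum>j \<in> {1..n} - {k}. gvec_pair l k j) else (\<Sum>j \<in> {1..n} - {k}. gvec_pair l k j))"
        using pair by (simp add: sum_negf[symmetric])
      then show ?thesis
        using k 1 eta_reflect[of "l 1"] by (auto simp: gvec_def dot_gen_def l algebra_simps)
    next
      case 2
      have l: "?l = l(n := - l n)" "dot_int n n l = l(n := - l n)"
        using 2 n by (simp_all add: dot_int_def)
      have ln: "l n \<noteq> 0" using move l(1) by (metis fun_upd_triv minus_zero)
      have pair: "gvec_pair ?l k j = (if k = n then - gvec_pair l k j else gvec_pair l k j)"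
        if "j \<in> {1..n} - {k}" for j
        using that k by (auto simp: l gvec_pair_def eta_lex_def add.commute)
      have "(\<Sum>j \<in> {1..n} - {k}. gvec_pair ?l k j) =
          (if k = n then - (\<Sum>j \<in> {1..n} - {k}. gvec_pair l k j) else (\<Sum>j \<in> {1..n} - {k}. gvec_pair l k j))"
        using pair by (simp add: sum_negf[symmetric])
      then show ?thesis
        using k 2 eta_minus[OF ln] by (auto simp: gvec_def dot_gen_def gen_def l algebra_simps)
    next
      case 3
      define s where "s = (\<lambda>j. if j = i then i + 1 else if j = i + 1 then i else j)"
      have l: "?l j = l (s j)" for j using 3 by (auto simp: dot_int_def s_def)
      have li: "l i \<noteq> l (i + 1)"
      proof
        assume "l i = l (i + 1)"
        then have "?l x = l x" for x
          unfolding l by (auto simp: s_def)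
        then show False using move by blast
      qed
      have ss: "s (s j) = j" for j by (auto simp: s_def)
      have inj: "s a = s b \<longleftrightarrow> a = b" for a b by (metis ss)
      have sr: "s j \<in> {1..n} \<longleftrightarrow> j \<in> {1..n}" for j using 3 by (auto simp: s_def)
      have pair: "gvec_pair ?l k j = gvec_pair l (s k) (s j)" if "j \<noteq> k" for j
      proof -
        \<comment> \<open>Only the indices \<open>i\<close> and \<open>i + 1\<close> change their
          relative order, and \<open>li\<close> excludes a tie between them.\<close>
        have "eta_lex k j (l (s k) - l (s j)) = eta_lex (s k) (s j) (l (s k) - l (s j))"
          using that li by (auto simp: s_def eta_lex_def eta_def)
        then show ?thesis by (simp only: gvec_pair_def l)
      qed
      have "(\<Sum>j \<in> {1..n} - {k}. gvec_pair ?l k j) = (\<Sum>j \<in> {1..n} - {s k}. gvec_pair l (s k) j)"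
      proof (rule sum.reindex_bij_witness[of _ s s])
        fix a assume a: "a \<in> {1..n} - {k}"
        then show "s (s a) = a" "s a \<in> {1..n} - {s k}" "gvec_pair l (s k) (s a) = gvec_pair ?l k a"
          using ss sr[of a] pair[of a] inj[of a k] by (simp_all only: Diff_iff singleton_iff) auto
      next
        fix a assume a: "a \<in> {1..n} - {s k}"
        then show "s (s a) = a" "s a \<in> {1..n} - {k}"
          using ss[of a] ss[of k] sr[of a] by auto
      qed
      moreover have "s k \<in> {1..n}" using sr k by blast
      ultimately have "gvec n P ?l k = gvec n P l (s k)"
        using k by (simp only: gvec_def l if_True)
      also have "\<dots> = dot_gen n i (gvec n P l) k"
        using 3 by (auto simp: s_def dot_gen_def gen_def)
      finally show ?thesis .
    qed
  qed
qed

text \<open>Along a shortest word every letter moves the point, so that \<open>gvec_step\<close> applies.\<close>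

lemma gvec_word:
  assumes "1 \<le> n" "set ws \<subseteq> {0..n}"
    and "\<And>ws'. set ws' \<subseteq> {0..n} \<Longrightarrow> foldr (dot_int n) ws' (\<lambda>_. 0) = foldr (dot_int n) ws (\<lambda>_. 0) \<Longrightarrow>
      length ws \<le> length ws'"
  shows "foldr (dot_gen n) ws (gamma0 n P) = gvec n P (foldr (dot_int n) ws (\<lambda>_. 0))"
  using assms(2,3)
proof (induction ws)
  case Nil
  show ?case by (simp add: gvec_0)
next
  case (Cons i ws)
  have i: "i \<le> n" and ws: "set ws \<subseteq> {0..n}" using Cons.prems(1) by auto
  have "length ws \<le> length ws'"
    if "set ws' \<subseteq> {0..n}" "foldr (dot_int n) ws' (\<lambda>_. 0) = foldr (dot_int n) ws (\<lambda>_. 0)" for ws'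
    using Cons.prems(2)[of "i # ws'"] that i by simp
  then have IH: "foldr (dot_gen n) ws (gamma0 n P) = gvec n P (foldr (dot_int n) ws (\<lambda>_. 0))"
    using Cons.IH ws by blast
  \<comment> \<open>If the first letter fixed the point, \<open>ws\<close> would reach it with one
    letter less.\<close>
  have "dot_int n i (foldr (dot_int n) ws (\<lambda>_. 0)) \<noteq> foldr (dot_int n) ws (\<lambda>_. 0)"
    using Cons.prems(2)[OF ws] by auto
  then show ?case
    using gvec_step[OF assms(1) i] IH by simp
qed

lemma gamma_eq_gvec:
  assumes "1 \<le> n" "l \<in> Lam n"
  shows "gamma n P l = gvec n P l"
proof -
  note u = u_elt_geodesic[OF assms(2)]
  have "set (reduced_word n (u_elt n l)) \<subseteq> {0..n}"
    using word_of_reduced_word(1)[OF u(1)] by (simp add: word_of_def)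
  then show ?thesis
    using gvec_word[OF assms(1), of "reduced_word n (u_elt n l)" P] u(2,3)
    by (simp add: gamma_def dot_def)
qed

section \<open>Invariant polynomials at spectral points\<close>

lemma invariants_gen:
  assumes "f \<in> invariants n" "i \<in> {1..n}" shows "f (gen n i x) = f x"
proof -
  have "gen n i \<in> finW n"
    unfolding generated_def using assms(2) by (intro CollectI exI[of _ "[i]"]) (auto simp: fun_eq_iff)
  then have "act (gen n i) f = f" using assms(1) by (simp add: invariants_def)
  then show ?thesis by (metis act_def inv_gen)
qed

text \<open>Minus one is a product of sign changes, each conjugate to the last reflection by
  adjacent transpositions. This removes the signs from \<open>- Y\<close> and from the evaluation
  points of the pairing.\<close>

lemma invariants_neg:
  assumes f: "f \<in> invariants n" shows "f (- x) = f x"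
proof -
  have flip: "f (x(i := - x i)) = f x" if "i \<in> {1..n}" for i x
  proof -
    have "i \<le> n" "1 \<le> i" using that by auto
    then show ?thesis
    proof (induction i arbitrary: x rule: inc_induct)
      case base
      then show ?case using invariants_gen[OF f, of n x] by (simp add: gen_def del: fun_upd_apply)
    next
      case (step i)
      let ?y = "gen n i x"
      have "f (?y(Suc i := - ?y (Suc i))) = f ?y" using step by (auto simp del: fun_upd_apply)
      also have "\<dots> = f x" using step by (intro invariants_gen[OF f]) auto
      finally have "f (gen n i (?y(Suc i := - ?y (Suc i)))) = f x"
        using step by (subst invariants_gen[OF f]) (auto simp del: fun_upd_apply)
      moreover have "gen n i (?y(Suc i := - ?y (Suc i))) = x(i := - x i)"
        using step by (auto simp: gen_def fun_eq_iff)
      ultimately show ?case by (simp only:)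
    qed
  qed
  have "k \<le> n \<Longrightarrow> f (\<lambda>i. if i \<in> {1..k} then - x i else x i) = f x" for k
  proof (induction k)
    case (Suc k)
    let ?y = "\<lambda>i. if i \<in> {1..k} then - x i else x i"
    have "(\<lambda>i. if i \<in> {1..Suc k} then - x i else x i) = ?y(Suc k := - ?y (Suc k))"
      by (auto simp: fun_eq_iff)
    then show ?case using flip[of "Suc k" ?y] Suc by simp
  qed simp
  from this[of n] have "f (\<lambda>i. if i \<in> {1..n} then - x i else x i) = f x" by simp
  \<comment> \<open>\<open>- x\<close> also negates coordinates outside \<open>1\<close> to
    \<open>n\<close>, which \<open>f\<close> does not see.\<close>
  moreover have "f (- x) = f (\<lambda>i. if i \<in> {1..n} then - x i else x i)"
    using f by (intro polys_local[of f n]) (auto simp: invariants_def)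
  ultimately show ?thesis by simp
qed

text \<open>By \<open>gvec_step\<close> a generator either fixes the weight or reflects its spectral
  point, so the spectral points of one orbit are conjugate under the finite group.\<close>

lemma invariants_gamma_orbit:
  assumes f: "f \<in> invariants n" and n: "1 \<le> n" and l: "l \<in> Lam n" and m: "m \<in> orbit n l"
  shows "f (gamma n P m) = f (gamma n P l)"
proof -
  obtain ws where ws: "set ws \<subseteq> {1..n}" "pt m = foldr (gen n) ws (pt l)" and mL: "m \<in> Lam n"
    using m by (auto simp: orbit_def generated_def)
  have dot: "set ws \<subseteq> {1..n} \<Longrightarrow> foldr (gen n) ws x = foldr (dot_gen n) ws x" for x
    by (induction ws) (auto simp: dot_gen_def)
  have "m = foldr (dot_int n) ws l"
    using ws dot by (simp add: pt_inject[symmetric] pt_foldr_dot_int)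
  moreover have "set ws \<subseteq> {1..n} \<Longrightarrow> f (gvec n P (foldr (dot_int n) ws l)) = f (gvec n P l)"
  proof (induction ws)
    case (Cons i ws)
    let ?m = "foldr (dot_int n) ws l"
    have i: "i \<le> n" "i \<in> {1..n}" using Cons.prems by auto
    show ?case
    proof (cases "dot_int n i ?m = ?m")
      case False
      then have "gvec n P (dot_int n i ?m) = gen n i (gvec n P ?m)"
        using gvec_step[OF n i(1) False, of P] i(2) by (simp add: dot_gen_def)
      then show ?thesis using Cons invariants_gen[OF f i(2)] by simp
    qed (use Cons in auto)
  qed simp
  ultimately show ?thesis
    using ws(1) gamma_eq_gvec[OF n l] gamma_eq_gvec[OF n mL] by simp
qed

section \<open>Symmetric Wilson polynomials and their duality\<close>

lemma subspace_invariants: "cfun.subspace (invariants n)"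
  unfolding invariants_def
  by (rule cfun.subspaceI)
     (auto simp: act_def polys_0 polys_plus polys_cscale cscale_def fun_eq_iff simp del: zero_fun_apply plus_fun_apply,
      auto simp: fun_eq_iff polys_cscale[unfolded cscale_def])

text \<open>Dimension one supplies a nonzero element to rescale; two normalized elements differ by
  one that vanishes at the normalization point, hence by zero.\<close>

lemma sym_wilson_normalized:
  assumes "sym_wilson_well_defined n P l"
  shows "sym_wilson n P l \<in> P_space_inv n P l" "sym_wilson n P l (gamma0 n (sigma P)) = 1"
proof -
  let ?V = "P_space_inv n P l" and ?x = "gamma0 n (sigma P)"
  have sub: "cfun.subspace ?V"
    unfolding P_space_inv_def P_space_def
    by (intro cfun.subspace_inter cfun.subspace_span subspace_invariants)
  have dim: "cfun.dim ?V = 1" and nz: "\<And>p. p \<in> ?V \<Longrightarrow> p \<noteq> 0 \<Longrightarrow> p ?x \<noteq> 0"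
    using assms by (auto simp: sym_wilson_well_defined_def)
  have "\<exists>p \<in> ?V. p \<noteq> 0"
  proof (rule ccontr)
    assume "\<not> (\<exists>p \<in> ?V. p \<noteq> 0)"
    then have "?V = {0}" using cfun.subspace_0[OF sub] by blast
    then have "cfun.dim ?V = card ({} :: cfun set)"
      by (intro cfun.dim_eq_card) (auto simp: cfun.independent_empty)
    then show False using dim by simp
  qed
  then obtain p where p: "p \<in> ?V" "p ?x \<noteq> 0" using nz by blast
  define q where "q = cscale (1 / p ?x) p"
  have "q \<in> ?V"
    unfolding q_def by (rule cfun.subspace_scale[OF sub p(1)])
  moreover have "q ?x = 1"
    using p(2) by (simp add: q_def cscale_def)
  ultimately have q: "q \<in> ?V" "q ?x = 1" .
  have "sym_wilson n P l = q"
    unfolding sym_wilson_def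
  proof (rule the_equality)
    fix r assume r: "r \<in> ?V \<and> r ?x = 1"
    then have "r - q \<in> ?V" "(r - q) ?x = 0" using q cfun.subspace_diff[OF sub] by auto
    then show "r = q" using nz by fastforce
  qed (use q in auto)
  with q show "sym_wilson n P l \<in> ?V" "sym_wilson n P l ?x = 1" by auto
qed

context wilson
begin

text \<open>\<open>F\<close> acts on each nonsymmetric polynomial of the orbit by
  \<open>f (- gamma n P m)\<close>. Invariance makes these eigenvalues equal, so one eigenspace
  contains the whole span.\<close>

lemma peval_P_space:
  assumes F: "peval n (\<lambda>i. - Y i) f F" and f: "f \<in> invariants n"
    and l: "l \<in> Lam n" and p: "p \<in> P_space n P l"
  shows "app F p = cscale (f (gamma n P l)) p"
proof -
  let ?c = "f (gamma n P l)"
  let ?E = "{p \<in> Polys. app F p = cscale ?c p}"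
  have "nonsym_wilson n P m \<in> ?E" if m: "m \<in> orbit n l" for m
  proof -
    have mL: "m \<in> Lam n" using m by (simp add: orbit_def)
    have w: "weight (nonsym_wilson n P m) (gamma n P m)"
      by (rule weight_nonsym_wilson) (rule u_elt_geodesic(1)[OF mL])
    then have pol: "nonsym_wilson n P m \<in> Polys" using polys_Polys by (auto simp: weight_def)
    have "app F (nonsym_wilson n P m) = cscale (f (- gamma n P m)) (nonsym_wilson n P m)"
    proof (rule peval_eigen[OF F pol])
      fix i assume "i \<in> {1..n}"
      then have "app (Y i) (nonsym_wilson n P m) = cscale (gamma n P m i) (nonsym_wilson n P m)"
        using w by (simp add: weight_def)
      then show "app (- Y i) (nonsym_wilson n P m) = cscale ((- gamma n P m) i) (nonsym_wilson n P m)"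
        by (simp only: app_uminus_op uminus_apply cfun.scale_minus_left)
    qed
    also have "f (- gamma n P m) = ?c"
      using invariants_neg[OF f] invariants_gamma_orbit[OF f _ l m] n_ge_2 by simp
    finally show ?thesis using pol by simp
  qed
  then have "nonsym_wilson n P ` orbit n l \<subseteq> ?E" by blast
  moreover have "cfun.subspace ?E"
  proof (rule cfun.subspaceI)
    show "0 \<in> ?E" by (simp del: zero_fun_apply)
    show "x + y \<in> ?E" if "x \<in> ?E" "y \<in> ?E" for x y
      using that by (simp add: app_add Polys_plus cfun.scale_right_distrib del: plus_fun_apply)
    show "cscale c x \<in> ?E" if "x \<in> ?E" for c x
      using that by (simp add: app_cscale Polys_cscale mult.commute)
  qed
  ultimately have "P_space n P l \<subseteq> ?E"
    unfolding P_space_def by (rule cfun.span_minimal)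
  then show ?thesis using p by blast
qed

end

lemma sigma_sigma: "sigma (sigma P) = P"
  by (simp add: sigma_def)

theorem (in wilson_pair) sym_wilson_duality:
  assumes l: "l \<in> Lam n" "sym_wilson_well_defined n P l"
    and m: "m \<in> Lam n" "sym_wilson_well_defined n (sigma P) m"
  shows "sym_wilson n P l (gamma n (sigma P) m) = sym_wilson n (sigma P) m (gamma n P l)"
proof -
  define p where "p = sym_wilson n P l"
  define f where "f = sym_wilson n (sigma P) m"
  have p: "p \<in> P_space n P l" "p \<in> invariants n" "p (gamma0 n (sigma P)) = 1"
    using sym_wilson_normalized[OF l(2)] by (auto simp: p_def P_space_inv_def)
  have f: "f \<in> P_space n (sigma P) m" "f \<in> invariants n" "f (gamma0 n P) = 1"
    using sym_wilson_normalized[OF m(2)] by (auto simp: f_def P_space_inv_def sigma_sigma)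
  obtain F where F: "peval n (\<lambda>i. - Y i) f F"
    using peval_exists[of f n] f(2) by (auto simp: invariants_def)
  obtain B where B: "peval n (\<lambda>i. - dual.Y i) p B"
    using peval_exists[of p n] p(2) by (auto simp: invariants_def)
  \<comment> \<open>\<open>F\<close> acts on \<open>p\<close> by the eigenvalue
    \<open>f (gamma n P l)\<close>, and \<open>p\<close> has value \<open>1\<close> at
    \<open>- gamma0 n (sigma P)\<close> because it is even.\<close>
  have "f (gamma n P l) = app F p (- gamma0 n (sigma P))"
    unfolding peval_P_space[OF F f(2) l(1) p(1)] using p invariants_neg[OF p(2)]
    by (simp add: cscale_def)
  also have "\<dots> = app B f (- gamma0 n P)"
    by (rule pairing_symmetric[OF B F])
  also have "\<dots> = p (gamma n (sigma P) m)"
    unfolding dual.peval_P_space[OF B p(2) m(1) f(1)] using f invariants_neg[OF f(2)]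
    by (simp add: cscale_def)
  finally show ?thesis by (simp add: p_def f_def)
qed

theorem theorem6p9:
  fixes n :: nat and t0 u0 t tn un :: real and P :: params and l m :: "nat \<Rightarrow> int"
  assumes "n \<ge> 2"
    and "P = \<lparr>par_t0 = complex_of_real t0, par_u0 = complex_of_real u0, par_t = complex_of_real t,
              par_tn = complex_of_real tn, par_un = complex_of_real un\<rparr>"
    and "tn + un > 0" and "tn - un > 0"
    and "t0 + u0 + 1/2 > 0" and "t0 - u0 + 1/2 > 0" and "t > 0"
    and "\<forall>k \<in> Lam n. \<forall>k' \<in> Lam n. k \<noteq> k' \<longrightarrow> gamma n P k \<noteq> gamma n P k'"
    and "\<forall>k \<in> Lam n. \<forall>k' \<in> Lam n. k \<noteq> k' \<longrightarrow> gamma n (sigma P) k \<noteq> gamma n (sigma P) k'"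
    and "\<forall>k \<in> Lam_plus n. sym_wilson_well_defined n P k"
    and "\<forall>k \<in> Lam_plus n. sym_wilson_well_defined n (sigma P) k"
    and "l \<in> Lam_plus n" and "m \<in> Lam_plus n"
  shows "sym_wilson n P l (gamma n (sigma P) m) = sym_wilson n (sigma P) m (gamma n P l)"
proof -
  interpret wilson_pair n P by unfold_locales (rule assms(1))+
  show ?thesis
    by (rule sym_wilson_duality) (use assms(10-13) in \<open>auto simp: Lam_plus_def\<close>)
qed

end
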